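(* Let $d\ge 2$ and $n\ge 1$ be integers and set $\mathcal H_A=\mathcal H_B=\mathbb C^d$. There is a quantum channel \[ \Lambda_{d,n}:\mathrm D\bigl(\mathcal H_A^{\otimes n}\otimes\mathcal H_B^{\otimes n}\bigr)\longrightarrow \mathrm D(\mathcal H_A\otimes\mathcal H_B) \] which is an $(\epsilon_{d,n},0)$-disentangler, where \[ \epsilon_{d,n}:=\min\left\{1,\frac{\sqrt{d-1}}{2n}\right\}. \] Consequently, for every fixed $\epsilon\in(0,1)$ there is a constant $C_\epsilon>0$ (depending only on $\epsilon$) such that for every $d\ge2$ there is an $(\epsilon,0)$-disentangler $\mathrm D(\mathbb C^D)\to\mathrm D(\mathbb C^d\otimes\mathbb C^d)$ whose input dimension $D$ satisfies $\log D\le C_\epsilon\sqrt d\,\log d$. In particular, this holds with $(\epsilon,\delta)=(1/4,0)$.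
   Context: $\mathrm D(\mathcal H)$ denotes the density operators on a finite-dimensional complex Hilbert space $\mathcal H$. A quantum channel is (the restriction to states of) a completely positive trace-preserving linear map. $D_{\mathrm{tr}}(\rho,\sigma):=\frac12\|\rho-\sigma\|_1$ is trace distance. $\mathrm{SEP}(d,d):=\mathrm{conv}\{|u\rangle\langle u|\otimes|v\rangle\langle v|:u,v\in\mathbb C^d,\ \|u\|=\|v\|=1\}$. A channel $\Lambda:\mathrm D(\mathbb C^D)\to\mathrm D(\mathbb C^d\otimes\mathbb C^d)$ is an $(\epsilon,\delta)$-disentangler if (soundness) $\sup_{\rho\in\mathrm D(\mathbb C^D)}\ \inf_{\sigma\in\mathrm{SEP}(d,d)}D_{\mathrm{tr}}(\Lambda(\rho),\sigma)\le\epsilon$, and (coverage) $\sup_{\sigma\in\mathrm{SEP}(d,d)}\ \inf_{\rho\in\mathrm D(\mathbb C^D)}D_{\mathrm{tr}}(\Lambda(\rho),\sigma)\le\delta$. *)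

theory Defs
  imports
    Complex_Main
    "HOL-Library.Extended_Real"
    "Jordan_Normal_Form.Schur_Decomposition"
begin

text \<open>Operators on the Hilbert space of dimension \<open>n\<close> are the matrices in
  \<open>carrier_mat n n\<close> over the complex numbers.  The tensor product of spaces of dimensions \<open>m\<close>
  and \<open>n\<close> is the space of dimension \<open>m * n\<close>, with the basis vector \<open>e_i \<otimes> e_j\<close> at index
  \<open>i * n + j\<close>.\<close>

definition mtrace :: "complex mat \<Rightarrow> complex" where
  "mtrace A = (\<Sum>i<dim_row A. A $$ (i, i))"

text \<open>The order on the complex numbers is that of \<open>Complex_Order\<close>: \<open>0 \<le> z\<close> says that \<open>z\<close> is
  real and nonnegative, so positivity includes self-adjointness.\<close>

definition psd :: "nat \<Rightarrow> complex mat \<Rightarrow> bool" where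
  "psd n A \<longleftrightarrow> A \<in> carrier_mat n n \<and> (\<forall>v\<in>carrier_vec n. 0 \<le> (A *\<^sub>v v) \<bullet>c v)"

definition density_ops :: "nat \<Rightarrow> complex mat set" where
  "density_ops n = {\<rho>. psd n \<rho> \<and> mtrace \<rho> = 1}"

text \<open>The trace norm is the sum of the singular values, i.e. of the square roots of the (real,
  nonnegative) eigenvalues of \<open>X\<^sup>* X\<close>, counted with multiplicity.\<close>

definition trace_norm :: "complex mat \<Rightarrow> real" where
  "trace_norm X =
    (let G = mat_adjoint X * X
     in \<Sum>l | eigenvalue G l. real (order l (char_poly G)) * sqrt (Re l))"

definition trace_dist :: "complex mat \<Rightarrow> complex mat \<Rightarrow> real" where
  "trace_dist \<rho> \<sigma> = trace_norm (\<rho> - \<sigma>) / 2"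

definition kron :: "complex mat \<Rightarrow> complex mat \<Rightarrow> complex mat" where
  "kron A B = mat (dim_row A * dim_row B) (dim_col A * dim_col B)
    (\<lambda>(i, j). A $$ (i div dim_row B, j div dim_col B) * B $$ (i mod dim_row B, j mod dim_col B))"

definition ketbra :: "complex vec \<Rightarrow> complex mat" where
  "ketbra u = mat (dim_vec u) (dim_vec u) (\<lambda>(i, j). u $ i * conjugate (u $ j))"

definition unit_vectors :: "nat \<Rightarrow> complex vec set" where
  "unit_vectors n = {u \<in> carrier_vec n. u \<bullet>c u = 1}"

definition conv_mat :: "nat \<Rightarrow> complex mat set \<Rightarrow> complex mat set" where
  "conv_mat n S = {M. \<exists>(N::nat) (p :: nat \<Rightarrow> real) X.
      (\<forall>k<N. 0 \<le> p k \<and> X k \<in> S) \<and> (\<Sum>k<N. p k) = 1 \<and>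
      M = mat n n (\<lambda>(i, j). \<Sum>k<N. complex_of_real (p k) * X k $$ (i, j))}"

definition SEP :: "nat \<Rightarrow> complex mat set" where
  "SEP d = conv_mat (d * d)
     {kron (ketbra u) (ketbra v) | u v. u \<in> unit_vectors d \<and> v \<in> unit_vectors d}"

definition mat_linear :: "nat \<Rightarrow> nat \<Rightarrow> (complex mat \<Rightarrow> complex mat) \<Rightarrow> bool" where
  "mat_linear D m \<Phi> \<longleftrightarrow>
     (\<forall>A\<in>carrier_mat D D. \<Phi> A \<in> carrier_mat m m) \<and>
     (\<forall>A\<in>carrier_mat D D. \<forall>B\<in>carrier_mat D D. \<Phi> (A + B) = \<Phi> A + \<Phi> B) \<and>
     (\<forall>c. \<forall>A\<in>carrier_mat D D. \<Phi> (c \<cdot>\<^sub>m A) = c \<cdot>\<^sub>m \<Phi> A)"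

text \<open>\<open>ampliation k D m \<Phi>\<close> is \<open>id_k \<otimes> \<Phi>\<close>: it applies \<open>\<Phi>\<close> to each of the \<open>D \<times> D\<close> blocks of a
  \<open>kD \<times> kD\<close> matrix.\<close>

definition mat_block :: "nat \<Rightarrow> complex mat \<Rightarrow> nat \<Rightarrow> nat \<Rightarrow> complex mat" where
  "mat_block D X a b = mat D D (\<lambda>(i, j). X $$ (a * D + i, b * D + j))"

definition ampliation ::
  "nat \<Rightarrow> nat \<Rightarrow> nat \<Rightarrow> (complex mat \<Rightarrow> complex mat) \<Rightarrow> complex mat \<Rightarrow> complex mat" where
  "ampliation k D m \<Phi> X = mat (k * m) (k * m)
     (\<lambda>(i, j). \<Phi> (mat_block D X (i div m) (j div m)) $$ (i mod m, j mod m))"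

lemma ampliation_kron:
  assumes \<Phi>: "mat_linear D m \<Phi>" and A: "A \<in> carrier_mat k k" and B: "B \<in> carrier_mat D D"
  shows "ampliation k D m \<Phi> (kron A B) = kron A (\<Phi> B)"
proof -
  have PB: "\<Phi> B \<in> carrier_mat m m" using \<Phi> B by (auto simp: mat_linear_def)
  have lt: "a * D + i < k * D" if "a < k" "i < D" for a i
  proof -
    have "a * D + i < Suc a * D" using that by simp
    also have "\<dots> \<le> k * D" using that by (intro mult_le_mono1) simp
    finally show ?thesis .
  qed
  have bl: "mat_block D (kron A B) a b = A $$ (a, b) \<cdot>\<^sub>m B" if "a < k" "b < k" for a b
    using A B that by (intro eq_matI) (auto simp: mat_block_def kron_def lt)
  show ?thesis
  proof (intro eq_matI)
    fix i j assume "i < dim_row (kron A (\<Phi> B))" "j < dim_col (kron A (\<Phi> B))"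
    hence ij: "i < k * m" "j < k * m" using A PB by (auto simp: kron_def)
    hence m: "0 < m" by (cases m) auto
    have d: "i div m < k" "j div m < k"
      using ij by (simp_all add: less_mult_imp_div_less)
    have "\<Phi> (A $$ (i div m, j div m) \<cdot>\<^sub>m B) = A $$ (i div m, j div m) \<cdot>\<^sub>m \<Phi> B"
      using \<Phi> B by (auto simp: mat_linear_def)
    thus "ampliation k D m \<Phi> (kron A B) $$ (i, j) = kron A (\<Phi> B) $$ (i, j)"
      using ij d m A PB by (simp add: ampliation_def bl) (simp add: kron_def)
  qed (use A PB in \<open>auto simp: ampliation_def kron_def\<close>)
qed

definition completely_positive :: "nat \<Rightarrow> nat \<Rightarrow> (complex mat \<Rightarrow> complex mat) \<Rightarrow> bool" where
  "completely_positive D m \<Phi> \<longleftrightarrow>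
     (\<forall>k X. psd (k * D) X \<longrightarrow> psd (k * m) (ampliation k D m \<Phi> X))"

definition trace_preserving :: "nat \<Rightarrow> (complex mat \<Rightarrow> complex mat) \<Rightarrow> bool" where
  "trace_preserving D \<Phi> \<longleftrightarrow> (\<forall>A\<in>carrier_mat D D. mtrace (\<Phi> A) = mtrace A)"

definition quantum_channel :: "nat \<Rightarrow> nat \<Rightarrow> (complex mat \<Rightarrow> complex mat) \<Rightarrow> bool" where
  "quantum_channel D m \<Lambda> \<longleftrightarrow>
     (\<exists>\<Phi>. mat_linear D m \<Phi> \<and> completely_positive D m \<Phi> \<and> trace_preserving D \<Phi> \<and>
          (\<forall>\<rho>\<in>density_ops D. \<Lambda> \<rho> = \<Phi> \<rho>))"

text \<open>Suprema and infima are taken in the extended reals, where they always exist.\<close>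

definition disentangler ::
  "nat \<Rightarrow> nat \<Rightarrow> real \<Rightarrow> real \<Rightarrow> (complex mat \<Rightarrow> complex mat) \<Rightarrow> bool" where
  "disentangler D d \<epsilon> \<delta> \<Lambda> \<longleftrightarrow>
     quantum_channel D (d * d) \<Lambda> \<and>
     (SUP \<rho>\<in>density_ops D. INF \<sigma>\<in>SEP d. ereal (trace_dist (\<Lambda> \<rho>) \<sigma>)) \<le> ereal \<epsilon> \<and>
     (SUP \<sigma>\<in>SEP d. INF \<rho>\<in>density_ops D. ereal (trace_dist (\<Lambda> \<rho>) \<sigma>)) \<le> ereal \<delta>"

end

theory Submission
  imports
    "HOL-Analysis.Function_Topology"
    "HOL-Analysis.Topology_Euclidean_Space"
    "HOL-Analysis.Convex"
    Defs
begin

text \<open>Let \<open>S\<close> be the span of the vectors \<open>u\<^sup>\<otimes>\<^sup>n \<otimes> v\<^sup>\<otimes>\<^sup>n\<close>.  The channel projects onto \<open>S\<close> and keeps one copy of each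
  system; if the projection fails, it outputs a fixed product state.  Coverage is immediate.  For
  soundness, the minimax theorem reduces the claim to: for every observable \<open>0 \<le> W \<le> 1\<close> on one copy of each
  system, each eigenvalue \<open>\<mu>\<close> of the compression of \<open>W \<otimes> 1\<close> to \<open>S\<close> is at most
  \<open>\<langle>uv|W|uv\<rangle> + \<surd>(d - 1) / (2 n)\<close> for some unit vectors \<open>u, v\<close>.

  Given an eigenvector \<open>\<Psi>\<close>, choose \<open>u, v\<close> maximizing \<open>|f|\<close> for \<open>f(u, v) = \<langle>u\<^sup>\<otimes>\<^sup>n \<otimes> v\<^sup>\<otimes>\<^sup>n | \<Psi>\<rangle>\<close>.  Evaluating the eigenvalue
  equation there gives \<open>\<mu> f = \<langle>W uv | g\<rangle>\<close>, where \<open>g\<close> is the contraction of \<open>\<Psi>\<close> with \<open>n - 1\<close> copies of \<open>u\<close> and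
  of \<open>v\<close>.  At a maximum the first derivatives of \<open>f\<close> orthogonal to \<open>u\<close> and \<open>v\<close> vanish and the mixed second derivative
  has operator norm at most \<open>n |f|\<close>; hence \<open>g = f uv + \<Delta>\<close> with \<open>\<Delta>\<close> supported on the orthogonal complements of
  \<open>u\<close> and \<open>v\<close>, of operator norm at most \<open>|f| / n\<close> and thus of Hilbert--Schmidt norm at most \<open>\<surd>(d - 1) |f| / n\<close>.
  The component of \<open>W uv\<close> orthogonal to \<open>uv\<close> has norm at most \<open>1 / 2\<close>, since \<open>W\<^sup>2 \<le> W\<close>.\<close>

section \<open>Vectors as functions on the natural numbers\<close>

text \<open>The factor \<open>1 / n\<close> comes from a count of slots. Displacing \<open>u\<close>
  and \<open>v\<close> by \<open>r\<close> along orthogonal unit vectors \<open>z\<close>,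
  \<open>w\<close> enlarges the permitted size of \<open>f\<close> by (1 + r^2)^n, that is by n r^2
  to second order, whereas the mixed term of \<open>f\<close> collects n^2 choices of one slot in
  each system. So n^2 |<z w | g>| \<le> n |f|, and dividing by n^2 gives the deviation bound. All
  estimates are relative to |f|, which cancels at the end: it does not matter how small the largest
  overlap of a highly entangled \<Psi> with product powers is, only that it is nonzero. This is why
  \<Psi> has to be taken inside S. On the minimax side an observable is an orthonormal basis with
  weights in [0, 1], and the trace norm ball is described by differences P - Q of positive matrices
  of bounded trace. The claim becomes that 0 is approached by the convex set of all \<rho> -
  \<sigma> - (P - Q), which an iteration with explicit rate settles.\<close>

definition cip :: "nat \<Rightarrow> (nat \<Rightarrow> complex) \<Rightarrow> (nat \<Rightarrow> complex) \<Rightarrow> complex" where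
  "cip n x y = (\<Sum>i<n. cnj (x i) * y i)"

definition nsq :: "nat \<Rightarrow> (nat \<Rightarrow> complex) \<Rightarrow> real" where
  "nsq n x = (\<Sum>i<n. (cmod (x i))\<^sup>2)"

definition mapply :: "nat \<Rightarrow> (nat \<Rightarrow> nat \<Rightarrow> complex) \<Rightarrow> (nat \<Rightarrow> complex) \<Rightarrow> nat \<Rightarrow> complex" where
  "mapply n A x = (\<lambda>i. \<Sum>j<n. A i j * x j)"

definition hermitian :: "nat \<Rightarrow> (nat \<Rightarrow> nat \<Rightarrow> complex) \<Rightarrow> bool" where
  "hermitian n A \<longleftrightarrow> (\<forall>i<n. \<forall>j<n. A i j = cnj (A j i))"

definition orthonormal :: "nat \<Rightarrow> nat \<Rightarrow> (nat \<Rightarrow> nat \<Rightarrow> complex) \<Rightarrow> bool" where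
  "orthonormal n m e \<longleftrightarrow> (\<forall>k<m. \<forall>l<m. cip n (e k) (e l) = (if k = l then 1 else 0))"

lemma mult_indicator: "c * (if P then 1 else 0) = (if P then c else (0::complex))"
  by simp

lemma cip_add_right: "cip n x (\<lambda>i. y i + z i) = cip n x y + cip n x z"
  by (simp add: cip_def distrib_left sum.distrib)

lemma cip_diff_right: "cip n x (\<lambda>i. y i - z i) = cip n x y - cip n x z"
  by (simp add: cip_def right_diff_distrib sum_subtractf)

lemma cip_scale_right: "cip n x (\<lambda>i. a * y i) = a * cip n x y"
  by (simp add: cip_def sum_distrib_left mult_ac)

lemma cip_sum_right: "cip n x (\<lambda>i. \<Sum>k\<in>K. y k i) = (\<Sum>k\<in>K. cip n x (y k))"
  by (simp add: cip_def sum_distrib_left) (rule sum.swap)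

lemma cip_commute: "cip n y x = cnj (cip n x y)"
  by (simp add: cip_def mult_ac)

lemma cip_add_left: "cip n (\<lambda>i. y i + z i) x = cip n y x + cip n z x"
  by (simp add: cip_def distrib_right sum.distrib)

lemma cip_diff_left: "cip n (\<lambda>i. y i - z i) x = cip n y x - cip n z x"
  by (simp add: cip_def left_diff_distrib sum_subtractf)

lemma cip_scale_left: "cip n (\<lambda>i. a * y i) x = cnj a * cip n y x"
  by (simp add: cip_def sum_distrib_left mult_ac)

lemma cip_sum_left: "cip n (\<lambda>i. \<Sum>k\<in>K. y k i) x = (\<Sum>k\<in>K. cip n (y k) x)"
  by (simp add: cip_def sum_distrib_right) (rule sum.swap)

lemmas cip_linear = cip_add_right cip_diff_right cip_scale_right cip_sum_right
  cip_add_left cip_diff_left cip_scale_left cip_sum_left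

lemma cip_cong: "(\<And>i. i < n \<Longrightarrow> x i = x' i) \<Longrightarrow> (\<And>i. i < n \<Longrightarrow> y i = y' i) \<Longrightarrow> cip n x y = cip n x' y'"
  by (simp add: cip_def)

lemma cip_self: "cip n x x = of_real (nsq n x)"
  by (simp add: cip_def nsq_def complex_norm_square[symmetric] mult.commute flip: of_real_power)

lemma nsq_nonneg [simp]: "0 \<le> nsq n x"
  by (simp add: nsq_def sum_nonneg)

lemma nsq_eq_0: "nsq n x = 0 \<Longrightarrow> i < n \<Longrightarrow> x i = 0"
  by (simp add: nsq_def sum_nonneg_eq_0_iff)

lemma nsq_scale: "nsq n (\<lambda>i. a * x i) = (cmod a)\<^sup>2 * nsq n x"
  by (simp add: nsq_def norm_mult power_mult_distrib sum_distrib_left)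

lemma nsq_cong: "(\<And>i. i < n \<Longrightarrow> x i = y i) \<Longrightarrow> nsq n x = nsq n y"
  by (simp add: nsq_def)

lemma nsq_add: "nsq n (\<lambda>i. x i + y i) = nsq n x + nsq n y + 2 * Re (cip n x y)"
proof -
  have "complex_of_real (nsq n (\<lambda>i. x i + y i)) = of_real (nsq n x + nsq n y) + (cip n x y + cnj (cip n x y))"
    by (simp add: cip_self[symmetric] cip_linear cip_commute[of n y x])
  also have "\<dots> = of_real (nsq n x + nsq n y + 2 * Re (cip n x y))"
    by (simp add: complex_add_cnj)
  finally show ?thesis by (simp only: of_real_eq_iff)
qed

lemma cauchy_schwarz_sum:
  fixes f g :: "'i \<Rightarrow> complex"
  shows "(cmod (\<Sum>i\<in>I. f i * g i))\<^sup>2 \<le> (\<Sum>i\<in>I. (cmod (f i))\<^sup>2) * (\<Sum>i\<in>I. (cmod (g i))\<^sup>2)"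
proof -
  have "cmod (\<Sum>i\<in>I. f i * g i) \<le> (\<Sum>i\<in>I. cmod (f i) * cmod (g i))"
    by (rule sum_norm_le) (simp add: norm_mult)
  hence "(cmod (\<Sum>i\<in>I. f i * g i))\<^sup>2 \<le> (\<Sum>i\<in>I. cmod (f i) * cmod (g i))\<^sup>2"
    by (rule power_mono) simp
  also have "\<dots> \<le> (\<Sum>i\<in>I. (cmod (f i))\<^sup>2) * (\<Sum>i\<in>I. (cmod (g i))\<^sup>2)"
    by (rule Cauchy_Schwarz_ineq_sum)
  finally show ?thesis .
qed

lemma cauchy_schwarz: "(cmod (cip n x y))\<^sup>2 \<le> nsq n x * nsq n y"
  using cauchy_schwarz_sum[of "\<lambda>i. cnj (x i)" y "{..<n}"] by (simp add: cip_def nsq_def)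

lemma hermitianD: "hermitian n A \<Longrightarrow> i < n \<Longrightarrow> j < n \<Longrightarrow> cnj (A i j) = A j i"
  unfolding hermitian_def by metis

lemma mapply_hermitian:
  assumes "hermitian n A"
  shows "cip n (mapply n A x) y = cip n x (mapply n A y)"
proof -
  have "cip n (mapply n A x) y = (\<Sum>i<n. \<Sum>j<n. cnj (A i j) * cnj (x j) * y i)"
    by (simp add: cip_def mapply_def sum_distrib_right)
  also have "\<dots> = (\<Sum>i<n. \<Sum>j<n. A j i * cnj (x j) * y i)"
    by (simp add: hermitianD[OF assms])
  also have "\<dots> = (\<Sum>j<n. \<Sum>i<n. A j i * cnj (x j) * y i)" by (rule sum.swap)
  also have "\<dots> = cip n x (mapply n A y)"
    by (simp add: cip_def mapply_def sum_distrib_left mult_ac)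
  finally show ?thesis .
qed

section \<open>Orthonormal families, Bessel's inequality and completeness\<close>

lemma orthonormal_cip_sum:
  assumes "orthonormal n m e" "k < m"
  shows "cip n (e k) (\<lambda>j. \<Sum>l<m. c l * e l j) = c k"
proof -
  have "(\<Sum>l<m. c l * cip n (e k) (e l)) = (\<Sum>l<m. c l * (if k = l then 1 else 0))"
    using assms by (intro sum.cong) (auto simp: orthonormal_def)
  also have "\<dots> = c k" using assms(2) by (simp add: mult_indicator)
  finally show ?thesis by (simp add: cip_linear)
qed

text \<open>Pythagoras for the \<open>i\<close>-th standard basis vector: its projection onto the
  span of the family has squared norm \<Sum>k. |e k i|^2. The residual in the second part doubles as
  an explicit vector orthogonal to the family.\<close>

lemma bessel_coordinate:
  assumes "orthonormal n m e" "i < n"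
  shows "(\<Sum>k<m. (cmod (e k i))\<^sup>2) \<le> 1"
    "nsq n (\<lambda>j. (if j = i then 1 else 0) - (\<Sum>k<m. cnj (e k i) * e k j)) = 1 - (\<Sum>k<m. (cmod (e k i))\<^sup>2)"
proof -
  let ?d = "\<lambda>j. if j = i then 1 else (0::complex)" and ?p = "\<lambda>j. \<Sum>k<m. cnj (e k i) * e k j"
  have d1: "cip n (e k) ?d = cnj (e k i)" for k using \<open>i < n\<close> by (simp add: cip_def mult_indicator)
  have d2: "cip n ?d (e k) = e k i" for k using d1[of k] cip_commute[of n ?d "e k"] by simp
  have pe: "cip n (e l) ?p = cnj (e l i)" if "l < m" for l
    using orthonormal_cip_sum[OF assms(1) that] .
  have pp: "cip n ?p ?p = (\<Sum>k<m. e k i * cnj (e k i))"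
    by (subst cip_sum_left) (auto simp: cip_scale_left pe)
  have s: "(\<Sum>k<m. e k i * cnj (e k i)) = of_real (\<Sum>k<m. (cmod (e k i))\<^sup>2)"
    by (simp add: complex_norm_square del: of_real_power)
  have "complex_of_real (nsq n (\<lambda>j. ?d j - ?p j)) = cip n ?d ?d - cip n ?d ?p - cip n ?p ?d + cip n ?p ?p"
    by (simp add: cip_self[symmetric] cip_diff_left cip_diff_right)
  also have "cip n ?d ?d = 1" using \<open>i < n\<close> by (simp add: cip_def mult_indicator)
  also have "cip n ?d ?p = (\<Sum>k<m. e k i * cnj (e k i))" by (simp add: cip_linear d2) (simp add: mult.commute)
  also have "cip n ?p ?d = (\<Sum>k<m. e k i * cnj (e k i))" by (simp add: cip_linear d1)
  finally have "complex_of_real (nsq n (\<lambda>j. ?d j - ?p j)) = of_real (1 - (\<Sum>k<m. (cmod (e k i))\<^sup>2))"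
    by (simp add: pp s)
  thus eq: "nsq n (\<lambda>j. ?d j - ?p j) = 1 - (\<Sum>k<m. (cmod (e k i))\<^sup>2)" by (simp only: of_real_eq_iff)
  show "(\<Sum>k<m. (cmod (e k i))\<^sup>2) \<le> 1"
    using eq nsq_nonneg[of n "\<lambda>j. ?d j - ?p j"] by linarith
qed

lemma orthonormal_nsq: "orthonormal n m e \<Longrightarrow> k < m \<Longrightarrow> nsq n (e k) = 1"
  using cip_self[of n "e k"] by (simp add: orthonormal_def)

text \<open>Double counting of the m by n array of squared moduli. Together with the bound 1 per
  coordinate it yields both m \<le> n and, in the case of equality, completeness.\<close>

lemma orthonormal_sum_coordinates:
  assumes "orthonormal n m e"
  shows "(\<Sum>i<n. \<Sum>k<m. (cmod (e k i))\<^sup>2) = real m"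
proof -
  have "(\<Sum>i<n. \<Sum>k<m. (cmod (e k i))\<^sup>2) = (\<Sum>k<m. nsq n (e k))"
    unfolding nsq_def by (rule sum.swap)
  thus ?thesis using orthonormal_nsq[OF assms] by simp
qed

lemma orthonormal_le_dim:
  assumes "orthonormal n m e"
  shows "m \<le> n"
proof -
  have "real m = (\<Sum>i<n. \<Sum>k<m. (cmod (e k i))\<^sup>2)" by (simp add: orthonormal_sum_coordinates[OF assms])
  also have "\<dots> \<le> (\<Sum>i<n. 1)" using bessel_coordinate(1)[OF assms] by (intro sum_mono) simp
  finally show ?thesis by simp
qed

text \<open>The equality case of Bessel: n numbers that are at most 1 and sum to n are all 1, so
  every standard basis vector has zero residual.\<close>

lemma orthonormal_complete:
  assumes "orthonormal n n e" "i < n" "j < n"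
  shows "(\<Sum>k<n. e k i * cnj (e k j)) = (if i = j then 1 else 0)"
proof -
  have *: "(\<Sum>i<n. 1 - (\<Sum>k<n. (cmod (e k i))\<^sup>2)) = 0"
    using orthonormal_sum_coordinates[OF assms(1)] by (simp add: sum_subtractf)
  have "\<forall>i\<in>{..<n}. 1 - (\<Sum>k<n. (cmod (e k i))\<^sup>2) = 0"
    using * bessel_coordinate(1)[OF assms(1)]
    by (subst (asm) sum_nonneg_eq_0_iff) (auto simp: algebra_simps)
  hence "nsq n (\<lambda>i. (if i = j then 1 else 0) - (\<Sum>k<n. cnj (e k j) * e k i)) = 0"
    using bessel_coordinate(2)[OF assms(1,3)] assms(3) by simp
  from nsq_eq_0[OF this assms(2)] show ?thesis by (simp add: mult.commute)
qed

lemma orthonormal_extend: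
  assumes "orthonormal n m e" "\<And>k. k < m \<Longrightarrow> cip n (e k) x = 0" "nsq n x = 1"
  shows "orthonormal n (Suc m) (e(m := x))"
proof -
  have "cip n x (e k) = 0" if "k < m" for k using assms(2)[OF that] cip_commute[of n x "e k"] by simp
  thus ?thesis using assms cip_self[of n x] by (auto simp: orthonormal_def less_Suc_eq)
qed

lemma orthonormal_residual:
  assumes "orthonormal n m e" "k < m"
  shows "cip n (e k) (\<lambda>j. x j - (\<Sum>l<m. cip n (e l) x * e l j)) = 0"
  using orthonormal_cip_sum[OF assms, of "\<lambda>l. cip n (e l) x"] by (simp add: cip_diff_right)

lemma unit_normalize:
  assumes "nsq n x \<noteq> 0"
  shows "nsq n (\<lambda>i. of_real (1 / sqrt (nsq n x)) * x i) = 1"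
  using assms nsq_nonneg[of n x] by (subst nsq_scale) (simp add: power_divide norm_divide)

text \<open>Vectors are functions on all of \<open>nat\<close>; freezing the irrelevant coordinates at \<open>0\<close> makes
  the unit sphere compact in the product topology.\<close>

definition usphere :: "nat \<Rightarrow> (nat \<Rightarrow> complex) set" where
  "usphere n = {x. (\<forall>i\<ge>n. x i = 0) \<and> nsq n x = 1}"

lemma continuous_on_apply [continuous_intros]:
  "continuous_on S (\<lambda>x :: 'i \<Rightarrow> 'a::topological_space. x i)"
  by (rule continuous_on_subset[OF continuous_on_product_coordinates]) simp

lemma compact_usphere: "compact (usphere n)"
proof -
  define K where "K = (\<Pi>\<^sub>E i\<in>UNIV. (if i < n then cball 0 1 else {0 :: complex}))"
  have "compactin (product_topology (\<lambda>i. euclidean) UNIV) K"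
    unfolding K_def by (subst compactin_PiE) auto
  hence K: "compact K" by (simp add: euclidean_product_topology)
  have cont: "continuous_on UNIV (nsq n)"
    unfolding nsq_def by (intro continuous_intros)
  have closed: "closed {x. nsq n x = 1}"
    using continuous_closed_preimage[OF cont closed_UNIV, of "{1}"] by (simp add: vimage_def)
  have "cmod (x i) \<le> 1" if "nsq n x = 1" "i < n" for x i
  proof -
    have "(cmod (x i))\<^sup>2 \<le> nsq n x" unfolding nsq_def
      using that(2) by (intro member_le_sum) auto
    hence "(cmod (x i))\<^sup>2 \<le> 1\<^sup>2" using that(1) by simp
    thus ?thesis using power2_le_imp_le[of "cmod (x i)" 1] by simp
  qed
  hence "usphere n = K \<inter> {x. nsq n x = 1}"
    by (auto simp: usphere_def K_def PiE_def Pi_def split: if_splits)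
  thus ?thesis using compact_Int_closed[OF K closed] by simp
qed

section \<open>The spectral theorem\<close>

text \<open>Divide by t and let t tend to 0. It turns a perturbation inequality at a maximum into
  the first-order condition.\<close>

lemma quadratic_bound_imp_nonpos:
  fixes a b :: real
  assumes "\<And>t. 0 < t \<Longrightarrow> t \<le> 1 \<Longrightarrow> a * t \<le> b * t\<^sup>2"
  shows "a \<le> 0"
proof (rule ccontr)
  assume "\<not> a \<le> 0"
  hence a: "a > 0" by simp
  define t where "t = min 1 (a / (2 * (\<bar>b\<bar> + 1)))"
  have t: "0 < t" "t \<le> 1" "t \<le> a / (2 * (\<bar>b\<bar> + 1))" using a by (auto simp: t_def)
  have "a * t \<le> b * t * t" using assms[OF t(1,2)] by (simp add: power2_eq_square mult_ac)
  hence "a \<le> b * t" using t(1) by simp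
  also have "\<dots> \<le> (\<bar>b\<bar> + 1) * t" using t(1) by (intro mult_right_mono) auto
  also have "\<dots> \<le> (\<bar>b\<bar> + 1) * (a / (2 * (\<bar>b\<bar> + 1)))" using t(3) by (intro mult_left_mono) auto
  also have "\<dots> = a / 2" by (simp add: field_simps add_pos_nonneg)
  finally show False using a by simp
qed

text \<open>The eigenvector is a maximizer of the Rayleigh quotient on the orthogonal complement of the family.\<close>

lemma eigenvector_orthogonal_to_family:
  assumes A: "hermitian n A" and e: "orthonormal n m e" and mn: "m < n"
    and eig: "\<And>k i. k < m \<Longrightarrow> i < n \<Longrightarrow> mapply n A (e k) i = of_real (l k) * e k i"
  shows "\<exists>x \<mu>. nsq n x = 1 \<and> (\<forall>k<m. cip n (e k) x = 0) \<and>
    (\<forall>i<n. mapply n A x i = of_real \<mu> * x i)"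
proof -
  define T where "T = usphere n \<inter> {x. \<forall>k<m. cip n (e k) x = 0}"
  have cont_cip: "continuous_on UNIV (cip n y)" for y
    unfolding cip_def by (intro continuous_intros)
  have "closed (\<Inter>k\<in>{..<m}. {x. cip n (e k) x = 0})"
    using continuous_closed_preimage[OF cont_cip closed_UNIV, of "{0}"]
    by (intro closed_INT) (simp add: vimage_def)
  moreover have "(\<Inter>k\<in>{..<m}. {x. cip n (e k) x = 0}) = {x. \<forall>k<m. cip n (e k) x = 0}" by auto
  ultimately have compT: "compact T"
    unfolding T_def using compact_Int_closed[OF compact_usphere] by simp
  \<comment> \<open>Since m < n, the squared entries sum to less than n, so some standard basis
    vector is not in the span of the family; its normalized residual shows that \<open>T\<close> is
    nonempty.\<close>
  have "\<exists>i<n. (\<Sum>k<m. (cmod (e k i))\<^sup>2) \<noteq> 1"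
  proof (rule ccontr)
    assume "\<not> ?thesis"
    hence "(\<Sum>i<n. \<Sum>k<m. (cmod (e k i))\<^sup>2) = real n" by simp
    thus False using orthonormal_sum_coordinates[OF e] mn by simp
  qed
  then obtain i where i: "i < n" "(\<Sum>k<m. (cmod (e k i))\<^sup>2) \<noteq> 1" by blast
  define y where "y = (\<lambda>j. (if j = i then 1 else 0) - (\<Sum>k<m. cnj (e k i) * e k j))"
  have y0: "nsq n y \<noteq> 0" using bessel_coordinate(2)[OF e i(1)] i(2) by (simp add: y_def)
  have ye: "cip n (e k) y = 0" if "k < m" for k
    using orthonormal_residual[OF e that, of "\<lambda>j. if j = i then 1 else 0"] i(1)
    by (simp add: y_def cip_def mult_indicator)
  define z where "z = (\<lambda>j. if j < n then of_real (1 / sqrt (nsq n y)) * y j else 0)"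
  have "nsq n z = 1" using unit_normalize[OF y0] by (simp add: z_def cong: nsq_cong)
  moreover have "cip n (e k) z = of_real (1 / sqrt (nsq n y)) * cip n (e k) y" for k
    unfolding cip_scale_right[symmetric] by (rule cip_cong) (auto simp: z_def)
  ultimately have "z \<in> T" using ye by (auto simp: T_def usphere_def z_def)
  hence "T \<noteq> {}" by blast
  moreover have "continuous_on T (\<lambda>x. Re (cip n x (mapply n A x)))"
    unfolding cip_def mapply_def by (intro continuous_intros)
  ultimately obtain x where x: "x \<in> T"
    and max: "\<And>w. w \<in> T \<Longrightarrow> Re (cip n w (mapply n A w)) \<le> Re (cip n x (mapply n A x))"
    using continuous_attains_sup[OF compT, of "\<lambda>x. Re (cip n x (mapply n A x))"] by blast
  define \<mu> where "\<mu> = Re (cip n x (mapply n A x))"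
  have x1: "nsq n x = 1" and xe: "\<And>k. k < m \<Longrightarrow> cip n (e k) x = 0"
    using x by (auto simp: T_def usphere_def)
  have real: "cip n w (mapply n A w) = of_real (Re (cip n w (mapply n A w)))" for w
  proof -
    have "cip n w (mapply n A w) = cnj (cip n w (mapply n A w))"
      using mapply_hermitian[OF A, of w w] cip_commute[of n "mapply n A w" w] by simp
    thus ?thesis by (simp add: complex_eq_iff)
  qed
  have mapply_scale: "mapply n A (\<lambda>i. c * w i) = (\<lambda>i. c * mapply n A w i)" for c w
    by (rule ext) (simp add: mapply_def sum_distrib_left mult_ac)
  have mapply_add: "mapply n A (\<lambda>i. v i + w i) = (\<lambda>i. mapply n A v i + mapply n A w i)" for v w
    by (rule ext) (simp add: mapply_def distrib_left sum.distrib)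
  \<comment> \<open>Homogeneity carries the maximality of \<open>x\<close> from unit vectors over to
    all vectors orthogonal to the family, so the perturbed vectors below need no
    normalization.\<close>
  have bound: "Re (cip n w (mapply n A w)) \<le> \<mu> * nsq n w" if we: "\<And>k. k < m \<Longrightarrow> cip n (e k) w = 0" for w
  proof (cases "nsq n w = 0")
    case True
    have "cip n w v = 0" for v
      using nsq_eq_0[OF True] by (simp add: cip_def)
    thus ?thesis using True by simp
  next
    case False
    define c where "c = 1 / sqrt (nsq n w)"
    define w' where "w' = (\<lambda>j. if j < n then of_real c * w j else 0)"
    have "nsq n w' = 1" using unit_normalize[OF False] by (simp add: w'_def c_def cong: nsq_cong)
    moreover have e': "cip n v w' = of_real c * cip n v w" for v
      unfolding cip_scale_right[symmetric] by (rule cip_cong) (auto simp: w'_def)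
    ultimately have "w' \<in> T" using we by (auto simp: T_def usphere_def w'_def)
    have m': "mapply n A w' i = of_real c * mapply n A w i" for i
      unfolding mapply_def sum_distrib_left by (intro sum.cong) (auto simp: w'_def)
    have "cip n w' (mapply n A w') = of_real c * of_real c * cip n w (mapply n A w)"
    proof -
      have "cip n w' (mapply n A w') = cip n (\<lambda>i. of_real c * w i) (\<lambda>i. of_real c * mapply n A w i)"
        by (rule cip_cong) (simp add: w'_def, simp add: m')
      thus ?thesis by (simp add: cip_scale_left cip_scale_right)
    qed
    hence "c\<^sup>2 * Re (cip n w (mapply n A w)) \<le> \<mu>"
      using max[OF \<open>w' \<in> T\<close>] by (simp add: \<mu>_def power2_eq_square flip: of_real_mult)
    moreover have "c\<^sup>2 = 1 / nsq n w" using nsq_nonneg[of n w] by (simp add: c_def power_divide)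
    moreover have "nsq n w > 0" using False nsq_nonneg[of n w] by linarith
    ultimately show ?thesis by (simp add: field_simps)
  qed
  \<comment> \<open>The defect of the eigenvalue equation. It is orthogonal to \<open>x\<close>, and
    to the family because \<open>A\<close> maps each \<open>e k\<close> to a multiple of itself, so
    \<open>x + t y\<close> is admissible. Its first-order gain 2 t |y|^2 must be dominated by a
    multiple of t^2, which forces \<open>y\<close> to vanish.\<close>
  define y where "y = (\<lambda>i. mapply n A x i - of_real \<mu> * x i)"
  have yx: "cip n x y = 0"
    using real[of x] x1 cip_self[of n x] by (simp add: y_def cip_diff_right cip_scale_right \<mu>_def)
  have ye: "cip n (e k) y = 0" if "k < m" for k
  proof -
    have "cip n (e k) (mapply n A x) = cip n (mapply n A (e k)) x" using mapply_hermitian[OF A] by simp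
    also have "\<dots> = cip n (\<lambda>i. of_real (l k) * e k i) x" using eig[OF that] by (intro cip_cong) auto
    also have "\<dots> = 0" using xe[OF that] by (simp add: cip_scale_left)
    finally show ?thesis using xe[OF that] by (simp add: y_def cip_diff_right cip_scale_right)
  qed
  have yy: "Re (cip n y (mapply n A x)) = nsq n y"
  proof -
    have "cip n y y = cip n y (mapply n A x) - of_real \<mu> * cip n y x"
      by (subst (2) y_def) (simp add: cip_diff_right cip_scale_right)
    moreover have "cip n y x = 0" using yx cip_commute[of n y x] by simp
    ultimately have "cip n y (mapply n A x) = of_real (nsq n y)" using cip_self[of n y] by simp
    thus ?thesis by simp
  qed
  have "2 * nsq n y * t \<le> (\<mu> * nsq n y - Re (cip n y (mapply n A y))) * t\<^sup>2" if "0 < t" for t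
  proof -
    let ?w = "\<lambda>i. x i + of_real t * y i"
    have "Re (cip n ?w (mapply n A ?w)) \<le> \<mu> * nsq n ?w"
      by (rule bound) (simp add: cip_linear xe ye)
    moreover have "nsq n ?w = 1 + t\<^sup>2 * nsq n y"
      using yx by (simp add: nsq_add nsq_scale x1 cip_scale_right)
    moreover have "cip n x (mapply n A y) = cnj (cip n y (mapply n A x))"
      using mapply_hermitian[OF A, of x y] cip_commute[of n "mapply n A x" y] by simp
    hence "Re (cip n ?w (mapply n A ?w)) = \<mu> + 2 * t * nsq n y + t\<^sup>2 * Re (cip n y (mapply n A y))"
      using yy by (simp add: mapply_add mapply_scale cip_linear \<mu>_def power2_eq_square algebra_simps)
    ultimately show ?thesis by (simp add: algebra_simps)
  qed
  hence "2 * nsq n y \<le> 0" by (rule quadratic_bound_imp_nonpos)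
  hence "nsq n y = 0" using nsq_nonneg[of n y] by linarith
  hence "\<forall>i<n. mapply n A x i = of_real \<mu> * x i" using nsq_eq_0[of n y] by (auto simp: y_def)
  thus ?thesis using x1 xe by blast
qed

theorem hermitian_spectral:
  assumes A: "hermitian n A"
  obtains e l where "orthonormal n n e"
    and "\<And>i j. i < n \<Longrightarrow> j < n \<Longrightarrow> A i j = (\<Sum>k<n. of_real (l k) * e k i * cnj (e k j))"
    and "\<And>k i. k < n \<Longrightarrow> i < n \<Longrightarrow> mapply n A (e k) i = of_real (l k) * e k i"
proof -
  have "m \<le> n \<Longrightarrow> \<exists>e l. orthonormal n m e \<and>
      (\<forall>k<m. \<forall>i<n. mapply n A (e k) i = of_real (l k :: real) * e k i)" for m
  proof (induction m)
    case 0
    show ?case by (simp add: orthonormal_def)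
  next
    case (Suc m)
    then obtain e l where e: "orthonormal n m e"
      and l: "\<forall>k<m. \<forall>i<n. mapply n A (e k) i = of_real (l k :: real) * e k i" by auto
    obtain x \<mu> where x: "nsq n x = 1" "\<forall>k<m. cip n (e k) x = 0" "\<forall>i<n. mapply n A x i = of_real \<mu> * x i"
      using eigenvector_orthogonal_to_family[OF A e, of l] l Suc.prems by auto
    show ?case
    proof (intro exI conjI)
      show "orthonormal n (Suc m) (e(m := x))" using x by (intro orthonormal_extend[OF e]) auto
      show "\<forall>k<Suc m. \<forall>i<n. mapply n A ((e(m := x)) k) i = of_real ((l(m := \<mu>)) k) * (e(m := x)) k i"
        using l x(3) by (auto simp: less_Suc_eq)
    qed
  qed
  then obtain e l where e: "orthonormal n n e"
    and l: "\<And>k i. k < n \<Longrightarrow> i < n \<Longrightarrow> mapply n A (e k) i = of_real (l k :: real) * e k i" by blast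
  have "A i j = (\<Sum>k<n. of_real (l k) * e k i * cnj (e k j))" if "i < n" "j < n" for i j
  proof -
    have "(\<Sum>k<n. of_real (l k) * e k i * cnj (e k j)) = (\<Sum>k<n. (\<Sum>p<n. A i p * e k p) * cnj (e k j))"
      using l that by (simp add: mapply_def)
    also have "\<dots> = (\<Sum>p<n. A i p * (\<Sum>k<n. e k p * cnj (e k j)))"
      by (simp add: sum_distrib_left sum_distrib_right mult_ac) (rule sum.swap)
    also have "\<dots> = (\<Sum>p<n. A i p * (if p = j then 1 else 0))"
      using that by (intro sum.cong refl) (simp add: orthonormal_complete[OF e])
    also have "\<dots> = A i j" using that by (simp add: mult_indicator)
    finally show ?thesis by simp
  qed
  thus thesis using that e l by blast
qed

section \<open>Trace norm and positivity\<close>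

lemma order_prod_linear:
  fixes a :: "'i \<Rightarrow> complex"
  assumes "finite I"
  shows "order z (\<Prod>i\<in>I. [:- a i, 1:]) = card {i \<in> I. a i = z}"
  using assms
proof (induction I rule: finite_induct)
  case empty
  then show ?case by simp
next
  case (insert i I)
  have nz: "[:- a i, 1:] * (\<Prod>i\<in>I. [:- a i, 1:]) \<noteq> 0"
    using insert(1) by (intro no_zero_divisors) (auto simp: prod_zero_iff)
  have "order z (\<Prod>i\<in>insert i I. [:- a i, 1:]) = order z [:- a i, 1:] + card {i \<in> I. a i = z}"
    by (simp only: prod.insert[OF insert(1,2)] order_mult[OF nz] insert(3))
  moreover have "order z [:- a i, 1:] = (if a i = z then 1 else 0)"
    using order_power_n_n[of z 1] by (auto intro!: order_0I)
  moreover have "{j \<in> insert i I. a j = z} = (if a i = z then insert i {j \<in> I. a j = z} else {j \<in> I. a j = z})"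
    by auto
  ultimately show ?case using insert by simp
qed

text \<open>Bridges two ways to list eigenvalues: the definition of the trace norm sums over
  distinct roots weighted by their order, a spectral decomposition lists them with
  repetition.\<close>

lemma sum_roots_with_multiplicity:
  fixes a :: "'i \<Rightarrow> complex" and f :: "complex \<Rightarrow> real"
  assumes "finite I"
  defines "p \<equiv> (\<Prod>i\<in>I. [:- a i, 1:])"
  shows "(\<Sum>z | poly p z = 0. real (order z p) * f z) = (\<Sum>i\<in>I. f (a i))"
proof -
  have "{z. poly p z = 0} = a ` I" using assms(1) by (auto simp: p_def poly_prod prod_zero_iff)
  hence "(\<Sum>z | poly p z = 0. real (order z p) * f z) = (\<Sum>z\<in>a ` I. \<Sum>i\<in>{i \<in> I. a i = z}. f (a i))"
    unfolding p_def order_prod_linear[OF assms(1)] by simp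
  also have "\<dots> = (\<Sum>i\<in>I. f (a i))" using assms(1) by (rule sum.image_gen[symmetric])
  finally show ?thesis .
qed

lemma mat_mult_entry:
  assumes "A \<in> carrier_mat n n" "B \<in> carrier_mat n n" "i < n" "j < n"
  shows "(A * B) $$ (i, j) = (\<Sum>k<n. A $$ (i, k) * B $$ (k, j))"
  using assms by (simp add: scalar_prod_def atLeast0LessThan)

text \<open>The columns \<open>e k\<close> form a unitary matrix, which conjugates
  \<open>mat_adjoint X * X\<close> to the diagonal matrix of the squares of the \<open>l k\<close>.
  The characteristic polynomial therefore splits into linear factors at these squares, whose roots
  are the |l k|.\<close>

lemma trace_norm_spectral:
  assumes X: "X \<in> carrier_mat n n" and e: "orthonormal n n e"
    and spec: "\<And>i j. i < n \<Longrightarrow> j < n \<Longrightarrow> X $$ (i, j) = (\<Sum>k<n. of_real (l k) * e k i * cnj (e k j))"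
  shows "trace_norm X = (\<Sum>k<n. \<bar>l k\<bar>)"
proof -
  define G where "G = mat_adjoint X * X"
  define U where "U = mat n n (\<lambda>(i, k). e k i)"
  define V where "V = mat n n (\<lambda>(k, i). cnj (e k i))"
  define E where "E = mat n n (\<lambda>(i, j). if i = j then complex_of_real ((l i)\<^sup>2) else 0)"
  have adjc: "mat_adjoint X \<in> carrier_mat n n"
    unfolding mat_adjoint_def using X mat_of_rows_carrier(1)[of n "map conjugate (cols X)"] by simp
  have carr: "G \<in> carrier_mat n n" "U \<in> carrier_mat n n" "V \<in> carrier_mat n n" "E \<in> carrier_mat n n"
    using X adjc by (auto simp: G_def U_def V_def E_def)
  have adj: "mat_adjoint X $$ (i, p) = cnj (X $$ (p, i))" if "i < n" "p < n" for i p
    using X that by (simp add: mat_adjoint_def mat_of_rows_index)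
  have Xe: "X $$ (p, j) = (\<Sum>k<n. e k p * (of_real (l k) * cnj (e k j)))" if "p < n" "j < n" for p j
    using spec[OF that] by (simp add: mult_ac)
  have Gij: "G $$ (i, j) = (\<Sum>k<n. e k i * of_real ((l k)\<^sup>2) * cnj (e k j))" if ij: "i < n" "j < n" for i j
  proof -
    have "G $$ (i, j) = (\<Sum>p<n. cnj (X $$ (p, i)) * X $$ (p, j))"
      using X ij adjc by (simp add: G_def scalar_prod_def atLeast0LessThan adj[symmetric])
    also have "\<dots> = cip n (\<lambda>p. \<Sum>k<n. e k p * (of_real (l k) * cnj (e k i))) (\<lambda>p. \<Sum>k<n. e k p * (of_real (l k) * cnj (e k j)))"
      unfolding cip_def using ij by (intro sum.cong refl) (simp add: Xe)
    also have "\<dots> = cip n (\<lambda>p. \<Sum>k<n. (of_real (l k) * cnj (e k i)) * e k p) (\<lambda>p. \<Sum>k<n. (of_real (l k) * cnj (e k j)) * e k p)"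
      by (simp add: mult_ac)
    also have "\<dots> = (\<Sum>k<n. cnj (of_real (l k) * cnj (e k i)) * (of_real (l k) * cnj (e k j)))"
      by (subst cip_sum_left, subst cip_scale_left) (simp add: orthonormal_cip_sum[OF e])
    finally show ?thesis by (simp add: power2_eq_square mult_ac)
  qed
  have VU: "V * U = 1\<^sub>m n"
    using e by (intro eq_matI) (auto simp: U_def V_def scalar_prod_def atLeast0LessThan orthonormal_def cip_def)
  have UV: "U * V = 1\<^sub>m n"
    using orthonormal_complete[OF e]
    by (intro eq_matI) (auto simp: U_def V_def scalar_prod_def atLeast0LessThan)
  have UE: "(U * E) $$ (i, k) = e k i * of_real ((l k)\<^sup>2)" if "i < n" "k < n" for i k
    using that by (simp add: U_def E_def scalar_prod_def atLeast0LessThan if_distrib[of "\<lambda>x. _ * x"] cong: if_cong)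
  have "G = U * E * V"
  proof (rule eq_matI)
    fix i j assume "i < dim_row (U * E * V)" "j < dim_col (U * E * V)"
    hence ij: "i < n" "j < n" using carr by auto
    have "(U * E * V) $$ (i, j) = (\<Sum>k<n. (U * E) $$ (i, k) * V $$ (k, j))"
      by (rule mat_mult_entry[OF mult_carrier_mat[OF carr(2,4)] carr(3) ij])
    also have "\<dots> = (\<Sum>k<n. e k i * of_real ((l k)\<^sup>2) * cnj (e k j))"
    proof (rule sum.cong[OF refl])
      fix k assume "k \<in> {..<n}"
      hence k: "k < n" by simp
      have "V $$ (k, j) = cnj (e k j)" using k ij by (simp add: V_def)
      thus "(U * E) $$ (i, k) * V $$ (k, j) = e k i * of_real ((l k)\<^sup>2) * cnj (e k j)"
        by (simp only: UE[OF ij(1) k])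
    qed
    also have "\<dots> = G $$ (i, j)" by (rule Gij[OF ij, symmetric])
    finally show "G $$ (i, j) = (U * E * V) $$ (i, j)" by simp
  qed (use carr in auto)
  hence sim: "similar_mat G E"
    using carr UV VU by (intro similar_matI[of G E U V n]) auto
  have "char_poly G = (\<Prod>a\<leftarrow>diag_mat E. [:- a, 1:])"
    unfolding char_poly_similar[OF sim]
    by (rule char_poly_upper_triangular[OF carr(4)]) (auto simp: E_def)
  also have "diag_mat E = map (\<lambda>i. complex_of_real ((l i)\<^sup>2)) [0..<n]"
    unfolding diag_mat_def by (auto simp: E_def)
  also have "(\<Prod>a\<leftarrow>map (\<lambda>i. complex_of_real ((l i)\<^sup>2)) [0..<n]. [:- a, 1:]) = (\<Prod>i<n. [:- complex_of_real ((l i)\<^sup>2), 1:])"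
    by (simp add: prod.list_conv_set_nth atLeast0LessThan)
  finally have cp: "char_poly G = (\<Prod>i<n. [:- complex_of_real ((l i)\<^sup>2), 1:])" .
  have "trace_norm X = (\<Sum>z | poly (char_poly G) z = 0. real (order z (char_poly G)) * sqrt (Re z))"
    unfolding trace_norm_def Let_def G_def[symmetric]
    by (rule sum.cong) (auto simp: eigenvalue_root_char_poly[OF carr(1)])
  also have "\<dots> = (\<Sum>i<n. sqrt (Re (complex_of_real ((l i)\<^sup>2))))"
    unfolding cp by (rule sum_roots_with_multiplicity) simp
  also have "\<dots> = (\<Sum>k<n. \<bar>l k\<bar>)" by simp
  finally show ?thesis .
qed

section \<open>Positivity and trace norm bounds through quadratic forms\<close>

definition qform :: "nat \<Rightarrow> (nat \<Rightarrow> nat \<Rightarrow> complex) \<Rightarrow> (nat \<Rightarrow> complex) \<Rightarrow> complex" where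
  "qform n A x = (\<Sum>i<n. \<Sum>j<n. cnj (x i) * A i j * x j)"

abbreviation entries :: "complex mat \<Rightarrow> nat \<Rightarrow> nat \<Rightarrow> complex" where
  "entries A \<equiv> \<lambda>i j. A $$ (i, j)"

lemma psd_iff_qform:
  assumes "A \<in> carrier_mat n n"
  shows "psd n A \<longleftrightarrow> (\<forall>x. 0 \<le> qform n (entries A) x)"
proof -
  have *: "(A *\<^sub>v v) \<bullet>c v = qform n (entries A) (\<lambda>i. v $ i)" if "v \<in> carrier_vec n" for v
    using assms that
    by (simp add: qform_def scalar_prod_def sum_distrib_right sum_distrib_left atLeast0LessThan mult_ac)
  have **: "qform n (entries A) x = (A *\<^sub>v vec n x) \<bullet>c vec n x" for x
    unfolding *[OF vec_carrier] by (simp add: qform_def)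
  have "(\<forall>v\<in>carrier_vec n. 0 \<le> (A *\<^sub>v v) \<bullet>c v) \<longleftrightarrow> (\<forall>x. 0 \<le> qform n (entries A) x)"
  proof (intro iffI allI ballI)
    fix x assume "\<forall>v\<in>carrier_vec n. 0 \<le> (A *\<^sub>v v) \<bullet>c v"
    thus "0 \<le> qform n (entries A) x" unfolding ** using vec_carrier by blast
  next
    fix v :: "complex vec" assume "\<forall>x. 0 \<le> qform n (entries A) x" "v \<in> carrier_vec n"
    thus "0 \<le> (A *\<^sub>v v) \<bullet>c v" by (simp only: *)
  qed
  thus ?thesis using assms by (simp only: psd_def simp_thms)
qed

lemma qform_mapply: "qform n A x = cip n x (mapply n A x)"
  by (simp add: qform_def cip_def mapply_def sum_distrib_left mult.assoc)

lemma qform_add: "qform n (\<lambda>i j. A i j + B i j) x = qform n A x + qform n B x"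
  by (simp add: qform_def distrib_left distrib_right sum.distrib)

lemma qform_diff: "qform n (\<lambda>i j. A i j - B i j) x = qform n A x - qform n B x"
  by (simp add: qform_def left_diff_distrib right_diff_distrib sum_subtractf)

lemma qform_cong: "(\<And>i j. i < n \<Longrightarrow> j < n \<Longrightarrow> A i j = B i j) \<Longrightarrow> qform n A x = qform n B x"
  by (simp add: qform_def)

lemma trace_orthonormal:
  assumes e: "orthonormal n n e"
  shows "(\<Sum>k<n. qform n A (e k)) = (\<Sum>i<n. A i i)"
proof -
  have "(\<Sum>k<n. qform n A (e k)) = (\<Sum>i<n. \<Sum>j<n. \<Sum>k<n. A i j * (e k j * cnj (e k i)))"
    unfolding qform_def
    by (subst sum.swap, rule sum.cong[OF refl], subst sum.swap) (simp add: mult_ac)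
  also have "\<dots> = (\<Sum>i<n. \<Sum>j<n. A i j * (if j = i then 1 else 0))"
    unfolding sum_distrib_left[symmetric]
    by (intro sum.cong refl) (simp add: orthonormal_complete[OF e])
  also have "\<dots> = (\<Sum>i<n. A i i)" by (simp add: mult_indicator)
  finally show ?thesis .
qed

text \<open>Polarization: reality of the form at e_i, e_j, e_i + e_j and e_i + \<i> e_j determines
  the real and imaginary parts of \<open>A i j - cnj (A j i)\<close>.\<close>

lemma hermitian_of_real_qform:
  assumes "\<And>x. Im (qform n A x) = 0"
  shows "hermitian n A"
  unfolding hermitian_def
proof (intro allI impI)
  fix i j assume ij: "i < n" "j < n"
  let ?d = "\<lambda>a k. if k = a then 1 else (0::complex)"
  have cd: "cip n (?d a) y = y a" if "a < n" for a y
  proof -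
    have "cip n (?d a) y = (\<Sum>k<n. y k * (if k = a then 1 else 0))"
      unfolding cip_def by (intro sum.cong) auto
    thus ?thesis using that by (simp add: mult_indicator)
  qed
  have md: "mapply n A (\<lambda>k. ?d a k + c * ?d b k) = (\<lambda>k. A k a + c * A k b)" if "a < n" "b < n" for a b c
  proof
    fix k
    have "mapply n A (\<lambda>k. ?d a k + c * ?d b k) k = (\<Sum>p<n. A k p * (if p = a then 1 else 0)) + (\<Sum>p<n. (c * A k p) * (if p = b then 1 else 0))"
      unfolding mapply_def sum.distrib[symmetric] by (intro sum.cong) (auto simp: algebra_simps)
    thus "mapply n A (\<lambda>k. ?d a k + c * ?d b k) k = A k a + c * A k b"
      using that by (simp add: mult_indicator)
  qed
  have q: "qform n A (\<lambda>k. ?d i k + c * ?d j k) = A i i + c * A i j + cnj c * (A j i + c * A j j)" for c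
    unfolding qform_mapply md[OF ij] by (simp add: cip_add_left cip_scale_left cd ij)
  have q0: "qform n A (\<lambda>k. ?d j k + 0 * ?d i k) = A j j"
    unfolding qform_mapply md[OF ij(2,1)] by (simp add: cd ij)
  have "Im (A i i) = 0" using q[of 0] assms[of "\<lambda>k. ?d i k + 0 * ?d j k"] by simp
  moreover have "Im (A j j) = 0" using q0 assms[of "\<lambda>k. ?d j k + 0 * ?d i k"] by simp
  moreover have "Im (A i i + 1 * A i j + cnj 1 * (A j i + 1 * A j j)) = 0" unfolding q[symmetric] by (rule assms)
  moreover have "Im (A i i + \<i> * A i j + cnj \<i> * (A j i + \<i> * A j j)) = 0" unfolding q[symmetric] by (rule assms)
  ultimately show "A i j = cnj (A j i)" by (simp add: complex_eq_iff)
qed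

lemma psd_hermitian:
  assumes "psd n A"
  shows "hermitian n (entries A)"
proof (rule hermitian_of_real_qform)
  fix x
  have "0 \<le> qform n (entries A) x" using assms psd_iff_qform[of A n] by (simp add: psd_def)
  thus "Im (qform n (entries A) x) = 0" by (simp add: less_eq_complex_def)
qed

text \<open>The Hilbert--Schmidt norm dominates the numerical radius, by Cauchy--Schwarz over all
  pairs of indices.\<close>

lemma qform_bound: "(cmod (qform n A x))\<^sup>2 \<le> (\<Sum>i<n. \<Sum>j<n. (cmod (A i j))\<^sup>2) * (nsq n x)\<^sup>2"
proof -
  let ?I = "{..<n} \<times> {..<n}"
  have "qform n A x = (\<Sum>p\<in>?I. A (fst p) (snd p) * (cnj (x (fst p)) * x (snd p)))"
    by (simp add: qform_def sum.cartesian_product case_prod_beta mult_ac)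
  hence "(cmod (qform n A x))\<^sup>2 \<le> (\<Sum>p\<in>?I. (cmod (A (fst p) (snd p)))\<^sup>2) * (\<Sum>p\<in>?I. (cmod (cnj (x (fst p)) * x (snd p)))\<^sup>2)"
    using cauchy_schwarz_sum[of "\<lambda>p. A (fst p) (snd p)" "\<lambda>p. cnj (x (fst p)) * x (snd p)" ?I] by simp
  also have "(\<Sum>p\<in>?I. (cmod (cnj (x (fst p)) * x (snd p)))\<^sup>2) = (nsq n x)\<^sup>2"
  proof -
    have "(nsq n x)\<^sup>2 = (\<Sum>i<n. \<Sum>j<n. (cmod (x i))\<^sup>2 * (cmod (x j))\<^sup>2)"
      by (subst power2_eq_square) (simp only: nsq_def sum_product)
    also have "\<dots> = (\<Sum>p\<in>?I. (cmod (cnj (x (fst p)) * x (snd p)))\<^sup>2)"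
      unfolding sum.cartesian_product
      by (intro sum.cong refl) (simp add: case_prod_beta norm_mult power_mult_distrib)
    finally show ?thesis by simp
  qed
  also have "(\<Sum>p\<in>?I. (cmod (A (fst p) (snd p)))\<^sup>2) = (\<Sum>i<n. \<Sum>j<n. (cmod (A i j))\<^sup>2)"
    unfolding sum.cartesian_product by (intro sum.cong refl) (simp add: case_prod_beta)
  finally show ?thesis .
qed

text \<open>In an eigenbasis of \<open>X\<close> each |l k| is at most the sum of the diagonal
  values of \<open>P\<close> and \<open>Q\<close> plus \<eta>, and the diagonal values add up to the
  traces. The remainder \<open>R\<close> is there because the iteration below reaches a
  decomposition only approximately; it costs \<eta> once per basis vector.\<close>

lemma trace_norm_bound:
  assumes X: "X \<in> carrier_mat n n" and herm: "hermitian n (entries X)"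
    and split: "\<And>i j. i < n \<Longrightarrow> j < n \<Longrightarrow> X $$ (i, j) = P i j - Q i j + R i j"
    and P: "\<And>x. 0 \<le> qform n P x" and Q: "\<And>x. 0 \<le> qform n Q x"
    and R: "(\<Sum>i<n. \<Sum>j<n. (cmod (R i j))\<^sup>2) \<le> \<eta>\<^sup>2" "0 \<le> \<eta>"
  shows "trace_norm X \<le> Re (\<Sum>i<n. P i i) + Re (\<Sum>i<n. Q i i) + real n * \<eta>"
proof -
  obtain e l where e: "orthonormal n n e"
    and spec: "\<And>i j. i < n \<Longrightarrow> j < n \<Longrightarrow> X $$ (i, j) = (\<Sum>k<n. of_real (l k) * e k i * cnj (e k j))"
    and eig: "\<And>k i. k < n \<Longrightarrow> i < n \<Longrightarrow> mapply n (entries X) (e k) i = of_real (l k) * e k i"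
    by (rule hermitian_spectral[OF herm]) (rule that)
  have le: "\<bar>l k\<bar> \<le> Re (qform n P (e k)) + Re (qform n Q (e k)) + \<eta>" if "k < n" for k
  proof -
    have "qform n (entries X) (e k) = cip n (e k) (\<lambda>i. of_real (l k) * e k i)"
      unfolding qform_mapply using eig[OF that] by (intro cip_cong) auto
    also have "\<dots> = of_real (l k)" using e that by (simp add: cip_scale_right orthonormal_def)
    finally have "of_real (l k) = qform n (\<lambda>i j. P i j - Q i j + R i j) (e k)"
      using qform_cong[of n "entries X"] split by simp
    hence "of_real (l k) = qform n P (e k) - qform n Q (e k) + qform n R (e k)"
      by (simp add: qform_add qform_diff)
    hence "Re (of_real (l k)) = Re (qform n P (e k) - qform n Q (e k) + qform n R (e k))" by (rule arg_cong)
    hence "l k = Re (qform n P (e k)) - Re (qform n Q (e k)) + Re (qform n R (e k))" by simp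
    moreover have "0 \<le> Re (qform n P (e k))" "0 \<le> Re (qform n Q (e k))"
      using P[of "e k"] Q[of "e k"] by (auto simp: less_eq_complex_def)
    moreover have "(cmod (qform n R (e k)))\<^sup>2 \<le> \<eta>\<^sup>2"
      using qform_bound[of n R "e k"] R(1) orthonormal_nsq[OF e that] by simp
    hence "\<bar>Re (qform n R (e k))\<bar> \<le> \<eta>"
      using R(2) abs_Re_le_cmod[of "qform n R (e k)"] power2_le_imp_le by fastforce
    ultimately show ?thesis by linarith
  qed
  have "trace_norm X = (\<Sum>k<n. \<bar>l k\<bar>)" using trace_norm_spectral[OF X e spec] .
  also have "\<dots> \<le> (\<Sum>k<n. Re (qform n P (e k)) + Re (qform n Q (e k)) + \<eta>)"
    using le by (intro sum_mono) simp
  also have "\<dots> = Re (\<Sum>k<n. qform n P (e k)) + Re (\<Sum>k<n. qform n Q (e k)) + real n * \<eta>"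
    by (simp add: sum.distrib)
  finally show ?thesis by (simp add: trace_orthonormal[OF e])
qed

section \<open>The minimax argument\<close>

text \<open>\<open>a * b / (a + b)\<close> is the smallest squared norm on the segment between
  orthogonal vectors of squared norms a and b. Monotonicity lets bounds replace the actual
  norms.\<close>

lemma harmonic_mean_mono:
  fixes a b A B :: real
  assumes "0 \<le> a" "a \<le> A" "0 \<le> b" "b \<le> B" "0 < a + b"
  shows "a * b / (a + b) \<le> A * B / (A + B)"
proof -
  have AB: "0 < A + B" using assms by linarith
  have "a * A * b \<le> a * A * B" using assms by (intro mult_left_mono mult_nonneg_nonneg) linarith+
  moreover have "a * (b * B) \<le> A * (b * B)" using assms by (intro mult_right_mono mult_nonneg_nonneg) linarith+
  ultimately have "a * b * (A + B) \<le> A * B * (a + b)" by (simp add: algebra_simps)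
  thus ?thesis using assms(5) AB by (simp add: field_simps)
qed

text \<open>The steps of the Frank--Wolfe method decrease the squared norm like \<open>C / k\<close>; this replaces the
  separating hyperplane theorem.\<close>

lemma frank_wolfe:
  fixes Z :: "('i \<Rightarrow> complex) set"
  assumes conv: "\<And>a b t. a \<in> Z \<Longrightarrow> b \<in> Z \<Longrightarrow> 0 \<le> t \<Longrightarrow> t \<le> 1 \<Longrightarrow>
      (\<lambda>i. of_real (1 - t) * a i + of_real t * b i) \<in> Z"
    and bound: "\<And>a. a \<in> Z \<Longrightarrow> (\<Sum>i\<in>J. (cmod (a i))\<^sup>2) \<le> C"
    and descent: "\<And>a. a \<in> Z \<Longrightarrow> \<exists>b\<in>Z. Re (\<Sum>i\<in>J. cnj (a i) * b i) \<le> 0"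
    and "Z \<noteq> {}" "0 < C"
  shows "\<exists>a\<in>Z. (\<Sum>i\<in>J. (cmod (a i))\<^sup>2) \<le> C / real (Suc k)"
proof (induction k)
  case 0
  thus ?case using assms(4) bound by auto
next
  case (Suc k)
  define N where "N = (\<lambda>a :: 'i \<Rightarrow> complex. \<Sum>i\<in>J. (cmod (a i))\<^sup>2)"
  have N0: "0 \<le> N a" for a by (simp add: N_def sum_nonneg)
  obtain a where a: "a \<in> Z" "N a \<le> C / real (Suc k)" using Suc unfolding N_def by blast
  obtain b where b: "b \<in> Z" "Re (\<Sum>i\<in>J. cnj (a i) * b i) \<le> 0" using descent[OF a(1)] by blast
  show ?case
  proof (cases "N a + N b = 0")
    case True
    hence "N a = 0" using N0[of a] N0[of b] by linarith
    thus ?thesis using a(1) assms(5) unfolding N_def by (intro bexI[of _ a]) auto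
  next
    case False
    hence pos: "0 < N a + N b" using N0[of a] N0[of b] by linarith
    \<comment> \<open>The minimizer of (1 - t)^2 N a + t^2 N b, the squared norm of the new point
      once the nonpositive cross term is dropped.\<close>
    define t where "t = N a / (N a + N b)"
    have t: "0 \<le> t" "t \<le> 1" "1 - t = N b / (N a + N b)"
      using pos N0[of a] N0[of b] by (auto simp: t_def field_simps)
    define c where "c = (\<lambda>i. of_real (1 - t) * a i + of_real t * b i)"
    have cZ: "c \<in> Z" unfolding c_def using conv[OF a(1) b(1) t(1,2)] .
    have pt: "(cmod (c i))\<^sup>2 = (1 - t)\<^sup>2 * (cmod (a i))\<^sup>2 + t\<^sup>2 * (cmod (b i))\<^sup>2 + 2 * t * (1 - t) * Re (cnj (a i) * b i)" for i
      by (simp add: c_def cmod_power2) (simp add: power2_eq_square algebra_simps)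
    have "N c = (1 - t)\<^sup>2 * N a + t\<^sup>2 * N b + 2 * t * (1 - t) * Re (\<Sum>i\<in>J. cnj (a i) * b i)"
      unfolding N_def pt by (simp only: sum.distrib sum_distrib_left Re_sum)
    also have "\<dots> \<le> (1 - t)\<^sup>2 * N a + t\<^sup>2 * N b"
    proof -
      have "0 \<le> 2 * t * (1 - t)" using t(1,2) by simp
      from mult_nonneg_nonpos[OF this b(2)] show ?thesis by linarith
    qed
    also have "\<dots> = N a * N b / (N a + N b)"
    proof -
      have "(1 - t)\<^sup>2 * N a + t\<^sup>2 * N b = (N a * N b) * (N a + N b) / (N a + N b)\<^sup>2"
        unfolding t(3) unfolding t_def
        by (simp add: power_divide add_divide_distrib[symmetric]) (simp add: power2_eq_square algebra_simps)
      also have "\<dots> = N a * N b / (N a + N b)" using pos by (simp add: power2_eq_square)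
      finally show ?thesis .
    qed
    \<comment> \<open>Reciprocals add up: (k + 1) / C for the current point and 1 / C for the new
      direction give (k + 2) / C, which drives the induction.\<close>
    also have "\<dots> \<le> (C / real (Suc k)) * C / (C / real (Suc k) + C)"
      using a(2) bound[OF b(1)] N0 pos by (intro harmonic_mean_mono) (auto simp: N_def)
    also have "\<dots> = C / real (Suc (Suc k))"
    proof -
      define x where "x = real (Suc k)"
      have x: "0 < x" "x + 1 \<noteq> 0" by (simp_all add: x_def)
      have "C / x + C = C * (x + 1) / x" using x by (simp add: field_simps)
      hence "C / x * C / (C / x + C) = C / (x + 1)" using x assms(5) by simp
      thus ?thesis by (simp add: x_def add.commute)
    qed
    finally show ?thesis using cZ unfolding N_def by blast
  qed
qed

lemma qform_scale: "qform n (\<lambda>i j. c * A i j) x = c * qform n A x"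
  by (simp add: qform_def sum_distrib_left mult_ac)

lemma qform_rank_one: "qform n (\<lambda>i j. u i * cnj (u j)) x = of_real ((cmod (cip n u x))\<^sup>2)"
proof -
  have "qform n (\<lambda>i j. u i * cnj (u j)) x = (\<Sum>i<n. cnj (x i) * u i) * (\<Sum>j<n. cnj (u j) * x j)"
    by (simp add: qform_def sum_product mult_ac)
  also have "\<dots> = cnj (cip n u x) * cip n u x"
    using cip_commute[of n x u] by (simp add: cip_def)
  finally show ?thesis by (simp only: complex_norm_square mult.commute)
qed

lemma hermitian_diff:
  assumes "hermitian n A" "hermitian n B"
  shows "hermitian n (\<lambda>i j. A i j - B i j)"
  using hermitianD[OF assms(1)] hermitianD[OF assms(2)] by (simp add: hermitian_def)

lemma real_qformD: "0 \<le> qform n P x \<Longrightarrow> Im (qform n P x) = 0" "0 \<le> qform n P x \<Longrightarrow> 0 \<le> Re (qform n P x)"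
  by (auto simp: less_eq_complex_def)

lemma qform_eigenvector:
  assumes "orthonormal n n e" "k < n"
    and "\<And>i. i < n \<Longrightarrow> mapply n A (e k) i = of_real (l k) * e k i"
  shows "qform n A (e k) = of_real (l k)"
proof -
  have "qform n A (e k) = cip n (e k) (\<lambda>i. of_real (l k) * e k i)"
    unfolding qform_mapply using assms(3) by (intro cip_cong) auto
  also have "\<dots> = of_real (l k)" using assms(1,2) by (simp add: cip_scale_right orthonormal_def)
  finally show ?thesis .
qed

text \<open>Unit eigenvectors have entries of modulus at most 1, so an entry is bounded by the sum
  of the nonnegative eigenvalues. It supplies the boundedness that the iteration requires.\<close>

lemma psd_entry_bound:
  assumes P: "\<And>x. 0 \<le> qform n P x" and ij: "i < n" "j < n"
  shows "cmod (P i j) \<le> Re (\<Sum>i<n. P i i)"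
proof -
  have herm: "hermitian n P" using real_qformD(1)[OF P] by (rule hermitian_of_real_qform)
  obtain e l where e: "orthonormal n n e"
    and spec: "\<And>i j. i < n \<Longrightarrow> j < n \<Longrightarrow> P i j = (\<Sum>k<n. of_real (l k) * e k i * cnj (e k j))"
    and eig: "\<And>k i. k < n \<Longrightarrow> i < n \<Longrightarrow> mapply n P (e k) i = of_real (l k) * e k i"
    by (rule hermitian_spectral[OF herm]) (rule that)
  have q: "qform n P (e k) = of_real (l k)" if "k < n" for k using qform_eigenvector[of n e k P l] e that eig by blast
  have l0: "0 \<le> l k" if "k < n" for k using P[of "e k"] q[OF that] by (simp add: less_eq_complex_def)
  have e1: "cmod (e k i) \<le> 1" if "k < n" "i < n" for k i
  proof -
    have "(cmod (e k i))\<^sup>2 \<le> nsq n (e k)" unfolding nsq_def using that by (intro member_le_sum) auto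
    thus ?thesis using orthonormal_nsq[OF e that(1)] power2_le_imp_le[of "cmod (e k i)" 1] by simp
  qed
  have "cmod (P i j) \<le> (\<Sum>k<n. cmod (of_real (l k) * e k i * cnj (e k j)))"
    unfolding spec[OF ij] by (rule norm_sum)
  also have "\<dots> \<le> (\<Sum>k<n. l k)"
  proof (rule sum_mono)
    fix k assume "k \<in> {..<n}"
    hence k: "k < n" by simp
    have "cmod (e k i) * cmod (e k j) \<le> 1 * 1" using e1[OF k] ij by (intro mult_mono) auto
    thus "cmod (of_real (l k) * e k i * cnj (e k j)) \<le> l k"
      using l0[OF k] mult_left_mono[of "cmod (e k i) * cmod (e k j)" 1 "l k"] by (simp add: norm_mult mult_ac)
  qed
  also have "\<dots> = Re (\<Sum>k<n. qform n P (e k))" using q by simp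
  finally show ?thesis by (simp add: trace_orthonormal[OF e])
qed

lemma density_opsD:
  assumes "\<rho> \<in> density_ops n"
  shows "\<rho> \<in> carrier_mat n n" "0 \<le> qform n (entries \<rho>) x" "(\<Sum>i<n. \<rho> $$ (i, i)) = 1"
  using assms psd_iff_qform[of \<rho> n] by (auto simp: density_ops_def psd_def mtrace_def)

text \<open>\<open>response\<close> is the dual statement: every observable with eigenbasis
  \<open>e\<close> and eigenvalues \<open>w\<close> in [0, 1] is answered by its own \<sigma>. The
  conclusion asks for one \<sigma> against all observables. A point of \<open>Z\<close> near 0
  writes \<rho> - \<sigma> almost as P - Q with both traces at most \<epsilon>, hence trace distance
  about \<epsilon>. The slack \<eta> reflects that the iteration only approaches 0 and
  \<open>S\<close> is not assumed to be closed.\<close>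

lemma minimax_trace_dist:
  assumes \<rho>: "\<rho> \<in> density_ops n" and S: "S \<subseteq> density_ops n" and n: "0 < n" and \<epsilon>: "0 \<le> \<epsilon>"
    and conv: "\<And>\<sigma> \<tau> t. \<sigma> \<in> S \<Longrightarrow> \<tau> \<in> S \<Longrightarrow> 0 \<le> t \<Longrightarrow> t \<le> 1 \<Longrightarrow>
      mat n n (\<lambda>(i, j). of_real (1 - t) * \<sigma> $$ (i, j) + of_real t * \<tau> $$ (i, j)) \<in> S"
    and response: "\<And>e w. orthonormal n n e \<Longrightarrow> (\<And>k. k < n \<Longrightarrow> 0 \<le> w k \<and> w k \<le> 1) \<Longrightarrow>
      \<exists>\<sigma>\<in>S. (\<Sum>k<n. w k * (Re (qform n (entries \<rho>) (e k)) - Re (qform n (entries \<sigma>) (e k)))) \<le> \<epsilon>"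
    and \<eta>: "0 < \<eta>"
  shows "\<exists>\<sigma>\<in>S. trace_dist \<rho> \<sigma> \<le> \<epsilon> + \<eta>"
proof -
  define good where "good = (\<lambda>P. (\<forall>x. 0 \<le> qform n P x) \<and> Re (\<Sum>i<n. P i i) \<le> \<epsilon>)"
  define Z where "Z = {a. \<exists>\<sigma>\<in>S. \<exists>P Q. good P \<and> good Q \<and>
    (\<forall>i<n. \<forall>j<n. a (i, j) = \<rho> $$ (i, j) - \<sigma> $$ (i, j) - (P i j - Q i j))}"
  let ?J = "{..<n} \<times> {..<n}"
  have ZI: "a \<in> Z" if "\<sigma> \<in> S" "good P" "good Q"
    "\<And>i j. i < n \<Longrightarrow> j < n \<Longrightarrow> a (i, j) = \<rho> $$ (i, j) - \<sigma> $$ (i, j) - (P i j - Q i j)" for a \<sigma> P Q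
    using that unfolding Z_def by blast
  define C where "C = real (n * n) * (2 + 2 * \<epsilon>)\<^sup>2"
  have "\<exists>a\<in>Z. (\<Sum>p\<in>?J. (cmod (a p))\<^sup>2) \<le> C / real (Suc k)" for k
  proof (rule frank_wolfe)
    fix a b :: "nat \<times> nat \<Rightarrow> complex" and t :: real
    assume "a \<in> Z" and "b \<in> Z" and t: "0 \<le> t" "t \<le> 1"
    then obtain \<sigma> P Q \<tau> P' Q' where a: "\<sigma> \<in> S" "good P" "good Q"
        "\<And>i j. i < n \<Longrightarrow> j < n \<Longrightarrow> a (i, j) = \<rho> $$ (i, j) - \<sigma> $$ (i, j) - (P i j - Q i j)"
      and b: "\<tau> \<in> S" "good P'" "good Q'"
        "\<And>i j. i < n \<Longrightarrow> j < n \<Longrightarrow> b (i, j) = \<rho> $$ (i, j) - \<tau> $$ (i, j) - (P' i j - Q' i j)"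
      unfolding Z_def by blast
    have good: "good (\<lambda>i j. of_real (1 - t) * A i j + of_real t * B i j)" if "good A" "good B" for A B
    proof -
      have "0 \<le> qform n (\<lambda>i j. of_real (1 - t) * A i j + of_real t * B i j) x" for x
        using that t unfolding good_def qform_add qform_scale
        by (intro add_nonneg_nonneg mult_nonneg_nonneg) (auto simp: less_eq_complex_def)
      moreover have "Re (\<Sum>i<n. of_real (1 - t) * A i i + of_real t * B i i)
          = (1 - t) * Re (\<Sum>i<n. A i i) + t * Re (\<Sum>i<n. B i i)"
        by (simp add: sum.distrib sum_distrib_left)
      moreover have "\<dots> \<le> (1 - t) * \<epsilon> + t * \<epsilon>"
        using that t unfolding good_def by (intro add_mono mult_left_mono) auto
      ultimately show ?thesis unfolding good_def by (simp add: algebra_simps)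
    qed
    show "(\<lambda>i. of_real (1 - t) * a i + of_real t * b i) \<in> Z"
      by (rule ZI[OF conv[OF a(1) b(1) t] good[OF a(2) b(2)] good[OF a(3) b(3)]])
        (simp add: a(4) b(4) algebra_simps)
  next
    fix a assume "a \<in> Z"
    then obtain \<sigma> P Q where a: "\<sigma> \<in> S" "good P" "good Q"
        "\<And>i j. i < n \<Longrightarrow> j < n \<Longrightarrow> a (i, j) = \<rho> $$ (i, j) - \<sigma> $$ (i, j) - (P i j - Q i j)"
      unfolding Z_def by blast
    have den: "cmod (\<tau> $$ (i, j)) \<le> 1" if "\<tau> \<in> density_ops n" "i < n" "j < n" for \<tau> i j
      using psd_entry_bound[of n "entries \<tau>", OF density_opsD(2)[OF that(1)] that(2,3)] density_opsD(3)[OF that(1)] by simp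
    have le: "cmod (a p) \<le> 2 + 2 * \<epsilon>" if pJ: "p \<in> ?J" for p
    proof -
      obtain i j where p: "p = (i, j)" "i < n" "j < n" using pJ by (cases p) auto
      have "cmod (P i j) \<le> \<epsilon>" "cmod (Q i j) \<le> \<epsilon>"
        using psd_entry_bound[of n _ i j] a(2,3) p unfolding good_def by (meson order_trans)+
      moreover have "cmod (\<rho> $$ (i, j)) \<le> 1" "cmod (\<sigma> $$ (i, j)) \<le> 1"
        using den p \<rho> S a(1) by auto
      moreover have "cmod (a p) \<le> cmod (\<rho> $$ (i, j)) + cmod (\<sigma> $$ (i, j)) + (cmod (P i j) + cmod (Q i j))"
        unfolding p(1) a(4)[OF p(2,3)] by (intro norm_diff_triangle_le order_trans[OF norm_triangle_ineq4] add_mono order_refl)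
      ultimately show ?thesis by linarith
    qed
    have "(\<Sum>p\<in>?J. (cmod (a p))\<^sup>2) \<le> (\<Sum>p\<in>?J. (2 + 2 * \<epsilon>)\<^sup>2)"
      using le by (intro sum_mono power_mono) auto
    thus "(\<Sum>p\<in>?J. (cmod (a p))\<^sup>2) \<le> C" by (simp add: C_def card_cartesian_product)
  next
    fix a assume "a \<in> Z"
    then obtain \<sigma> P Q where a: "\<sigma> \<in> S" "good P" "good Q"
        "\<And>i j. i < n \<Longrightarrow> j < n \<Longrightarrow> a (i, j) = \<rho> $$ (i, j) - \<sigma> $$ (i, j) - (P i j - Q i j)"
      unfolding Z_def by blast
    define A where "A = (\<lambda>i j. (\<rho> $$ (i, j) - \<sigma> $$ (i, j)) - (P i j - Q i j))"
    have hP: "hermitian n B" if "\<And>x. 0 \<le> qform n B x" for B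
      using real_qformD(1)[OF that] by (rule hermitian_of_real_qform)
    have hA: "hermitian n A" unfolding A_def using a(1-3) \<rho> S unfolding good_def
      by (intro hermitian_diff hP) (auto dest: density_opsD(2))
    obtain e l where e: "orthonormal n n e"
      and spec: "\<And>i j. i < n \<Longrightarrow> j < n \<Longrightarrow> A i j = (\<Sum>k<n. of_real (l k) * e k i * cnj (e k j))"
      by (rule hermitian_spectral[OF hA]) (rule that)
    have fin: "finite (l ` {..<n})" "l ` {..<n} \<noteq> {}" using n by auto
    obtain kL where kL: "kL < n" "l kL = Max (l ` {..<n})" using Max_in[OF fin] by auto
    obtain km where km: "km < n" "l km = Min (l ` {..<n})" using Min_in[OF fin] by auto
    have lk: "l km \<le> l k" "l k \<le> l kL" if "k < n" for k
      using that fin kL km by auto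
    \<comment> \<open>The spectrum of the current point is rescaled affinely to [0, 1], to make it
      an observable that \<open>response\<close> accepts. Subtracting the minimum is harmless since
      \<rho> - \<tau> has trace 0 (\<open>D0\<close>). If all eigenvalues agree, division by zero
      makes every weight 0.\<close>
    define w where "w = (\<lambda>k. (l k - l km) / (l kL - l km))"
    have w: "0 \<le> w k \<and> w k \<le> 1" if "k < n" for k
      using lk[OF that] lk[OF kL(1)] by (auto simp: w_def divide_simps)
    obtain \<tau> where \<tau>: "\<tau> \<in> S"
      "(\<Sum>k<n. w k * (Re (qform n (entries \<rho>) (e k)) - Re (qform n (entries \<tau>) (e k)))) \<le> \<epsilon>"
      using response[of e w, OF e w] by blast
    define D where "D = (\<lambda>k. Re (qform n (entries \<rho>) (e k)) - Re (qform n (entries \<tau>) (e k)))"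
    have D0: "(\<Sum>k<n. D k) = 0"
    proof -
      have "(\<Sum>k<n. D k) = Re (\<Sum>k<n. qform n (entries \<rho>) (e k)) - Re (\<Sum>k<n. qform n (entries \<tau>) (e k))"
        by (simp add: D_def sum_subtractf)
      moreover have \<tau>den: "\<tau> \<in> density_ops n" using S \<tau>(1) by blast
      ultimately show ?thesis
        by (simp only: trace_orthonormal[OF e] density_opsD(3)[OF \<rho>] density_opsD(3)[OF \<tau>den] diff_self)
    qed
    \<comment> \<open>The whole trace budget \<epsilon> is put on one eigenvector: \<open>P\<close>
      on a top one, \<open>Q\<close> on a bottom one. This P - Q has the largest pairing with the
      current point, \<epsilon> (l kL - l km), exactly the amount that \<open>response\<close>
      leaves to be compensated.\<close>
    define R1 where "R1 = (\<lambda>k i j. complex_of_real \<epsilon> * (e k i * cnj (e k j)))"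
    have q1: "qform n (R1 k) x = of_real (\<epsilon> * (cmod (cip n (e k) x))\<^sup>2)" for k x
      by (simp only: R1_def qform_scale qform_rank_one of_real_mult)
    have "Re (\<Sum>i<n. R1 k i i) = \<epsilon>" if "k < n" for k
    proof -
      have "(\<Sum>i<n. R1 k i i) = of_real \<epsilon> * cip n (e k) (e k)"
        by (simp add: R1_def cip_def sum_distrib_left mult_ac)
      thus ?thesis using e that by (simp add: orthonormal_def)
    qed
    moreover have "0 \<le> qform n (R1 k) x" for k x
      unfolding q1 using \<epsilon> by (simp add: less_eq_complex_def del: of_real_mult)
    ultimately have good1: "good (R1 k)" if "k < n" for k using that by (simp add: good_def)
    define b where "b = (\<lambda>p. \<rho> $$ (fst p, snd p) - \<tau> $$ (fst p, snd p) - (R1 kL (fst p) (snd p) - R1 km (fst p) (snd p)))"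
    have "b \<in> Z" by (rule ZI[OF \<tau>(1) good1[OF kL(1)] good1[OF km(1)]]) (simp add: b_def)
    moreover have "Re (\<Sum>p\<in>?J. cnj (a p) * b p) \<le> 0"
    proof -
      have "(\<Sum>p\<in>?J. cnj (a p) * b p) = (\<Sum>p\<in>?J. \<Sum>k<n. of_real (l k) * (cnj (e k (fst p)) * b p * e k (snd p)))"
      proof (rule sum.cong[OF refl])
        fix p assume "p \<in> ?J"
        then obtain i j where p: "p = (i, j)" "i < n" "j < n" by (cases p) auto
        have "a p = A i j" using a(4) p by (simp add: A_def)
        thus "cnj (a p) * b p = (\<Sum>k<n. of_real (l k) * (cnj (e k (fst p)) * b p * e k (snd p)))"
          using spec[OF p(2,3)] p(1) by (simp add: sum_distrib_left mult_ac)
      qed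
      also have "\<dots> = (\<Sum>k<n. of_real (l k) * qform n (\<lambda>i j. b (i, j)) (e k))"
      proof (subst sum.swap, rule sum.cong[OF refl])
        fix k
        have "(\<Sum>p\<in>?J. cnj (e k (fst p)) * b p * e k (snd p)) = qform n (\<lambda>i j. b (i, j)) (e k)"
          unfolding qform_def sum.cartesian_product by (intro sum.cong refl) (simp add: case_prod_beta)
        thus "(\<Sum>p\<in>?J. of_real (l k) * (cnj (e k (fst p)) * b p * e k (snd p)))
            = of_real (l k) * qform n (\<lambda>i j. b (i, j)) (e k)"
          by (simp only: sum_distrib_left[symmetric])
      qed
      finally have "Re (\<Sum>p\<in>?J. cnj (a p) * b p) = (\<Sum>k<n. l k * Re (qform n (\<lambda>i j. b (i, j)) (e k)))"
        by simp
      also have "\<dots> = (\<Sum>k<n. l k * D k - \<epsilon> * (if k = kL then l k else 0) + \<epsilon> * (if k = km then l k else 0))"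
      proof (rule sum.cong[OF refl])
        fix k assume "k \<in> {..<n}"
        hence k: "k < n" by simp
        have "qform n (\<lambda>i j. b (i, j)) (e k) = qform n (entries \<rho>) (e k) - qform n (entries \<tau>) (e k) - (qform n (R1 kL) (e k) - qform n (R1 km) (e k))"
          by (simp add: b_def qform_diff)
        moreover have "Re (qform n (R1 kL) (e k)) = (if k = kL then \<epsilon> else 0)"
          "Re (qform n (R1 km) (e k)) = (if k = km then \<epsilon> else 0)"
          using e k kL(1) km(1) unfolding q1 orthonormal_def by auto
        ultimately have "Re (qform n (\<lambda>i j. b (i, j)) (e k)) = D k - ((if k = kL then \<epsilon> else 0) - (if k = km then \<epsilon> else 0))"
          by (simp add: D_def)
        thus "l k * Re (qform n (\<lambda>i j. b (i, j)) (e k)) = l k * D k - \<epsilon> * (if k = kL then l k else 0) + \<epsilon> * (if k = km then l k else 0)"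
          by (simp only:) (cases "k = kL"; cases "k = km"; simp add: algebra_simps)
      qed
      also have "\<dots> = (\<Sum>k<n. l k * D k) - \<epsilon> * (l kL - l km)"
        using kL(1) km(1) by (simp add: sum.distrib sum_subtractf sum_distrib_left[symmetric] algebra_simps)
      also have "(\<Sum>k<n. l k * D k) = (\<Sum>k<n. (l k - l km) * D k)"
        using D0 by (simp add: left_diff_distrib sum_subtractf sum_distrib_left[symmetric])
      also have "\<dots> = (l kL - l km) * (\<Sum>k<n. w k * D k)"
      proof (cases "l kL = l km")
        case True
        hence "l k = l km" if "k < n" for k using lk[OF that] by simp
        thus ?thesis using True by simp
      next
        case False
        thus ?thesis by (simp add: w_def sum_distrib_left)
      qed
      also have "\<dots> \<le> (l kL - l km) * \<epsilon>"
        using \<tau>(2) lk[OF kL(1)] unfolding D_def by (intro mult_left_mono) auto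
      finally show ?thesis by (simp add: algebra_simps)
    qed
    ultimately show "\<exists>b\<in>Z. Re (\<Sum>p\<in>?J. cnj (a p) * b p) \<le> 0" by blast
  next
    have "\<exists>\<sigma>. \<sigma> \<in> S"
    proof -
      have "hermitian n (\<lambda>i j. 0)" by (simp add: hermitian_def)
      then obtain e where "orthonormal n n e" by (rule hermitian_spectral)
      thus ?thesis using response[of e "\<lambda>_. 0"] by auto
    qed
    then obtain \<sigma> where "\<sigma> \<in> S" by blast
    moreover have "good (\<lambda>i j. 0)" using \<epsilon> by (simp add: good_def qform_def)
    ultimately have "(\<lambda>p. \<rho> $$ (fst p, snd p) - \<sigma> $$ (fst p, snd p)) \<in> Z"
      by (intro ZI[of \<sigma> "\<lambda>i j. 0" "\<lambda>i j. 0"]) auto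
    thus "Z \<noteq> {}" by blast
  next
    show "0 < C" using n \<epsilon> by (simp add: C_def)
  qed
  note steps = this
  \<comment> \<open>The remainder costs its size once per dimension, so \<theta> is chosen with n
    \<theta> = \<eta>.\<close>
  define \<theta> where "\<theta> = \<eta> / real n"
  have \<theta>: "0 < \<theta>" using \<eta> n by (simp add: \<theta>_def)
  obtain k where k: "C / \<theta>\<^sup>2 < real k" using reals_Archimedean2 by blast
  obtain a where a: "a \<in> Z" "(\<Sum>p\<in>?J. (cmod (a p))\<^sup>2) \<le> C / real (Suc k)" using steps by blast
  have "C < real k * \<theta>\<^sup>2" using k \<theta> by (simp add: field_simps)
  moreover have "real k * \<theta>\<^sup>2 \<le> real (Suc k) * \<theta>\<^sup>2" by (intro mult_right_mono) auto
  ultimately have "C \<le> real (Suc k) * \<theta>\<^sup>2" by linarith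
  hence "C / real (Suc k) \<le> \<theta>\<^sup>2" by (simp add: divide_le_eq mult.commute)
  hence a2: "(\<Sum>i<n. \<Sum>j<n. (cmod (a (i, j)))\<^sup>2) \<le> \<theta>\<^sup>2"
    using a(2) by (simp add: sum.cartesian_product case_prod_beta)
  obtain \<sigma> P Q where s: "\<sigma> \<in> S" "good P" "good Q"
      "\<And>i j. i < n \<Longrightarrow> j < n \<Longrightarrow> a (i, j) = \<rho> $$ (i, j) - \<sigma> $$ (i, j) - (P i j - Q i j)"
    using a(1) unfolding Z_def by blast
  have car: "\<rho> \<in> carrier_mat n n" "\<sigma> \<in> carrier_mat n n" using \<rho> S s(1) by (auto dest: density_opsD(1))
  have "hermitian n (entries \<rho>)" "hermitian n (entries \<sigma>)"
    using \<rho> S s(1) by (auto simp: density_ops_def intro!: psd_hermitian)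
  from hermitian_diff[OF this] have h: "hermitian n (entries (\<rho> - \<sigma>))"
    using car by (simp add: hermitian_def)
  have "trace_norm (\<rho> - \<sigma>) \<le> Re (\<Sum>i<n. P i i) + Re (\<Sum>i<n. Q i i) + real n * \<theta>"
  proof (rule trace_norm_bound[OF _ h, where P = P and Q = Q and R = "\<lambda>i j. a (i, j)"])
    show "(\<rho> - \<sigma>) $$ (i, j) = P i j - Q i j + a (i, j)" if "i < n" "j < n" for i j
      using that car s(4)[OF that] by simp
  qed (use car s(2,3) a2 \<theta> in \<open>auto simp: good_def\<close>)
  also have "\<dots> \<le> \<epsilon> + \<epsilon> + \<eta>" using s(2,3) n by (simp add: good_def \<theta>_def)
  finally show ?thesis using s(1) \<eta> by (intro bexI[of _ \<sigma>]) (simp add: trace_dist_def)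
qed

section \<open>Kraus maps\<close>

lemma sum_lessThan_add: "(\<Sum>s<a + m. F s) = (\<Sum>s<a. F s) + (\<Sum>p<m. F (a + p))"
  for F :: "nat \<Rightarrow> 'a::comm_monoid_add"
  by (induction m) (simp_all add: add.assoc)

lemma sum_lessThan_mult: "(\<Sum>s<k * m. F s) = (\<Sum>a<k. \<Sum>p<m. F (a * m + p))"
  for F :: "nat \<Rightarrow> 'a::comm_monoid_add"
proof (induction k)
  case (Suc k)
  have "(\<Sum>s<Suc k * m. F s) = (\<Sum>s<k * m + m. F s)" by (simp add: add.commute)
  thus ?case using Suc by (simp only: sum_lessThan_add sum.lessThan_Suc)
qed simp

lemma sum_rotate3:
  "(\<Sum>a\<in>A. \<Sum>b\<in>B. \<Sum>c\<in>C. f a b c) = (\<Sum>c\<in>C. \<Sum>a\<in>A. \<Sum>b\<in>B. f a b c)"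
  for f :: "'a \<Rightarrow> 'b \<Rightarrow> 'c \<Rightarrow> 'd::comm_monoid_add"
proof -
  have "(\<Sum>a\<in>A. \<Sum>b\<in>B. \<Sum>c\<in>C. f a b c) = (\<Sum>a\<in>A. \<Sum>c\<in>C. \<Sum>b\<in>B. f a b c)"
    by (rule sum.cong[OF refl], rule sum.swap)
  also have "\<dots> = (\<Sum>c\<in>C. \<Sum>a\<in>A. \<Sum>b\<in>B. f a b c)" by (rule sum.swap)
  finally show ?thesis .
qed

lemma sum_swap_pairs:
  "(\<Sum>a\<in>A. \<Sum>b\<in>B. \<Sum>c\<in>C. \<Sum>e\<in>E. f a b c e) = (\<Sum>c\<in>C. \<Sum>e\<in>E. \<Sum>a\<in>A. \<Sum>b\<in>B. f a b c e)"
  for f :: "'a \<Rightarrow> 'b \<Rightarrow> 'c \<Rightarrow> 'e \<Rightarrow> 'd::comm_monoid_add"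
proof -
  have "(\<Sum>a\<in>A. \<Sum>b\<in>B. \<Sum>c\<in>C. \<Sum>e\<in>E. f a b c e) = (\<Sum>c\<in>C. \<Sum>a\<in>A. \<Sum>b\<in>B. \<Sum>e\<in>E. f a b c e)"
    by (rule sum_rotate3)
  also have "\<dots> = (\<Sum>c\<in>C. \<Sum>e\<in>E. \<Sum>a\<in>A. \<Sum>b\<in>B. f a b c e)"
    by (rule sum.cong[OF refl], rule sum_rotate3)
  finally show ?thesis .
qed

lemma sum_regroup5:
  "(\<Sum>p\<in>A. \<Sum>q\<in>B. \<Sum>r\<in>C. \<Sum>i\<in>E. \<Sum>j\<in>F. f p q r i j) = (\<Sum>r\<in>C. \<Sum>i\<in>E. \<Sum>j\<in>F. \<Sum>p\<in>A. \<Sum>q\<in>B. f p q r i j)"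
  for f :: "'a \<Rightarrow> 'b \<Rightarrow> 'c \<Rightarrow> 'e \<Rightarrow> 'f \<Rightarrow> 'd::comm_monoid_add"
  by (subst sum_rotate3, rule sum.cong[OF refl], rule sum_swap_pairs)

lemma pair_index_less: "a < k \<Longrightarrow> p < m \<Longrightarrow> a * m + p < k * (m :: nat)"
proof -
  assume "a < k" "p < m"
  hence "a * m + p < Suc a * m" by simp
  also have "\<dots> \<le> k * m" using \<open>a < k\<close> by (intro mult_le_mono1) simp
  finally show ?thesis .
qed

definition kraus_map ::
  "nat \<Rightarrow> nat \<Rightarrow> 'r set \<Rightarrow> ('r \<Rightarrow> nat \<Rightarrow> nat \<Rightarrow> complex) \<Rightarrow> complex mat \<Rightarrow> complex mat" where
  "kraus_map D m I L X = mat m m (\<lambda>(p, q). \<Sum>r\<in>I. \<Sum>i<D. \<Sum>j<D. L r p i * X $$ (i, j) * cnj (L r q j))"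

lemma kraus_map_linear: "mat_linear D m (kraus_map D m I L)"
  unfolding mat_linear_def
proof (intro conjI ballI allI)
  fix A B :: "complex mat" assume AB: "A \<in> carrier_mat D D" "B \<in> carrier_mat D D"
  show "kraus_map D m I L (A + B) = kraus_map D m I L A + kraus_map D m I L B"
    using AB by (intro eq_matI) (auto simp: kraus_map_def distrib_left distrib_right sum.distrib)
next
  fix c and A :: "complex mat" assume A: "A \<in> carrier_mat D D"
  show "kraus_map D m I L (c \<cdot>\<^sub>m A) = c \<cdot>\<^sub>m kraus_map D m I L A"
    using A by (intro eq_matI) (auto simp: kraus_map_def sum_distrib_left mult_ac)
qed (simp add: kraus_map_def)

text \<open>The Heisenberg picture for the entrywise pairing, without transposition. With the
  identity for \<open>W\<close> it gives trace preservation, with the entries of an observable its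
  pull-back to the input space.\<close>

lemma kraus_map_adjoint:
  assumes "finite I"
  shows "(\<Sum>p<m. \<Sum>q<m. W p q * kraus_map D m I L X $$ (p, q))
    = (\<Sum>i<D. \<Sum>j<D. X $$ (i, j) * (\<Sum>r\<in>I. \<Sum>p<m. \<Sum>q<m. W p q * L r p i * cnj (L r q j)))"
proof -
  let ?g = "\<lambda>p q r i j. X $$ (i, j) * (W p q * L r p i * cnj (L r q j))"
  have "(\<Sum>p<m. \<Sum>q<m. W p q * kraus_map D m I L X $$ (p, q))
      = (\<Sum>p<m. \<Sum>q<m. \<Sum>r\<in>I. \<Sum>i<D. \<Sum>j<D. ?g p q r i j)"
    by (intro sum.cong refl) (simp add: kraus_map_def sum_distrib_left mult_ac)
  also have "\<dots> = (\<Sum>r\<in>I. \<Sum>i<D. \<Sum>j<D. \<Sum>p<m. \<Sum>q<m. ?g p q r i j)"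
    by (rule sum_regroup5)
  also have "\<dots> = (\<Sum>i<D. \<Sum>j<D. \<Sum>r\<in>I. \<Sum>p<m. \<Sum>q<m. ?g p q r i j)"
    by (rule sum_rotate3[symmetric])
  finally show ?thesis by (simp add: sum_distrib_left)
qed

lemma kraus_map_trace:
  assumes "finite I" and complete: "\<And>i j. i < D \<Longrightarrow> j < D \<Longrightarrow>
    (\<Sum>r\<in>I. \<Sum>p<m. L r p i * cnj (L r p j)) = (if i = j then 1 else 0)"
  shows "trace_preserving D (kraus_map D m I L)"
  unfolding trace_preserving_def
proof
  fix A :: "complex mat" assume A: "A \<in> carrier_mat D D"
  let ?d = "\<lambda>p q. if q = p then 1 else (0::complex)"
  have d: "(\<Sum>q<m. ?d p q * f q) = f p" if "p < m" for p and f :: "nat \<Rightarrow> complex"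
    using that sum.delta[of "{..<m}" p f] by (simp add: if_distrib[of "\<lambda>x. x * _"] cong: if_cong)
  have "mtrace (kraus_map D m I L A) = (\<Sum>p<m. \<Sum>q<m. ?d p q * kraus_map D m I L A $$ (p, q))"
    using d by (simp add: mtrace_def kraus_map_def)
  also have "\<dots> = (\<Sum>i<D. \<Sum>j<D. A $$ (i, j) * (\<Sum>r\<in>I. \<Sum>p<m. \<Sum>q<m. ?d p q * L r p i * cnj (L r q j)))"
    by (rule kraus_map_adjoint[OF assms(1)])
  also have "\<dots> = (\<Sum>i<D. \<Sum>j<D. A $$ (i, j) * (if i = j then 1 else 0))"
  proof (intro sum.cong refl arg_cong2[of _ _ _ _ "(*)"])
    fix i j assume ij: "i \<in> {..<D}" "j \<in> {..<D}"
    have "(\<Sum>r\<in>I. \<Sum>p<m. \<Sum>q<m. ?d p q * L r p i * cnj (L r q j)) = (\<Sum>r\<in>I. \<Sum>p<m. L r p i * cnj (L r p j))"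
      using d by (intro sum.cong refl) (simp add: mult.assoc)
    thus "(\<Sum>r\<in>I. \<Sum>p<m. \<Sum>q<m. ?d p q * L r p i * cnj (L r q j)) = (if i = j then 1 else 0)"
      using complete ij by simp
  qed
  also have "\<dots> = mtrace A" using A by (simp add: mtrace_def mult_indicator)
  finally show "mtrace (kraus_map D m I L A) = mtrace A" .
qed

lemma kraus_map_completely_positive:
  shows "completely_positive D m (kraus_map D m I L)"
  unfolding completely_positive_def
proof (intro allI impI)
  fix k and X :: "complex mat" assume X: "psd (k * D) X"
  have car: "X \<in> carrier_mat (k * D) (k * D)" using X by (simp add: psd_def)
  let ?Y = "ampliation k D m (kraus_map D m I L) X"
  have Y: "?Y \<in> carrier_mat (k * m) (k * m)" by (simp add: ampliation_def)
  have entry: "?Y $$ (a * m + p, b * m + q) =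
      (\<Sum>r\<in>I. \<Sum>i<D. \<Sum>j<D. L r p i * X $$ (a * D + i, b * D + j) * cnj (L r q j))"
    if "a < k" "b < k" "p < m" "q < m" for a b p q
    using that by (simp add: ampliation_def pair_index_less kraus_map_def mat_block_def)
  have "0 \<le> qform (k * m) (entries ?Y) v" for v
  proof -
    \<comment> \<open>\<open>y r\<close> is the adjoint of 1 \<otimes> L_r applied to
      \<open>v\<close>; the quadratic form of the output at \<open>v\<close> is the sum over
      \<open>r\<close> of that of \<open>X\<close> at \<open>y r\<close>.\<close>
    define y where "y = (\<lambda>r t. \<Sum>q<m. cnj (L r q (t mod D)) * v ((t div D) * m + q))"
    have ye: "y r (b * D + j) = (\<Sum>q<m. cnj (L r q j) * v (b * m + q))" if "j < D" for r b j
      using that by (simp add: y_def)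
    let ?t = "\<lambda>r a p b q i j. cnj (v (a * m + p)) * (L r p i * X $$ (a * D + i, b * D + j) * cnj (L r q j)) * v (b * m + q)"
    have "qform (k * m) (entries ?Y) v = (\<Sum>a<k. \<Sum>p<m. \<Sum>b<k. \<Sum>q<m. cnj (v (a * m + p)) * ?Y $$ (a * m + p, b * m + q) * v (b * m + q))"
      by (simp add: qform_def sum_lessThan_mult)
    also have "\<dots> = (\<Sum>a<k. \<Sum>p<m. \<Sum>b<k. \<Sum>q<m. \<Sum>r\<in>I. \<Sum>i<D. \<Sum>j<D. ?t r a p b q i j)"
      by (intro sum.cong refl) (simp add: entry sum_distrib_left sum_distrib_right)
    also have "\<dots> = (\<Sum>a<k. \<Sum>b<k. \<Sum>p<m. \<Sum>q<m. \<Sum>r\<in>I. \<Sum>i<D. \<Sum>j<D. ?t r a p b q i j)"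
      by (rule sum.cong[OF refl], rule sum.swap)
    also have "\<dots> = (\<Sum>a<k. \<Sum>b<k. \<Sum>r\<in>I. \<Sum>i<D. \<Sum>j<D. \<Sum>p<m. \<Sum>q<m. ?t r a p b q i j)"
      by (rule sum.cong[OF refl], rule sum.cong[OF refl], rule sum_regroup5)
    also have "\<dots> = (\<Sum>r\<in>I. \<Sum>a<k. \<Sum>b<k. \<Sum>i<D. \<Sum>j<D. \<Sum>p<m. \<Sum>q<m. ?t r a p b q i j)"
      by (rule sum_rotate3)
    also have "\<dots> = (\<Sum>r\<in>I. qform (k * D) (entries X) (y r))"
    proof (rule sum.cong[OF refl])
      fix r
      have "qform (k * D) (entries X) (y r) = (\<Sum>a<k. \<Sum>i<D. \<Sum>b<k. \<Sum>j<D. cnj (y r (a * D + i)) * X $$ (a * D + i, b * D + j) * y r (b * D + j))"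
        by (simp add: qform_def sum_lessThan_mult)
      also have "\<dots> = (\<Sum>a<k. \<Sum>b<k. \<Sum>i<D. \<Sum>j<D. cnj (y r (a * D + i)) * X $$ (a * D + i, b * D + j) * y r (b * D + j))"
        by (rule sum.cong[OF refl], rule sum.swap)
      also have "\<dots> = (\<Sum>a<k. \<Sum>b<k. \<Sum>i<D. \<Sum>j<D. \<Sum>p<m. \<Sum>q<m. ?t r a p b q i j)"
      proof (intro sum.cong refl)
        fix a b i j assume "i \<in> {..<D}" "j \<in> {..<D}"
        hence ij: "i < D" "j < D" by auto
        have "cnj (y r (a * D + i)) * X $$ (a * D + i, b * D + j) * y r (b * D + j)
            = (\<Sum>p<m. L r p i * cnj (v (a * m + p))) * (\<Sum>q<m. X $$ (a * D + i, b * D + j) * (cnj (L r q j) * v (b * m + q)))"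
          by (simp add: ye ij sum_distrib_left mult.assoc)
        also have "\<dots> = (\<Sum>p<m. \<Sum>q<m. ?t r a p b q i j)"
          unfolding sum_product by (intro sum.cong refl) (simp add: mult_ac)
        finally show "cnj (y r (a * D + i)) * X $$ (a * D + i, b * D + j) * y r (b * D + j) = (\<Sum>p<m. \<Sum>q<m. ?t r a p b q i j)" .
      qed
      finally show "(\<Sum>a<k. \<Sum>b<k. \<Sum>i<D. \<Sum>j<D. \<Sum>p<m. \<Sum>q<m. ?t r a p b q i j) = qform (k * D) (entries X) (y r)"
        by simp
    qed
    also have "0 \<le> \<dots>" using X psd_iff_qform[OF car] by (intro sum_nonneg) auto
    finally show ?thesis .
  qed
  thus "psd (k * m) ?Y" using psd_iff_qform[OF Y] by simp
qed

lemma kraus_map_channel: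
  assumes "finite I" and "\<And>i j. i < D \<Longrightarrow> j < D \<Longrightarrow>
    (\<Sum>r\<in>I. \<Sum>p<m. L r p i * cnj (L r p j)) = (if i = j then 1 else 0)"
  shows "quantum_channel D m (kraus_map D m I L)"
  unfolding quantum_channel_def
  using kraus_map_linear kraus_map_completely_positive kraus_map_trace[OF assms] by blast

section \<open>Bihomogeneous forms at a maximum\<close>

text \<open>Compare Re (cnj a P(r)) \<le> M |P(r)| with M^2 (1 + r^2)^n = M^2 + n M^2 r^2 + ...,
  where a = P(0) and |a| = M. The constant terms agree; dividing by r, or by r^2 when the linear
  coefficient vanishes, and letting r tend to 0 from the right leaves the stated inequality.\<close>

lemma poly_growth_low_order:
  fixes P :: "complex poly"
  assumes bound: "\<And>r. 0 < r \<Longrightarrow> r < 1 \<Longrightarrow> cmod (poly P (of_real r)) \<le> M * (1 + r\<^sup>2) ^ n"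
    and M: "M = cmod (coeff P 0)"
  shows "Re (cnj (coeff P 0) * coeff P 1) \<le> 0"
    and "coeff P 1 = 0 \<Longrightarrow> Re (cnj (coeff P 0) * coeff P 2) \<le> real n * M\<^sup>2"
proof -
  obtain a b Q where P: "P = pCons a (pCons b Q)" by (metis pCons_cases)
  have coeffs: "coeff P 0 = a" "coeff P 1 = b" "coeff P 2 = coeff Q 0"
    by (simp_all add: P numeral_2_eq_2)
  \<comment> \<open>An exact remainder, (1 + r^2)^n = 1 + r^2 S(r) with S(0) = n, from the geometric
    sum.\<close>
  define S where "S = (\<lambda>r::real. \<Sum>i<n. (1 + r\<^sup>2) ^ i)"
  have S: "(1 + r\<^sup>2) ^ n = 1 + r\<^sup>2 * S r" for r
    using power_diff_1_eq[of "1 + r\<^sup>2" n] by (simp add: S_def)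
  have main: "Re (cnj a * b) * r + r\<^sup>2 * Re (cnj a * poly Q (of_real r)) \<le> M\<^sup>2 * (r\<^sup>2 * S r)"
    if r: "0 < r" "r < 1" for r
  proof -
    have p: "poly P (of_real r) = a + of_real r * (b + of_real r * poly Q (of_real r))" by (simp add: P)
    have "Re (cnj a * poly P (of_real r)) \<le> cmod a * cmod (poly P (of_real r))"
      using complex_Re_le_cmod[of "cnj a * poly P (of_real r)"] by (simp add: norm_mult)
    also have "\<dots> \<le> M * (M * (1 + r\<^sup>2) ^ n)"
      using bound[OF r] M coeffs by (intro mult_mono) auto
    finally have "Re (cnj a * poly P (of_real r)) \<le> M\<^sup>2 + M\<^sup>2 * (r\<^sup>2 * S r)"
      unfolding S by (simp add: power2_eq_square algebra_simps)
    moreover have "cnj a * poly P (of_real r) = cnj a * a + of_real r * (cnj a * b) + of_real (r\<^sup>2) * (cnj a * poly Q (of_real r))"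
      unfolding p by (simp add: power2_eq_square algebra_simps)
    hence "Re (cnj a * poly P (of_real r)) = Re (cnj a * a) + r * Re (cnj a * b) + r\<^sup>2 * Re (cnj a * poly Q (of_real r))"
      by (simp only: plus_complex.sel Re_complex_of_real times_complex.sel Im_complex_of_real mult_zero_left diff_zero)
    moreover have "Re (cnj a * a) = M\<^sup>2"
      using complex_norm_square[of a] M coeffs by (metis Re_complex_of_real mult.commute)
    ultimately show ?thesis by (simp add: algebra_simps)
  qed
  have ev: "eventually (\<lambda>r::real. 0 < r \<and> r < 1) (at_right 0)"
    by (rule eventually_at_rightI[of 0 1]) auto
  have St: "(S \<longlongrightarrow> S 0) (at_right 0)"
    unfolding S_def by (intro tendsto_intros)
  have Qt: "((\<lambda>r. Re (cnj a * poly Q (of_real r))) \<longlongrightarrow> Re (cnj a * poly Q (of_real 0))) (at_right 0)"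
    by (intro tendsto_intros)
  have t1: "((\<lambda>r. r * (M\<^sup>2 * S r - Re (cnj a * poly Q (of_real r)))) \<longlongrightarrow>
      0 * (M\<^sup>2 * S 0 - Re (cnj a * poly Q (of_real 0)))) (at_right 0)"
    by (intro tendsto_mult tendsto_diff St Qt tendsto_const tendsto_ident_at)
  have "eventually (\<lambda>r. Re (cnj a * b) \<le> r * (M\<^sup>2 * S r - Re (cnj a * poly Q (of_real r)))) (at_right 0)"
    using ev
  proof (rule eventually_mono)
    fix r :: real assume r: "0 < r \<and> r < 1"
    have "Re (cnj a * b) * r \<le> (r * (M\<^sup>2 * S r - Re (cnj a * poly Q (of_real r)))) * r"
      using main[of r] r by (simp add: power2_eq_square algebra_simps)
    thus "Re (cnj a * b) \<le> r * (M\<^sup>2 * S r - Re (cnj a * poly Q (of_real r)))"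
      using r by (simp only: mult_le_cancel_right)
  qed
  from tendsto_lowerbound[OF t1 this] show "Re (cnj (coeff P 0) * coeff P 1) \<le> 0"
    unfolding coeffs by simp
  show "Re (cnj (coeff P 0) * coeff P 2) \<le> real n * M\<^sup>2" if "coeff P 1 = 0"
  proof -
    have t2: "((\<lambda>r. M\<^sup>2 * S r - Re (cnj a * poly Q (of_real r))) \<longlongrightarrow>
        M\<^sup>2 * S 0 - Re (cnj a * poly Q (of_real 0))) (at_right 0)"
      by (intro tendsto_mult tendsto_diff St Qt tendsto_const)
    have "eventually (\<lambda>r. 0 \<le> M\<^sup>2 * S r - Re (cnj a * poly Q (of_real r))) (at_right 0)"
      using ev
    proof (rule eventually_mono)
      fix r :: real assume r: "0 < r \<and> r < 1"
      have "0 \<le> r\<^sup>2 * (M\<^sup>2 * S r - Re (cnj a * poly Q (of_real r)))"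
        using main[of r] r that coeffs by (simp add: algebra_simps)
      thus "0 \<le> M\<^sup>2 * S r - Re (cnj a * poly Q (of_real r))"
        using r by (simp add: zero_le_mult_iff)
    qed
    from tendsto_lowerbound[OF t2 this] show ?thesis
      unfolding coeffs by (simp add: S_def poly_0_coeff_0 mult.commute)
  qed
qed

text \<open>\<open>polar\<close> is the polarization, in one slot of each tensor factor, of the form
  \<open>u, v \<mapsto> \<langle>u\<^sup>\<otimes>\<^sup>n \<otimes> v\<^sup>\<otimes>\<^sup>n | \<Psi>\<rangle>\<close>, where \<open>\<Psi> = \<Sum>k. c k (X k)\<^sup>\<otimes>\<^sup>n \<otimes> (Y k)\<^sup>\<otimes>\<^sup>n\<close> and \<open>n = Suc m\<close>.\<close>

definition polar :: "nat \<Rightarrow> nat \<Rightarrow> nat \<Rightarrow> (nat \<Rightarrow> complex) \<Rightarrow> (nat \<Rightarrow> nat \<Rightarrow> complex) \<Rightarrow> (nat \<Rightarrow> nat \<Rightarrow> complex)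
    \<Rightarrow> (nat \<Rightarrow> complex) \<Rightarrow> (nat \<Rightarrow> complex) \<Rightarrow> (nat \<Rightarrow> complex) \<Rightarrow> (nat \<Rightarrow> complex) \<Rightarrow> complex" where
  "polar d m K c X Y u v z w =
    (\<Sum>k<K. c k * (cip d z (X k) * cip d u (X k) ^ m) * (cip d w (Y k) * cip d v (Y k) ^ m))"

definition form :: "nat \<Rightarrow> nat \<Rightarrow> nat \<Rightarrow> (nat \<Rightarrow> complex) \<Rightarrow> (nat \<Rightarrow> nat \<Rightarrow> complex) \<Rightarrow> (nat \<Rightarrow> nat \<Rightarrow> complex)
    \<Rightarrow> (nat \<Rightarrow> complex) \<Rightarrow> (nat \<Rightarrow> complex) \<Rightarrow> complex" where
  "form d n K c X Y u v = (\<Sum>k<K. c k * cip d u (X k) ^ n * cip d v (Y k) ^ n)"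

lemma polar_diag: "polar d m K c X Y u v u v = form d (Suc m) K c X Y u v"
  by (simp add: polar_def form_def)

lemma form_swap: "form d n K c X Y u v = form d n K c Y X v u"
  by (simp add: form_def mult_ac)

lemma polar_swap: "polar d m K c X Y u v z w = polar d m K c Y X v u w z"
  by (simp add: polar_def mult_ac)

lemma polar_scale: "polar d m K c X Y u v (\<lambda>i. a * z i) (\<lambda>i. b * w i) = cnj a * cnj b * polar d m K c X Y u v z w"
  by (simp add: polar_def cip_scale_left sum_distrib_left mult_ac)

text \<open>Maximality on unit vectors in its homogeneous form, so that it can be applied directly
  to displaced vectors of norm other than 1.\<close>

definition max_at :: "nat \<Rightarrow> nat \<Rightarrow> nat \<Rightarrow> (nat \<Rightarrow> complex) \<Rightarrow> (nat \<Rightarrow> nat \<Rightarrow> complex) \<Rightarrow> (nat \<Rightarrow> nat \<Rightarrow> complex)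
    \<Rightarrow> (nat \<Rightarrow> complex) \<Rightarrow> (nat \<Rightarrow> complex) \<Rightarrow> bool" where
  "max_at d n K c X Y u v \<longleftrightarrow> nsq d u = 1 \<and> nsq d v = 1 \<and>
    (\<forall>x y. cmod (form d n K c X Y x y) \<le> cmod (form d n K c X Y u v) * sqrt (nsq d x) ^ n * sqrt (nsq d y) ^ n)"

lemma max_at_swap:
  assumes "max_at d n K c X Y u v"
  shows "max_at d n K c Y X v u"
  unfolding max_at_def
proof (intro conjI allI)
  fix x y
  have "cmod (form d n K c X Y y x) \<le> cmod (form d n K c X Y u v) * sqrt (nsq d y) ^ n * sqrt (nsq d x) ^ n"
    using assms unfolding max_at_def by blast
  thus "cmod (form d n K c Y X x y) \<le> cmod (form d n K c Y X v u) * sqrt (nsq d x) ^ n * sqrt (nsq d y) ^ n"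
    by (simp only: form_swap[of d n K c Y X] mult_ac)
qed (use assms in \<open>auto simp: max_at_def\<close>)

lemma coeff_linear_power_low:
  fixes a b :: complex
  shows "coeff ([:a, b:] ^ n) 0 = a ^ n" "coeff ([:a, b:] ^ n) 1 = of_nat n * b * a ^ (n - 1)"
    "coeff ([:a, b:] ^ n) 2 = of_nat (n choose 2) * b\<^sup>2 * a ^ (n - 2)"
proof -
  have "degree ([:a, b:] ^ n) \<le> n"
    using degree_power_le[of "[:a, b:]" n] by (rule order_trans) (simp add: mult_le_cancel2)
  hence "coeff ([:a, b:] ^ n) i = of_nat (n choose i) * b ^ i * a ^ (n - i)" for i
    by (cases "i \<le> n") (simp_all add: coeff_linear_poly_power coeff_eq_0)
  from this[of 0] this[of 1] this[of 2]
  show "coeff ([:a, b:] ^ n) 0 = a ^ n" "coeff ([:a, b:] ^ n) 1 = of_nat n * b * a ^ (n - 1)"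
    "coeff ([:a, b:] ^ n) 2 = of_nat (n choose 2) * b\<^sup>2 * a ^ (n - 2)" by simp_all
qed

lemma nsq_displace:
  assumes "nsq d u = 1" "nsq d z = 1" "cip d u z = 0" "cmod a = 1"
  shows "nsq d (\<lambda>i. u i + a * of_real r * z i) = 1 + r\<^sup>2"
  using assms by (simp add: nsq_add nsq_scale cip_scale_right norm_mult)

lemma exists_phase: "\<exists>\<phi>. cmod \<phi> = 1 \<and> \<phi> * w = of_real (cmod w)"
proof (cases "w = 0")
  case True
  thus ?thesis by (intro exI[of _ 1]) simp
next
  case False
  have "cnj w / of_real (cmod w) * w = of_real (cmod w)"
    using False complex_norm_square[of w] by (simp add: field_simps power2_eq_square)
  thus ?thesis using False by (intro exI[of _ "cnj w / of_real (cmod w)"]) (simp add: norm_divide)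
qed

text \<open>An orthogonal displacement changes the norm of \<open>u\<close> only to second order, so
  a nonzero linear term of the form, with its phase turned to that of the value, would beat the
  maximum.\<close>

lemma max_at_first_order:
  assumes max: "max_at d (Suc m) K c X Y u v" and f: "form d (Suc m) K c X Y u v \<noteq> 0"
    and z: "nsq d z = 1" "cip d u z = 0"
  shows "polar d m K c X Y u v z v = 0"
proof -
  define N where "N = Suc m"
  note max = max[folded N_def] and f = f[folded N_def]
  define f where "f = form d (N) K c X Y u v"
  let ?b = "polar d m K c X Y u v z v"
  obtain \<phi> where \<phi>: "cmod \<phi> = 1" "\<phi> * (cnj f * ?b) = of_real (cmod (cnj f * ?b))"
    using exists_phase[of "cnj f * ?b"] by blast
  \<comment> \<open>The form is antilinear in each copy of \<open>u\<close>, so displacing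
    \<open>u\<close> by cnj \<phi> r z makes it a polynomial in r whose linear coefficient carries
    \<phi> itself.\<close>
  define P where "P = (\<Sum>k<K. smult (c k * cip d v (Y k) ^ N) ([:cip d u (X k), \<phi> * cip d z (X k):] ^ N))"
  have val: "poly P (of_real r) = form d (N) K c X Y (\<lambda>i. u i + cnj \<phi> * of_real r * z i) v" for r
    by (simp add: P_def form_def poly_sum poly_power cip_add_left cip_scale_left mult_ac)
  have c0: "coeff P 0 = f"
    unfolding P_def f_def form_def coeff_sum coeff_smult coeff_linear_power_low by (simp add: mult_ac)
  have c1: "coeff P 1 = of_nat N * \<phi> * ?b"
    unfolding P_def polar_def coeff_sum coeff_smult coeff_linear_power_low sum_distrib_left
    by (intro sum.cong refl) (simp add: N_def mult_ac)
  have bd: "cmod (form d N K c X Y x y) \<le> cmod f * sqrt (nsq d x) ^ N * sqrt (nsq d y) ^ N" for x y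
    using max unfolding max_at_def f_def by blast
  have v1: "nsq d v = 1" and u1: "nsq d u = 1" using max by (auto simp: max_at_def)
  have "cmod (poly P (of_real r)) \<le> cmod f * (1 + r\<^sup>2) ^ N" if "0 < r" for r
  proof -
    have "cmod (poly P (of_real r)) \<le> cmod f * sqrt (1 + r\<^sup>2) ^ N * sqrt 1 ^ N"
      unfolding val using nsq_displace[OF u1 z, of "cnj \<phi>" r] \<phi>(1)
      by (intro order_trans[OF bd]) (simp add: v1)
    \<comment> \<open>Only one of the two vectors moves, so the exact growth is sqrt (1 + r^2)^N.
      The weaker bound still has no linear term, which is all that matters here.\<close>
    also have "\<dots> \<le> cmod f * (1 + r\<^sup>2) ^ N"
    proof -
      have "(1 + r\<^sup>2) * 1 \<le> (1 + r\<^sup>2) * (1 + r\<^sup>2)" by (rule mult_left_mono) auto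
      hence "sqrt (1 + r\<^sup>2) \<le> 1 + r\<^sup>2" by (intro real_le_lsqrt) (auto simp: power2_eq_square[of "1 + r\<^sup>2"])
      thus ?thesis by (simp only: real_sqrt_one power_one mult_1_right) (intro mult_left_mono power_mono, auto)
    qed
    finally show ?thesis .
  qed
  hence "Re (cnj (coeff P 0) * coeff P 1) \<le> 0"
    using c0 by (intro poly_growth_low_order(1)) auto
  also have "cnj (coeff P 0) * coeff P 1 = of_nat (N) * (\<phi> * (cnj f * ?b))"
    unfolding c0 c1 by (simp add: mult_ac)
  finally have "real N * cmod (cnj f * ?b) \<le> 0"
    unfolding \<phi>(2) by (simp add: norm_mult)
  hence "cmod (cnj f * ?b) = 0" by (auto simp: mult_le_0_iff norm_mult N_def)
  thus ?thesis using f by (simp add: f_def)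
qed

text \<open>Averaging over the displacements \<open>(\<omega> z, \<omega>\<^sup>-\<^sup>1 w)\<close> with \<open>\<omega>\<^sup>4 = 1\<close> removes all terms of order at most two
  other than the constant and the mixed second derivative.\<close>

lemma max_at_second_order:
  assumes max: "max_at d (Suc m) K c X Y u v" and f: "form d (Suc m) K c X Y u v \<noteq> 0"
    and z: "nsq d z = 1" "cip d u z = 0" and w: "nsq d w = 1" "cip d v w = 0"
  shows "cmod (polar d m K c X Y u v z w) \<le> cmod (form d (Suc m) K c X Y u v) / real (Suc m)"
proof -
  define N where "N = Suc m"
  note max = max[folded N_def] and f = f[folded N_def]
  define f where "f = form d (N) K c X Y u v"
  let ?b = "polar d m K c X Y u v z w"
  obtain \<phi> where \<phi>: "cmod \<phi> = 1" "\<phi> * (cnj f * ?b) = of_real (cmod (cnj f * ?b))"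
    using exists_phase[of "cnj f * ?b"] by blast
  define A B C D where "A = (\<lambda>k. cip d u (X k))" and "B = (\<lambda>k. cip d z (X k))"
    and "C = (\<lambda>k. cip d v (Y k))" and "D = (\<lambda>k. cip d w (Y k))"
  define p where "p = (\<lambda>\<omega> k. [:A k, \<omega> * B k:] ^ N)"
  \<comment> \<open>The phase \<phi> sits on one side only: the mixed term then carries \<omega>
    \<phi> cnj \<omega> = \<phi> for each root of unity, which aligns it with
    \<open>f\<close>.\<close>
  define q where "q = (\<lambda>\<omega> k. [:C k, \<phi> * cnj \<omega> * D k:] ^ N)"
  define P where "P = (\<lambda>\<omega>. \<Sum>k<K. smult (c k) (p \<omega> k * q \<omega> k))"
  define T where "T = P 1 + P \<i> + P (-1) + P (-\<i>)"
  have val: "poly (P \<omega>) (of_real r) =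
      form d (N) K c X Y (\<lambda>i. u i + cnj \<omega> * of_real r * z i) (\<lambda>i. v i + cnj (\<phi> * cnj \<omega>) * of_real r * w i)" for \<omega> r
    by (simp add: P_def p_def q_def A_def B_def C_def D_def form_def poly_sum poly_power cip_add_left
        cip_scale_left mult_ac)
  have bd: "cmod (form d N K c X Y x y) \<le> cmod f * sqrt (nsq d x) ^ N * sqrt (nsq d y) ^ N" for x y
    using max unfolding max_at_def f_def by blast
  have v1: "nsq d v = 1" and u1: "nsq d u = 1" using max by (auto simp: max_at_def)
  have pb: "cmod (poly (P \<omega>) (of_real r)) \<le> cmod f * (1 + r\<^sup>2) ^ N" if "cmod \<omega> = 1" for \<omega> r
  proof -
    have "cmod (poly (P \<omega>) (of_real r)) \<le> cmod f * sqrt (1 + r\<^sup>2) ^ N * sqrt (1 + r\<^sup>2) ^ N"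
    proof -
      have "nsq d (\<lambda>i. u i + cnj \<omega> * of_real r * z i) = 1 + r\<^sup>2"
        using that by (intro nsq_displace[OF u1 z]) simp
      moreover have "nsq d (\<lambda>i. v i + cnj (\<phi> * cnj \<omega>) * of_real r * w i) = 1 + r\<^sup>2"
        using that \<phi>(1) by (intro nsq_displace[OF v1 w]) (simp add: norm_mult)
      ultimately show ?thesis unfolding val by (metis bd)
    qed
    also have "\<dots> = cmod f * (sqrt (1 + r\<^sup>2) * sqrt (1 + r\<^sup>2)) ^ N"
      by (simp only: power_mult_distrib mult.assoc)
    also have "sqrt (1 + r\<^sup>2) * sqrt (1 + r\<^sup>2) = 1 + r\<^sup>2" by (simp add: add_nonneg_nonneg)
    finally show ?thesis .
  qed
  have bound: "cmod (poly T (of_real r)) \<le> (4 * cmod f) * (1 + r\<^sup>2) ^ N" for r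
  proof -
    have "cmod (poly T (of_real r)) \<le> cmod (poly (P 1) (of_real r)) + cmod (poly (P \<i>) (of_real r))
        + cmod (poly (P (-1)) (of_real r)) + cmod (poly (P (-\<i>)) (of_real r))"
      unfolding T_def poly_add by (intro order_trans[OF norm_triangle_ineq] add_mono order_refl)
    also have "\<dots> \<le> (4 * cmod f) * (1 + r\<^sup>2) ^ N"
      using pb[of 1 r] pb[of \<i> r] pb[of "-1" r] pb[of "-\<i>" r] by simp
    finally show ?thesis .
  qed
  define n where "n = (of_nat (N) :: complex)"
  define e2 where "e2 = (of_nat (N choose 2) :: complex)"
  have p0: "coeff (p \<omega> k) 0 = A k ^ N" and p1: "coeff (p \<omega> k) 1 = n * \<omega> * B k * A k ^ m"
    and p2: "coeff (p \<omega> k) 2 = e2 * \<omega>\<^sup>2 * (B k)\<^sup>2 * A k ^ (N - 2)" for \<omega> k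
    unfolding p_def coeff_linear_power_low by (simp_all add: n_def e2_def power_mult_distrib mult_ac) (simp add: N_def)
  have q0: "coeff (q \<omega> k) 0 = C k ^ N" and q1: "coeff (q \<omega> k) 1 = n * (\<phi> * cnj \<omega>) * D k * C k ^ m"
    and q2: "coeff (q \<omega> k) 2 = e2 * (\<phi> * cnj \<omega>)\<^sup>2 * (D k)\<^sup>2 * C k ^ (N - 2)" for \<omega> k
    unfolding q_def coeff_linear_power_low by (simp_all add: n_def e2_def power_mult_distrib mult_ac) (simp add: N_def)
  have m0: "coeff (p' * q') 0 = coeff p' 0 * coeff q' 0"
    and m1: "coeff (p' * q') 1 = coeff p' 0 * coeff q' 1 + coeff p' 1 * coeff q' 0"
    and m2: "coeff (p' * q') 2 = coeff p' 0 * coeff q' 2 + coeff p' 1 * coeff q' 1 + coeff p' 2 * coeff q' 0"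
    for p' q' :: "complex poly"
    by (simp_all add: coeff_mult numeral_2_eq_2)
  have T0: "coeff T 0 = 4 * f"
    unfolding T_def P_def
    by (simp only: coeff_add coeff_sum coeff_smult m0 p0 q0)
      (simp add: f_def form_def A_def C_def mult.assoc)
  have T1: "coeff T 1 = 0"
    unfolding T_def P_def
    by (simp only: coeff_add coeff_sum coeff_smult m1 p0 q0 p1 q1 sum.distrib[symmetric])
      (rule sum.neutral, simp add: algebra_simps)
  \<comment> \<open>n^2 is the product of the two linear binomial coefficients, 4 the number of
    roots of unity. Against the second-order growth N of the bound this leaves N^2 |b| \<le> N
    |f|.\<close>
  have T2: "coeff T 2 = 4 * n\<^sup>2 * \<phi> * ?b"
    unfolding T_def P_def
    by (simp only: coeff_add coeff_sum coeff_smult m2 p0 q0 p1 q1 p2 q2 sum.distrib[symmetric] polar_def sum_distrib_left)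
      (intro sum.cong refl, simp add: A_def B_def C_def D_def power2_eq_square algebra_simps)
  have "Re (cnj (coeff T 0) * coeff T 2) \<le> real N * (4 * cmod f)\<^sup>2"
    using bound T0 T1 by (intro poly_growth_low_order(2)) (auto simp: norm_mult)
  also have "cnj (coeff T 0) * coeff T 2 = of_real (16 * (real N)\<^sup>2) * (\<phi> * (cnj f * ?b))"
    unfolding T0 T2 by (simp add: n_def mult_ac)
  finally have "16 * (real N)\<^sup>2 * cmod (cnj f * ?b) \<le> real N * (4 * cmod f)\<^sup>2"
    unfolding \<phi>(2) by (simp only: of_real_mult[symmetric] Re_complex_of_real)
  hence "(real N * cmod f) * (real N * cmod ?b) \<le> (real N * cmod f) * cmod f"
    by (simp add: norm_mult power2_eq_square mult_ac)
  moreover have "0 < real N * cmod f" using f by (intro mult_pos_pos) (simp_all add: f_def N_def)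
  ultimately have "real N * cmod ?b \<le> cmod f" by (simp only: mult_le_cancel_left_pos)
  moreover have "0 < real N" by (simp add: N_def)
  ultimately have "cmod ?b \<le> cmod f / real N" by (simp add: pos_le_divide_eq mult.commute)
  thus ?thesis by (simp only: f_def N_def)
qed

text \<open>The contraction g of the eigenvector with m copies of \<open>u\<close> and of
  \<open>v\<close>, as a d by d matrix; \<open>polar\<close> is its inner product with z \<otimes>
  w.\<close>

definition polar_entry :: "nat \<Rightarrow> nat \<Rightarrow> nat \<Rightarrow> (nat \<Rightarrow> complex) \<Rightarrow> (nat \<Rightarrow> nat \<Rightarrow> complex) \<Rightarrow> (nat \<Rightarrow> nat \<Rightarrow> complex)
    \<Rightarrow> (nat \<Rightarrow> complex) \<Rightarrow> (nat \<Rightarrow> complex) \<Rightarrow> nat \<Rightarrow> nat \<Rightarrow> complex" where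
  "polar_entry d m K c X Y u v j l =
    (\<Sum>k<K. c k * (X k j * cip d u (X k) ^ m) * (Y k l * cip d v (Y k) ^ m))"

lemma polar_cip:
  "polar d m K c X Y u v z w = cip d w (\<lambda>l. cip d z (\<lambda>j. polar_entry d m K c X Y u v j l))"
proof -
  have 1: "cip d z (\<lambda>j. polar_entry d m K c X Y u v j l)
      = (\<Sum>k<K. (c k * (cip d z (X k) * cip d u (X k) ^ m) * cip d v (Y k) ^ m) * Y k l)" for l
  proof -
    have "cip d z (\<lambda>j. polar_entry d m K c X Y u v j l)
        = cip d z (\<lambda>j. \<Sum>k<K. (c k * cip d u (X k) ^ m * (Y k l * cip d v (Y k) ^ m)) * X k j)"
      unfolding polar_entry_def by (simp add: mult_ac)
    thus ?thesis unfolding cip_sum_right cip_scale_right by (simp add: mult_ac)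
  qed
  show ?thesis
    unfolding 1 cip_sum_right cip_scale_right polar_def by (simp add: mult_ac)
qed

lemma unit_multiple:
  assumes "nsq d z \<noteq> 0"
  obtains z' where "nsq d z' = 1" "z = (\<lambda>i. of_real (sqrt (nsq d z)) * z' i)"
    "\<And>x. cip d x z = 0 \<Longrightarrow> cip d x z' = 0"
proof
  let ?z = "\<lambda>i. of_real (1 / sqrt (nsq d z)) * z i"
  show "nsq d ?z = 1" using unit_normalize[OF assms] .
  show "z = (\<lambda>i. of_real (sqrt (nsq d z)) * ?z i)" using assms by auto
  show "cip d x ?z = 0" if "cip d x z = 0" for x
    unfolding cip_scale_right using that by simp
qed

lemma polar_zero_left: "nsq d z = 0 \<Longrightarrow> polar d m K c X Y u v z w = 0"
proof -
  assume "nsq d z = 0"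
  hence "cip d z x = 0" for x using nsq_eq_0[of d z] by (simp add: cip_def)
  thus ?thesis by (simp add: polar_def)
qed

lemma max_at_polar_left:
  assumes "max_at d (Suc m) K c X Y u v" "form d (Suc m) K c X Y u v \<noteq> 0" "cip d u z = 0"
  shows "polar d m K c X Y u v z v = 0"
proof (cases "nsq d z = 0")
  case True
  thus ?thesis by (rule polar_zero_left)
next
  case False
  obtain z' where z': "nsq d z' = 1" "z = (\<lambda>i. of_real (sqrt (nsq d z)) * z' i)"
    "\<And>x. cip d x z = 0 \<Longrightarrow> cip d x z' = 0" using unit_multiple[of d z] False by blast
  have "polar d m K c X Y u v z' v = 0"
    using max_at_first_order[OF assms(1,2) z'(1) z'(3)[OF assms(3)]] .
  thus ?thesis
    by (subst z'(2)) (use polar_scale[of d m K c X Y u v _ z' 1 v] in simp)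
qed

lemma max_at_polar_right:
  assumes "max_at d (Suc m) K c X Y u v" "form d (Suc m) K c X Y u v \<noteq> 0" "cip d v w = 0"
  shows "polar d m K c X Y u v u w = 0"
  using max_at_polar_left[OF max_at_swap[OF assms(1)], of w] assms(2,3)
  by (simp add: form_swap[of d "Suc m" K c Y X] polar_swap[of d m K c X Y u v])

lemma max_at_polar_bound:
  assumes "max_at d (Suc m) K c X Y u v" "form d (Suc m) K c X Y u v \<noteq> 0"
    and z: "cip d u z = 0" and w: "cip d v w = 0"
  shows "(cmod (polar d m K c X Y u v z w))\<^sup>2
    \<le> (cmod (form d (Suc m) K c X Y u v) / real (Suc m))\<^sup>2 * (nsq d z * nsq d w)"
proof (cases "nsq d z = 0 \<or> nsq d w = 0")
  case True
  hence "polar d m K c X Y u v z w = 0"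
    using polar_zero_left[of d z m K c X Y u v w] polar_zero_left[of d w m K c Y X v u z]
    by (auto simp: polar_swap[of d m K c X Y u v])
  thus ?thesis by simp
next
  case False
  obtain z' where z': "nsq d z' = 1" "z = (\<lambda>i. of_real (sqrt (nsq d z)) * z' i)"
    "\<And>x. cip d x z = 0 \<Longrightarrow> cip d x z' = 0" using unit_multiple[of d z] False by blast
  obtain w' where w': "nsq d w' = 1" "w = (\<lambda>i. of_real (sqrt (nsq d w)) * w' i)"
    "\<And>x. cip d x w = 0 \<Longrightarrow> cip d x w' = 0" using unit_multiple[of d w] False by blast
  have "polar d m K c X Y u v z w = polar d m K c X Y u v (\<lambda>i. of_real (sqrt (nsq d z)) * z' i) (\<lambda>i. of_real (sqrt (nsq d w)) * w' i)"
    by (simp only: z'(2)[symmetric] w'(2)[symmetric])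
  also have "\<dots> = of_real (sqrt (nsq d z) * sqrt (nsq d w)) * polar d m K c X Y u v z' w'"
    unfolding polar_scale by simp
  finally have "(cmod (polar d m K c X Y u v z w))\<^sup>2 = (nsq d z * nsq d w) * (cmod (polar d m K c X Y u v z' w'))\<^sup>2"
    by (simp add: norm_mult power_mult_distrib)
  also have "\<dots> \<le> (nsq d z * nsq d w) * (cmod (form d (Suc m) K c X Y u v) / real (Suc m))\<^sup>2"
    using max_at_second_order[OF assms(1,2) z'(1) z'(3)[OF z] w'(1) w'(3)[OF w]]
    by (intro mult_left_mono power_mono mult_nonneg_nonneg) auto
  finally show ?thesis by (simp add: mult_ac)
qed

lemma nsq_pair: "nsq (a * b) (\<lambda>p. F (p div b) (p mod b)) = (\<Sum>j<a. nsq b (F j))"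
  by (simp add: nsq_def sum_lessThan_mult)

lemma cip_pair: "cip (a * b) (\<lambda>p. F (p div b) (p mod b)) (\<lambda>p. G (p div b) (p mod b)) = (\<Sum>j<a. cip b (F j) (G j))"
  by (simp add: cip_def sum_lessThan_mult)

lemma cip_tensor:
  "cip (a * b) (\<lambda>p. x (p div b) * y (p mod b)) (\<lambda>p. x' (p div b) * y' (p mod b)) = cip a x x' * cip b y y'"
  unfolding cip_pair[of a b "\<lambda>j l. x j * y l" "\<lambda>j l. x' j * y' l"] cip_scale_left cip_scale_right
  by (simp add: cip_def[of a] sum_distrib_left mult_ac)

text \<open>Testing the rows of the matrix of the polarized form against the vectors
  \<open>e\<^sub>j - \<langle>u|e\<^sub>j\<rangle> u\<close> gains the factor \<open>d - 1 = (\<Sum>j. \<parallel>e\<^sub>j - \<langle>u|e\<^sub>j\<rangle> u\<parallel>\<^sup>2)\<close> instead of \<open>d\<close>.\<close>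

lemma polar_entry_deviation:
  assumes max: "max_at d (Suc m) K c X Y u v" and f0: "form d (Suc m) K c X Y u v \<noteq> 0"
  defines "f \<equiv> form d (Suc m) K c X Y u v"
  defines "\<Delta> \<equiv> (\<lambda>j l. polar_entry d m K c X Y u v j l - f * (u j * v l))"
  shows "j < d \<Longrightarrow> cip d v (\<Delta> j) = 0"
    and "(\<Sum>j<d. nsq d (\<Delta> j)) \<le> (cmod f / real (Suc m))\<^sup>2 * (real d - 1)"
proof -
  let ?g = "polar_entry d m K c X Y u v"
  have u1: "nsq d u = 1" and v1: "nsq d v = 1" using max by (auto simp: max_at_def)
  define Q where "Q = (\<lambda>x :: nat \<Rightarrow> complex. \<lambda>j i. (if i = j then 1 else 0) - cnj (x j) * x i)"
  have cQ: "cip d (Q x j) y = y j - x j * cip d x y" if "j < d" for x y j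
  proof -
    have "cip d (\<lambda>i. if i = j then 1 else 0) y = (\<Sum>i<d. y i * (if i = j then 1 else 0))"
      unfolding cip_def by (intro sum.cong refl) auto
    also have "\<dots> = y j" using that by (simp add: mult_indicator)
    finally show ?thesis unfolding Q_def cip_diff_left cip_scale_left by simp
  qed
  have Qorth: "cip d x (Q x j) = 0" if "j < d" "nsq d x = 1" for x j
    using cQ[OF that(1), of x x] that(2) cip_self[of d x] cip_commute[of d "Q x j" x] by simp
  have Qn: "nsq d (Q x j) = 1 - (cmod (x j))\<^sup>2" if "j < d" "nsq d x = 1" for x j
  proof -
    have "complex_of_real (nsq d (Q x j)) = Q x j j - x j * cip d x (Q x j)"
      using cQ[OF that(1), of x "Q x j"] by (simp add: cip_self)
    also have "\<dots> = 1 - x j * cnj (x j)" using Qorth[OF that] by (simp add: Q_def)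
    also have "\<dots> = of_real (1 - (cmod (x j))\<^sup>2)"
      by (simp only: complex_norm_square[symmetric] of_real_diff of_real_1)
    finally show ?thesis by (simp only: of_real_eq_iff)
  qed
  \<comment> \<open>The first-order condition in \<open>v\<close>: contracting g with
    \<open>u\<close> leaves a vector orthogonal to the complement of \<open>v\<close>, hence f
    v.\<close>
  have Rl: "cip d u (\<lambda>j. ?g j l) = f * v l" if "l < d" for l
  proof -
    have "cip d (Q v l) (\<lambda>l. cip d u (\<lambda>j. ?g j l)) = 0"
      using max_at_polar_right[OF max f0 Qorth[OF that v1]] by (simp add: polar_cip)
    moreover have "cip d v (\<lambda>l. cip d u (\<lambda>j. ?g j l)) = f"
      by (simp add: polar_cip[symmetric] polar_diag f_def)
    ultimately show ?thesis unfolding cQ[OF that] by (simp add: mult.commute)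
  qed
  \<comment> \<open>Removing the \<open>u\<close> component of the j-th basis vector subtracts
    exactly the product part f u_j v from row j of g.\<close>
  have row: "polar d m K c X Y u v (Q u j) w = cip d w (\<Delta> j)" if "j < d" for j w
    unfolding polar_cip by (rule cip_cong) (simp_all add: cQ[OF that] Rl \<Delta>_def mult_ac)
  show orth: "cip d v (\<Delta> j) = 0" if "j < d" for j
    using max_at_polar_left[OF max f0 Qorth[OF that u1]] row[OF that] by simp
  \<comment> \<open>The second slot is tested with the row \<Delta>_j itself, which is admissible
    because it is orthogonal to \<open>v\<close>; one factor |\<Delta>_j|^2 then cancels.\<close>
  have bound: "nsq d (\<Delta> j) \<le> (cmod f / real (Suc m))\<^sup>2 * (1 - (cmod (u j))\<^sup>2)" if "j < d" for j
  proof -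
    have "(nsq d (\<Delta> j))\<^sup>2 = (cmod (cip d (\<Delta> j) (\<Delta> j)))\<^sup>2" by (simp add: cip_self)
    also have "\<dots> \<le> (cmod f / real (Suc m))\<^sup>2 * (nsq d (Q u j) * nsq d (\<Delta> j))"
      using max_at_polar_bound[OF max f0 Qorth[OF that u1] orth[OF that]]
      unfolding row[OF that] f_def .
    finally have *: "nsq d (\<Delta> j) * nsq d (\<Delta> j)
        \<le> ((cmod f / real (Suc m))\<^sup>2 * (1 - (cmod (u j))\<^sup>2)) * nsq d (\<Delta> j)"
      by (simp add: Qn[OF that u1] power2_eq_square mult.assoc)
    show ?thesis
    proof (cases "nsq d (\<Delta> j) = 0")
      case True
      thus ?thesis using nsq_nonneg[of d "Q u j"] Qn[OF that u1] by simp
    next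
      case False
      hence "0 < nsq d (\<Delta> j)" using nsq_nonneg[of d "\<Delta> j"] by linarith
      thus ?thesis using * by (simp only: mult_le_cancel_right_pos)
    qed
  qed
  have "(\<Sum>j<d. nsq d (\<Delta> j)) \<le> (\<Sum>j<d. (cmod f / real (Suc m))\<^sup>2 * (1 - (cmod (u j))\<^sup>2))"
    using bound by (intro sum_mono) simp
  also have "\<dots> = (cmod f / real (Suc m))\<^sup>2 * (real d - nsq d u)"
    by (simp only: sum_distrib_left[symmetric] sum_subtractf nsq_def) simp
  finally show "(\<Sum>j<d. nsq d (\<Delta> j)) \<le> (cmod f / real (Suc m))\<^sup>2 * (real d - 1)" by (simp only: u1)
qed

text \<open>With W the observable given by \<open>e\<close> and \<open>w\<close>: \<open>a\<close>
  is uv, \<open>\<kappa>\<close> is W uv, \<open>h\<close> is <uv|W|uv>, and \<open>eig\<close> is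
  the eigenvalue equation tested against the maximizing product power. The bound 1/2 on the part of
  W uv orthogonal to uv is the maximum of sqrt (h - h^2), taken at h = 1/2.\<close>

theorem max_at_product_bound:
  assumes max: "max_at d (Suc m) K c X Y u v" and f0: "form d (Suc m) K c X Y u v \<noteq> 0" and d: "1 \<le> d"
    and e: "orthonormal (d * d) (d * d) e" and w: "\<And>k. k < d * d \<Longrightarrow> 0 \<le> w k \<and> w k \<le> (1::real)"
  defines "a \<equiv> (\<lambda>p. u (p div d) * v (p mod d))"
  assumes eig: "(\<Sum>k<d * d. of_real (w k) * cnj (cip (d * d) (e k) a) *
      cip (d * d) (e k) (\<lambda>p. polar_entry d m K c X Y u v (p div d) (p mod d))) = of_real \<mu> * form d (Suc m) K c X Y u v"
  shows "\<mu> \<le> (\<Sum>k<d * d. w k * (cmod (cip (d * d) (e k) a))\<^sup>2) + sqrt (real d - 1) / (2 * real (Suc m))"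
proof -
  let ?n = "d * d"
  define f where "f = form d (Suc m) K c X Y u v"
  define G where "G = (\<lambda>p. polar_entry d m K c X Y u v (p div d) (p mod d))"
  define \<Delta> where "\<Delta> = (\<lambda>j l. polar_entry d m K c X Y u v j l - f * (u j * v l))"
  define \<delta> where "\<delta> = (\<lambda>p. \<Delta> (p div d) (p mod d))"
  define h where "h = (\<Sum>k<?n. w k * (cmod (cip ?n (e k) a))\<^sup>2)"
  define \<kappa> where "\<kappa> = (\<lambda>p. \<Sum>k<?n. (of_real (w k) * cip ?n (e k) a) * e k p)"
  have \<kappa>: "cip ?n \<kappa> y = (\<Sum>k<?n. of_real (w k) * cnj (cip ?n (e k) a) * cip ?n (e k) y)" for y
    unfolding \<kappa>_def cip_sum_left cip_scale_left by simp
  have a1: "nsq ?n a = 1"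
  proof -
    have "complex_of_real (nsq ?n a) = cip d u u * cip d v v"
      unfolding a_def cip_self[symmetric] by (rule cip_tensor)
    thus ?thesis using max by (simp add: cip_self max_at_def flip: of_real_mult)
  qed
  have \<kappa>a: "cip ?n \<kappa> a = of_real h"
    unfolding \<kappa> h_def of_real_sum
    by (intro sum.cong refl) (simp add: complex_norm_square mult_ac del: of_real_power)
  have \<kappa>\<kappa>: "nsq ?n \<kappa> \<le> h"
  proof -
    have "complex_of_real (nsq ?n \<kappa>) = (\<Sum>k<?n. of_real (w k) * cnj (cip ?n (e k) a) * cip ?n (e k) \<kappa>)"
      by (simp only: cip_self[symmetric] \<kappa>)
    also have "\<dots> = (\<Sum>k<?n. of_real (w k * w k * (cmod (cip ?n (e k) a))\<^sup>2))"
    proof (intro sum.cong refl)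
      fix k assume "k \<in> {..<?n}"
      hence "cip ?n (e k) \<kappa> = of_real (w k) * cip ?n (e k) a"
        unfolding \<kappa>_def using orthonormal_cip_sum[OF e] by simp
      thus "of_real (w k) * cnj (cip ?n (e k) a) * cip ?n (e k) \<kappa> = of_real (w k * w k * (cmod (cip ?n (e k) a))\<^sup>2)"
        by (simp add: complex_norm_square mult_ac del: of_real_power)
    qed
    finally have "nsq ?n \<kappa> = (\<Sum>k<?n. w k * w k * (cmod (cip ?n (e k) a))\<^sup>2)"
      by (simp only: of_real_sum[symmetric] of_real_eq_iff)
    also have "\<dots> \<le> h" unfolding h_def
    proof (rule sum_mono)
      fix k assume "k \<in> {..<?n}"
      hence "w k * w k \<le> w k * 1" using w[of k] by (intro mult_left_mono) auto
      thus "w k * w k * (cmod (cip ?n (e k) a))\<^sup>2 \<le> w k * (cmod (cip ?n (e k) a))\<^sup>2"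
        by (intro mult_right_mono) auto
    qed
    finally show ?thesis .
  qed
  have a\<delta>: "cip ?n a \<delta> = 0"
  proof -
    have "cip ?n a \<delta> = (\<Sum>j<d. cip d (\<lambda>l. u j * v l) (\<Delta> j))"
      unfolding a_def \<delta>_def by (rule cip_pair)
    also have "\<dots> = 0"
      unfolding cip_scale_left using polar_entry_deviation(1)[OF max f0]
      by (intro sum.neutral ballI) (simp add: \<Delta>_def f_def)
    finally show ?thesis .
  qed
  have \<delta>n: "nsq ?n \<delta> \<le> (cmod f / real (Suc m))\<^sup>2 * (real d - 1)"
  proof -
    have "nsq ?n \<delta> = (\<Sum>j<d. nsq d (\<Delta> j))" unfolding \<delta>_def by (rule nsq_pair)
    thus ?thesis using polar_entry_deviation(2)[OF max f0] unfolding \<Delta>_def f_def by simp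
  qed
  define \<xi> where "\<xi> = (\<lambda>p. \<kappa> p - of_real h * a p)"
  have "nsq ?n \<xi> = nsq ?n \<kappa> - h\<^sup>2"
  proof -
    have ac: "cip ?n a \<kappa> = of_real h" using \<kappa>a cip_commute[of ?n a \<kappa>] by simp
    have "complex_of_real (nsq ?n \<xi>) = of_real (nsq ?n \<kappa>) - of_real h * of_real h"
      unfolding cip_self[symmetric]
      by (simp add: \<xi>_def cip_linear \<kappa>a ac cip_self a1)
    thus ?thesis by (simp add: power2_eq_square flip: of_real_mult of_real_diff)
  qed
  also have "\<dots> \<le> h - h\<^sup>2" using \<kappa>\<kappa> by simp
  also have "\<dots> \<le> (1 / 2)\<^sup>2"
    using zero_le_power2[of "h - 1 / 2"] by (simp add: power2_eq_square algebra_simps)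
  finally have \<xi>n: "nsq ?n \<xi> \<le> (1 / 2)\<^sup>2" .
  have G: "G p = f * a p + \<delta> p" for p by (simp add: G_def \<delta>_def \<Delta>_def a_def)
  have "of_real \<mu> * f = cip ?n \<kappa> G" using eig unfolding \<kappa> by (simp add: G_def f_def)
  also have "\<dots> = f * of_real h + cip ?n \<kappa> \<delta>"
    unfolding G cip_add_right cip_scale_right \<kappa>a ..
  \<comment> \<open>\<delta> is orthogonal to \<open>a\<close>, so only the component of W uv
    orthogonal to uv meets it; this is where the constant 1/2 is gained over the trivial norm bound
    1.\<close>
  also have "cip ?n \<kappa> \<delta> = cip ?n \<xi> \<delta>" by (simp add: \<xi>_def cip_diff_left cip_scale_left a\<delta>)
  finally have "of_real (\<mu> - h) * f = cip ?n \<xi> \<delta>" by (simp add: algebra_simps)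
  hence "(\<bar>\<mu> - h\<bar> * cmod f)\<^sup>2 = (cmod (cip ?n \<xi> \<delta>))\<^sup>2"
    by (metis norm_mult norm_of_real)
  also have "\<dots> \<le> nsq ?n \<xi> * nsq ?n \<delta>" by (rule cauchy_schwarz)
  also have "\<dots> \<le> (1 / 2)\<^sup>2 * ((cmod f / real (Suc m))\<^sup>2 * (real d - 1))"
    using \<xi>n \<delta>n by (intro mult_mono) auto
  also have "\<dots> = (sqrt (real d - 1) / (2 * real (Suc m)) * cmod f)\<^sup>2"
  proof -
    have "(1 / 2)\<^sup>2 * ((F / N)\<^sup>2 * x\<^sup>2) = (x / (2 * N) * F)\<^sup>2" for F N x :: real
      by (simp add: power_mult_distrib power_divide)
    from this[of "cmod f" "real (Suc m)" "sqrt (real d - 1)"] show ?thesis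
      using d by (simp only: real_sqrt_pow2[of "real d - 1"])
  qed
  finally have "(\<bar>\<mu> - h\<bar> * cmod f)\<^sup>2 \<le> (sqrt (real d - 1) / (2 * real (Suc m)) * cmod f)\<^sup>2" .
  moreover have "0 \<le> sqrt (real d - 1) / (2 * real (Suc m)) * cmod f"
    using d by (intro mult_nonneg_nonneg divide_nonneg_nonneg) simp_all
  ultimately have "\<bar>\<mu> - h\<bar> * cmod f \<le> sqrt (real d - 1) / (2 * real (Suc m)) * cmod f"
    by (rule power2_le_imp_le)
  hence "\<bar>\<mu> - h\<bar> \<le> sqrt (real d - 1) / (2 * real (Suc m))"
    by (rule mult_right_le_imp_le) (use f0 in \<open>simp add: f_def\<close>)
  thus ?thesis by (simp add: h_def)
qed

section \<open>Tensor powers and the projection onto their span\<close>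

text \<open>The leading base-d digit of the index belongs to the copy split off first. The recursion
  is then a binary tensor product, and the copy kept by the channel is the leading digit.\<close>

primrec tpow :: "nat \<Rightarrow> nat \<Rightarrow> (nat \<Rightarrow> complex) \<Rightarrow> nat \<Rightarrow> complex" where
  "tpow d 0 x = (\<lambda>i. 1)"
| "tpow d (Suc n) x = (\<lambda>i. x (i div d ^ n) * tpow d n x (i mod d ^ n))"

lemma cip_tpow: "cip (d ^ n) (tpow d n x) (tpow d n y) = cip d x y ^ n"
proof (induction n)
  case 0
  show ?case by (simp add: cip_def)
next
  case (Suc n)
  show ?case using cip_tensor[of d "d ^ n" x "tpow d n x" y "tpow d n y"] Suc by simp
qed

text \<open>\<open>x\<^sup>\<otimes>\<^sup>n \<otimes> y\<^sup>\<otimes>\<^sup>n\<close>\<close>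

definition bipow :: "nat \<Rightarrow> nat \<Rightarrow> (nat \<Rightarrow> complex) \<Rightarrow> (nat \<Rightarrow> complex) \<Rightarrow> nat \<Rightarrow> complex" where
  "bipow d n x y = (\<lambda>i. tpow d n x (i div d ^ n) * tpow d n y (i mod d ^ n))"

lemma cip_bipow: "cip (d ^ n * d ^ n) (bipow d n x y) (bipow d n x' y') = cip d x x' ^ n * cip d y y' ^ n"
  unfolding bipow_def cip_tensor cip_tpow ..

text \<open>The index in \<open>\<complex>\<^sup>d \<otimes> \<complex>\<^sup>e \<otimes> \<complex>\<^sup>d \<otimes> \<complex>\<^sup>e\<close> with \<open>p\<close> encoding the pair of the two \<open>d\<close>-dimensional coordinates.\<close>

definition enc :: "nat \<Rightarrow> nat \<Rightarrow> nat \<Rightarrow> nat \<Rightarrow> nat \<Rightarrow> nat" where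
  "enc d e p a b = ((p div d) * e + a) * (d * e) + ((p mod d) * e + b)"

lemma sum_enc:
  fixes F :: "nat \<Rightarrow> 'a::comm_monoid_add"
  shows "(\<Sum>i<(d * e) * (d * e). F i) = (\<Sum>p<d * d. \<Sum>a<e. \<Sum>b<e. F (enc d e p a b))"
proof -
  have "(\<Sum>i<(d * e) * (d * e). F i) = (\<Sum>j<d. \<Sum>a<e. \<Sum>l<d. \<Sum>b<e. F ((j * e + a) * (d * e) + (l * e + b)))"
    by (simp only: sum_lessThan_mult)
  also have "\<dots> = (\<Sum>j<d. \<Sum>l<d. \<Sum>a<e. \<Sum>b<e. F ((j * e + a) * (d * e) + (l * e + b)))"
    by (rule sum.cong[OF refl], rule sum.swap)
  also have "\<dots> = (\<Sum>p<d * d. \<Sum>a<e. \<Sum>b<e. F (enc d e p a b))"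
    unfolding sum_lessThan_mult[of _ d d] by (intro sum.cong refl) (simp add: enc_def)
  finally show ?thesis .
qed

lemma enc_less:
  assumes "p < d * d" "a < e" "b < e"
  shows "enc d e p a b < (d * e) * (d * e)"
proof -
  have "p div d < d" "p mod d < d"
    using assms(1) by (cases "d = 0"; simp add: less_mult_imp_div_less)+
  thus ?thesis unfolding enc_def using assms by (intro pair_index_less)
qed

lemma pair_index_div: "p < m \<Longrightarrow> (a * m + p) div m = a" "p < m \<Longrightarrow> (a * m + p) mod m = p" for p m :: nat
  by simp_all

text \<open>Separates the kept copy of each system, indexed by \<open>p\<close>, from the m
  discarded ones, whose indices a, b label the Kraus operators.\<close>

lemma bipow_enc:
  assumes "p < d * d" "a < d ^ m" "b < d ^ m"
  shows "bipow d (Suc m) x y (enc d (d ^ m) p a b) = x (p div d) * y (p mod d) * (tpow d m x a * tpow d m y b)"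
proof -
  have "p mod d < d" using assms(1) by (cases "d = 0") simp_all
  hence lt: "(p mod d) * d ^ m + b < d * d ^ m" using assms by (intro pair_index_less)
  have "enc d (d ^ m) p a b div (d * d ^ m) = (p div d) * d ^ m + a"
    "enc d (d ^ m) p a b mod (d * d ^ m) = (p mod d) * d ^ m + b"
    unfolding enc_def by (rule pair_index_div[OF lt])+
  thus ?thesis
    by (simp only: bipow_def power_Suc tpow.simps pair_index_div[OF assms(2)] pair_index_div[OF assms(3)])
      (simp only: mult_ac)
qed

text \<open>Agreement is asked only on the coordinates below the dimension, since vectors are total
  functions. The explicit combination later provides the data c, X, Y of a
  \<open>form\<close>.\<close>

definition bipow_span :: "nat \<Rightarrow> nat \<Rightarrow> (nat \<Rightarrow> complex) set" where
  "bipow_span d n = {x. \<exists>(K :: nat) c X Y. \<forall>i<d ^ n * d ^ n. x i = (\<Sum>k<K. c k * bipow d n (X k) (Y k) i)}"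

lemma bipow_span_base: "bipow d n x y \<in> bipow_span d n"
  unfolding bipow_span_def
  by (intro CollectI exI[of _ "Suc 0"] exI[of _ "\<lambda>_. 1"] exI[of _ "\<lambda>_. x"] exI[of _ "\<lambda>_. y"]) simp

lemma bipow_span_scale:
  assumes "x \<in> bipow_span d n"
  shows "(\<lambda>i. a * x i) \<in> bipow_span d n"
proof -
  obtain K :: nat and c X Y where x: "\<forall>i<d ^ n * d ^ n. x i = (\<Sum>k<K. c k * bipow d n (X k) (Y k) i)"
    using assms unfolding bipow_span_def by blast
  show ?thesis unfolding bipow_span_def
    by (intro CollectI exI[of _ K] exI[of _ "\<lambda>k. a * c k"] exI[of _ X] exI[of _ Y])
      (use x in \<open>simp add: sum_distrib_left mult_ac\<close>)
qed

lemma bipow_span_add: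
  assumes "x \<in> bipow_span d n" "y \<in> bipow_span d n"
  shows "(\<lambda>i. x i + y i) \<in> bipow_span d n"
proof -
  obtain K :: nat and c X Y where x: "\<forall>i<d ^ n * d ^ n. x i = (\<Sum>k<K. c k * bipow d n (X k) (Y k) i)"
    using assms(1) unfolding bipow_span_def by blast
  obtain K' :: nat and c' X' Y' where y: "\<forall>i<d ^ n * d ^ n. y i = (\<Sum>k<K'. c' k * bipow d n (X' k) (Y' k) i)"
    using assms(2) unfolding bipow_span_def by blast
  let ?j = "\<lambda>f g k. if k < K then f k else g (k - K)"
  show ?thesis unfolding bipow_span_def
    by (intro CollectI exI[of _ "K + K'"] exI[of _ "?j c c'"] exI[of _ "?j X X'"] exI[of _ "?j Y Y'"])
      (use x y in \<open>simp add: sum_lessThan_add\<close>)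
qed

lemma bipow_span_sum:
  assumes "\<And>k :: nat. k < m \<Longrightarrow> x k \<in> bipow_span d n"
  shows "(\<lambda>i. \<Sum>k<m. a k * x k i) \<in> bipow_span d n"
  using assms
proof (induction m)
  case 0
  show ?case using bipow_span_scale[OF bipow_span_base, of 0] by simp
next
  case (Suc m)
  have "(\<lambda>i. (\<Sum>k<m. a k * x k i) + a m * x m i) \<in> bipow_span d n"
    using Suc by (intro bipow_span_add bipow_span_scale) auto
  thus ?case by simp
qed

text \<open>Orthonormal families inside the span have length at most \<open>D\<close>, so a longest
  one exists. If some product power had a nonzero residual, the normalized residual, again in the
  span, would lengthen it.\<close>

lemma bipow_span_projection:
  assumes D: "D = d ^ n * d ^ n"
  obtains M e where "orthonormal D M e" "\<And>k. k < M \<Longrightarrow> e k \<in> bipow_span d n"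
    "\<And>x y i. i < D \<Longrightarrow> (\<Sum>k<M. cip D (e k) (bipow d n x y) * e k i) = bipow d n x y i"
proof -
  define good where "good = (\<lambda>M. \<exists>e. orthonormal D M e \<and> (\<forall>k<M. e k \<in> bipow_span d n))"
  define M where "M = (GREATEST M. good M)"
  have g0: "good 0" by (simp add: good_def orthonormal_def)
  have le: "M' \<le> D" if "good M'" for M' using that orthonormal_le_dim unfolding good_def by blast
  have "good M" unfolding M_def using GreatestI_nat[of good 0 D, OF g0 le] by simp
  then obtain e where e: "orthonormal D M e" "\<And>k. k < M \<Longrightarrow> e k \<in> bipow_span d n"
    unfolding good_def by blast
  show thesis
  proof (rule that[OF e])
    fix x y i assume i: "i < D"
    let ?s = "bipow d n x y"
    define r where "r = (\<lambda>j. ?s j - (\<Sum>k<M. cip D (e k) ?s * e k j))"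
    have "nsq D r = 0"
    proof (rule ccontr)
      assume nz: "nsq D r \<noteq> 0"
      define r' where "r' = (\<lambda>j. of_real (1 / sqrt (nsq D r)) * r j)"
      have "(\<lambda>j. ?s j + (-1) * (\<Sum>k<M. cip D (e k) ?s * e k j)) \<in> bipow_span d n"
        by (intro bipow_span_add bipow_span_scale bipow_span_sum bipow_span_base e(2))
      hence "r \<in> bipow_span d n" by (simp add: r_def)
      hence r': "r' \<in> bipow_span d n" unfolding r'_def by (rule bipow_span_scale)
      have "orthonormal D (Suc M) (e(M := r'))"
      proof (rule orthonormal_extend[OF e(1)])
        fix k assume "k < M"
        thus "cip D (e k) r' = 0"
          unfolding r'_def cip_scale_right r_def using orthonormal_residual[OF e(1)] by simp
      next
        show "nsq D r' = 1" unfolding r'_def by (rule unit_normalize[OF nz])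
      qed
      hence "good (Suc M)" unfolding good_def using r' e(2) by (auto simp: less_Suc_eq intro!: exI[of _ "e(M := r')"])
      hence "Suc M \<le> M" unfolding M_def using Greatest_le_nat[of good "Suc M" D] le by (simp add: M_def)
      thus False by simp
    qed
    from nsq_eq_0[OF this i] show "(\<Sum>k<M. cip D (e k) ?s * e k i) = ?s i" by (simp add: r_def)
  qed
qed

definition proj :: "nat \<Rightarrow> nat \<Rightarrow> (nat \<Rightarrow> nat \<Rightarrow> complex) \<Rightarrow> nat \<Rightarrow> nat \<Rightarrow> complex" where
  "proj D M e i j = (\<Sum>k<M. e k i * cnj (e k j))"

lemma mapply_proj: "mapply D (proj D M e) x i = (\<Sum>k<M. cip D (e k) x * e k i)"
  by (simp add: mapply_def proj_def cip_def sum_distrib_right sum_distrib_left mult_ac) (rule sum.swap)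

lemma cnj_proj: "cnj (proj D M e i j) = proj D M e j i"
  by (simp add: proj_def mult_ac)

lemma proj_idem:
  assumes "orthonormal D M e"
  shows "(\<Sum>s<D. proj D M e i s * proj D M e s j) = proj D M e i j"
proof -
  have "(\<Sum>s<D. proj D M e i s * proj D M e s j) = mapply D (proj D M e) (\<lambda>s. proj D M e s j) i"
    by (simp add: mapply_def)
  also have "\<dots> = (\<Sum>k<M. cip D (e k) (\<lambda>s. \<Sum>l<M. cnj (e l j) * e l s) * e k i)"
    unfolding mapply_proj by (simp add: proj_def mult.commute)
  also have "\<dots> = proj D M e i j"
    unfolding proj_def
  proof (rule sum.cong[OF refl])
    fix k assume "k \<in> {..<M}"
    hence "cip D (e k) (\<lambda>s. \<Sum>l<M. cnj (e l j) * e l s) = cnj (e k j)"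
      using orthonormal_cip_sum[OF assms] by simp
    thus "cip D (e k) (\<lambda>s. \<Sum>l<M. cnj (e l j) * e l s) * e k i = e k i * cnj (e k j)"
      by (simp only: mult.commute)
  qed
  finally show ?thesis .
qed

text \<open>The channel: measure the projection onto the span of the \<open>u\<^sup>\<otimes>\<^sup>n \<otimes> v\<^sup>\<otimes>\<^sup>n\<close>; if it succeeds, keep one copy of
  each of the two systems (operators \<open>Inl\<close>), otherwise prepare \<open>e\<^sub>0 \<otimes> e\<^sub>0\<close> (operators \<open>Inr\<close>).\<close>

definition chan_ops :: "nat \<Rightarrow> nat \<Rightarrow> (nat \<Rightarrow> nat \<Rightarrow> complex) \<Rightarrow> (nat \<times> nat) + nat \<Rightarrow> nat \<Rightarrow> nat \<Rightarrow> complex" where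
  "chan_ops d m P r p i = (case r of
      Inl ab \<Rightarrow> P (enc d (d ^ m) p (fst ab) (snd ab)) i
    | Inr j \<Rightarrow> if p = 0 then (if j = i then 1 else 0) - P j i else 0)"

definition chan_index :: "nat \<Rightarrow> nat \<Rightarrow> ((nat \<times> nat) + nat) set" where
  "chan_index d m = ({..<d ^ m} \<times> {..<d ^ m}) <+> {..<d ^ Suc m * d ^ Suc m}"

lemma finite_chan_index: "finite (chan_index d m)"
  by (simp add: chan_index_def)

lemma sum_chan_index:
  fixes F :: "_ \<Rightarrow> 'a::comm_monoid_add"
  shows "(\<Sum>r\<in>chan_index d m. F r) =
    (\<Sum>a<d ^ m. \<Sum>b<d ^ m. F (Inl (a, b))) + (\<Sum>j<d ^ Suc m * d ^ Suc m. F (Inr j))"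
  unfolding chan_index_def by (simp add: sum.Plus sum.cartesian_product o_def)

text \<open>As (a, b) and p vary, \<open>enc\<close> meets every row of the projection P once, so
  the success operators contribute P* P = P and the failure operators (1 - P)* (1 - P) = 1 - P. The
  entries come out at (j, i).\<close>

lemma chan_ops_complete:
  assumes D: "D = d ^ Suc m * d ^ Suc m" and e: "orthonormal D M e" and d: "0 < d" and ij: "i < D" "j < D"
  defines "P \<equiv> proj D M e"
  shows "(\<Sum>r\<in>chan_index d m. \<Sum>p<d * d. chan_ops d m P r p i * cnj (chan_ops d m P r p j)) = (if i = j then 1 else 0)"
proof -
  let ?d = "\<lambda>s i. if s = i then 1 else (0::complex)"
  have "(\<Sum>a<d ^ m. \<Sum>b<d ^ m. \<Sum>p<d * d. chan_ops d m P (Inl (a, b)) p i * cnj (chan_ops d m P (Inl (a, b)) p j))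
      = (\<Sum>p<d * d. \<Sum>a<d ^ m. \<Sum>b<d ^ m. P (enc d (d ^ m) p a b) i * P j (enc d (d ^ m) p a b))"
    unfolding chan_ops_def P_def by (subst sum_rotate3) (simp add: cnj_proj)
  also have "\<dots> = (\<Sum>s<D. P s i * P j s)"
    unfolding D power_Suc by (rule sum_enc[symmetric])
  also have "\<dots> = P j i" using proj_idem[OF e, of j i] by (simp add: P_def mult.commute)
  finally have 1: "(\<Sum>a<d ^ m. \<Sum>b<d ^ m. \<Sum>p<d * d. chan_ops d m P (Inl (a, b)) p i * cnj (chan_ops d m P (Inl (a, b)) p j)) = P j i" .
  have "(\<Sum>s<D. \<Sum>p<d * d. chan_ops d m P (Inr s) p i * cnj (chan_ops d m P (Inr s) p j))
      = (\<Sum>s<D. (?d s i - P s i) * cnj (?d s j - P s j))"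
  proof (rule sum.cong[OF refl])
    fix s
    have "(\<Sum>p<d * d. chan_ops d m P (Inr s) p i * cnj (chan_ops d m P (Inr s) p j))
        = (\<Sum>p<d * d. if p = 0 then (?d s i - P s i) * cnj (?d s j - P s j) else 0)"
      by (intro sum.cong refl) (simp add: chan_ops_def)
    thus "(\<Sum>p<d * d. chan_ops d m P (Inr s) p i * cnj (chan_ops d m P (Inr s) p j))
        = (?d s i - P s i) * cnj (?d s j - P s j)" using d by (simp add: sum.delta')
  qed
  also have "\<dots> = (\<Sum>s<D. ?d s i * ?d s j - P j s * ?d s i - P s i * ?d s j + P s i * P j s)"
    by (intro sum.cong refl) (simp add: P_def cnj_proj algebra_simps)
  also have "\<dots> = ?d i j - P j i - P j i + P j i"
    unfolding sum.distrib sum_subtractf mult_indicator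
    using ij proj_idem[OF e, of j i] by (simp add: P_def mult.commute)
  finally show ?thesis unfolding sum_chan_index using 1 by (simp add: D)
qed

section \<open>Separable states\<close>

lemma form_scale:
  "form d n K c X Y (\<lambda>i. a * x i) (\<lambda>i. b * y i) = cnj a ^ n * cnj b ^ n * form d n K c X Y x y"
  by (simp add: form_def cip_scale_left power_mult_distrib sum_distrib_left mult_ac)

lemma form_cong:
  "(\<And>i. i < d \<Longrightarrow> x i = x' i) \<Longrightarrow> (\<And>i. i < d \<Longrightarrow> y i = y' i) \<Longrightarrow> form d n K c X Y x y = form d n K c X Y x' y'"
  unfolding form_def by (intro sum.cong refl) (simp cong: cip_cong)

lemma form_zero: "nsq d x = 0 \<Longrightarrow> form d (Suc n) K c X Y x y = 0"
proof -
  assume "nsq d x = 0"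
  hence "cip d x z = 0" for z using nsq_eq_0[of d x] by (simp add: cip_def)
  thus ?thesis by (simp add: form_def)
qed

lemma usphere_multiple:
  assumes "nsq d z \<noteq> 0"
  obtains z' where "z' \<in> usphere d" "\<And>i. i < d \<Longrightarrow> z i = of_real (sqrt (nsq d z)) * z' i"
proof -
  obtain z' where z': "nsq d z' = 1" "z = (\<lambda>i. of_real (sqrt (nsq d z)) * z' i)"
    using unit_multiple[of d z] assms by blast
  let ?z = "\<lambda>i. if i < d then z' i else 0"
  have "nsq d ?z = 1" using z'(1) by (simp cong: nsq_cong)
  moreover have "z i = of_real (sqrt (nsq d z)) * ?z i" if "i < d" for i
    using fun_cong[OF z'(2), of i] that by simp
  ultimately show thesis using that[of ?z] by (simp add: usphere_def)
qed

text \<open>Compactness of the product of two unit spheres gives a maximum there, and homogeneity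
  extends it to all vectors. Vectors of norm 0 are treated apart: the form vanishes on them because
  its degree \<open>Suc m\<close> is positive.\<close>

lemma max_at_exists:
  assumes d: "0 < d" and nz: "form d (Suc m) K c X Y x0 y0 \<noteq> 0"
  shows "\<exists>u v. max_at d (Suc m) K c X Y u v \<and> form d (Suc m) K c X Y u v \<noteq> 0"
proof -
  let ?S = "usphere d \<times> usphere d"
  let ?f = "\<lambda>p. cmod (form d (Suc m) K c X Y (fst p) (snd p))"
  have c1: "continuous_on ?S (\<lambda>p. fst p i)" "continuous_on ?S (\<lambda>p. snd p i)" for i
    by (rule continuous_on_product_then_coordinatewise, intro continuous_intros)+
  have cont: "continuous_on ?S ?f"
    unfolding form_def cip_def by (intro continuous_intros c1)
  have "(\<lambda>i. if i = 0 then 1 else 0) \<in> usphere d"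
    using d by (simp add: usphere_def nsq_def if_distrib[of cmod] if_distrib[of "\<lambda>x. x\<^sup>2"] cong: if_cong)
  hence "?S \<noteq> {}" by blast
  then obtain q where q: "q \<in> ?S" "\<And>p. p \<in> ?S \<Longrightarrow> ?f p \<le> ?f q"
    using continuous_attains_sup[OF compact_Times[OF compact_usphere compact_usphere] _ cont] by blast
  obtain u v where uv: "q = (u, v)" "nsq d u = 1" "nsq d v = 1"
    using q(1) by (cases q) (auto simp: usphere_def)
  let ?M = "cmod (form d (Suc m) K c X Y u v)"
  have bound: "cmod (form d (Suc m) K c X Y x y) \<le> ?M * sqrt (nsq d x) ^ Suc m * sqrt (nsq d y) ^ Suc m" for x y
  proof (cases "nsq d x = 0 \<or> nsq d y = 0")
    case True
    hence "form d (Suc m) K c X Y x y = 0"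
      using form_zero[of d x m K c X Y y] form_zero[of d y m K c Y X x] form_swap[of d "Suc m" K c X Y x y] by auto
    thus ?thesis by (simp only: norm_zero) (intro mult_nonneg_nonneg zero_le_power, simp_all)
  next
    case False
    obtain x' where x': "x' \<in> usphere d" "\<And>i. i < d \<Longrightarrow> x i = of_real (sqrt (nsq d x)) * x' i"
      using usphere_multiple[of d x] False by blast
    obtain y' where y': "y' \<in> usphere d" "\<And>i. i < d \<Longrightarrow> y i = of_real (sqrt (nsq d y)) * y' i"
      using usphere_multiple[of d y] False by blast
    have "form d (Suc m) K c X Y x y
        = form d (Suc m) K c X Y (\<lambda>i. of_real (sqrt (nsq d x)) * x' i) (\<lambda>i. of_real (sqrt (nsq d y)) * y' i)"
      by (rule form_cong) (use x'(2) y'(2) in auto)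
    hence "cmod (form d (Suc m) K c X Y x y)
        = sqrt (nsq d x) ^ Suc m * sqrt (nsq d y) ^ Suc m * cmod (form d (Suc m) K c X Y x' y')"
      unfolding form_scale by (simp add: norm_mult norm_power del: power_Suc)
    also have "\<dots> \<le> sqrt (nsq d x) ^ Suc m * sqrt (nsq d y) ^ Suc m * ?M"
    proof (rule mult_left_mono)
      show "cmod (form d (Suc m) K c X Y x' y') \<le> ?M" using q(2)[of "(x', y')"] x'(1) y'(1) uv(1) by simp
    qed (intro mult_nonneg_nonneg zero_le_power, simp_all)
    finally show ?thesis by (simp only: mult_ac)
  qed
  have "form d (Suc m) K c X Y u v \<noteq> 0"
    using bound[of x0 y0] nz by auto
  thus ?thesis using uv bound unfolding max_at_def by blast
qed

section \<open>Separable states as mixtures of product vectors\<close>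

definition pvec :: "nat \<Rightarrow> (nat \<Rightarrow> complex) \<Rightarrow> (nat \<Rightarrow> complex) \<Rightarrow> nat \<Rightarrow> complex" where
  "pvec d u v = (\<lambda>p. u (p div d) * v (p mod d))"

lemma nsq_pvec: "nsq (d * d) (pvec d u v) = nsq d u * nsq d v"
proof -
  have "complex_of_real (nsq (d * d) (pvec d u v)) = of_real (nsq d u * nsq d v)"
    unfolding cip_self[symmetric] pvec_def cip_tensor by (simp add: cip_self)
  thus ?thesis by (simp only: of_real_eq_iff)
qed

lemma unit_vectors_iff: "x \<in> unit_vectors d \<longleftrightarrow> x \<in> carrier_vec d \<and> nsq d (\<lambda>i. x $ i) = 1"
proof -
  have "x \<bullet>c x = of_real (nsq d (\<lambda>i. x $ i))" if "x \<in> carrier_vec d"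
    using that by (simp add: cip_self[symmetric] cip_def scalar_prod_def atLeast0LessThan mult.commute)
  thus ?thesis by (auto simp: unit_vectors_def)
qed

lemma kron_ketbra:
  assumes "x \<in> carrier_vec d" "y \<in> carrier_vec d" "p < d * d" "q < d * d"
  shows "kron (ketbra x) (ketbra y) $$ (p, q) =
    pvec d (\<lambda>i. x $ i) (\<lambda>i. y $ i) p * cnj (pvec d (\<lambda>i. x $ i) (\<lambda>i. y $ i) q)"
proof -
  have "p div d < d" "p mod d < d" "q div d < d" "q mod d < d"
    using assms(3,4) by (cases "d = 0"; simp add: less_mult_imp_div_less)+
  thus ?thesis using assms by (simp add: kron_def ketbra_def pvec_def mult_ac)
qed

text \<open>Translates Kronecker products of unit vectors into the function encoding; later proofs
  about separable states start from this form.\<close>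

lemma SEP_iff:
  "\<sigma> \<in> SEP d \<longleftrightarrow> (\<exists>(N :: nat) p U V. (\<forall>k<N. 0 \<le> p k \<and> nsq d (U k) = 1 \<and> nsq d (V k) = 1) \<and> (\<Sum>k<N. p k) = 1 \<and>
    \<sigma> = mat (d * d) (d * d) (\<lambda>(i, j). \<Sum>k<N. complex_of_real (p k) * (pvec d (U k) (V k) i * cnj (pvec d (U k) (V k) j))))"
  (is "_ \<longleftrightarrow> ?R")
proof
  assume "\<sigma> \<in> SEP d"
  then obtain N :: nat and p X where p: "\<And>k. k < N \<Longrightarrow> 0 \<le> p k" "(\<Sum>k<N. p k) = 1"
    and X: "\<And>k. k < N \<Longrightarrow> \<exists>x y. X k = kron (ketbra x) (ketbra y) \<and> x \<in> unit_vectors d \<and> y \<in> unit_vectors d"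
    and \<sigma>: "\<sigma> = mat (d * d) (d * d) (\<lambda>(i, j). \<Sum>k<N. complex_of_real (p k) * X k $$ (i, j))"
    unfolding SEP_def conv_mat_def by blast
  obtain x y where xy: "\<And>k. k < N \<Longrightarrow> X k = kron (ketbra (x k)) (ketbra (y k)) \<and> x k \<in> unit_vectors d \<and> y k \<in> unit_vectors d"
    using X by metis
  have "\<sigma> = mat (d * d) (d * d) (\<lambda>(i, j). \<Sum>k<N. complex_of_real (p k) *
      (pvec d (\<lambda>i. x k $ i) (\<lambda>i. y k $ i) i * cnj (pvec d (\<lambda>i. x k $ i) (\<lambda>i. y k $ i) j)))"
    unfolding \<sigma> using xy by (intro cong_mat refl) (simp add: kron_ketbra[where d = d] unit_vectors_iff)
  moreover have "\<forall>k<N. 0 \<le> p k \<and> nsq d (\<lambda>i. x k $ i) = 1 \<and> nsq d (\<lambda>i. y k $ i) = 1"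
    using xy p(1) by (auto simp: unit_vectors_iff)
  ultimately show ?R using p(2)
    by (intro exI[of _ N] exI[of _ p] exI[of _ "\<lambda>k i. x k $ i"] exI[of _ "\<lambda>k i. y k $ i"] conjI)
next
  assume ?R
  then obtain N :: nat and p U V where p: "\<forall>k<N. 0 \<le> p k \<and> nsq d (U k) = 1 \<and> nsq d (V k) = 1" "(\<Sum>k<N. p k) = 1"
    and \<sigma>: "\<sigma> = mat (d * d) (d * d) (\<lambda>(i, j). \<Sum>k<N. complex_of_real (p k) * (pvec d (U k) (V k) i * cnj (pvec d (U k) (V k) j)))"
    by blast
  let ?X = "\<lambda>k. kron (ketbra (vec d (U k))) (ketbra (vec d (V k)))"
  have unit: "vec d x \<in> unit_vectors d" if "nsq d x = 1" for x
    using that by (simp add: unit_vectors_iff cong: nsq_cong)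
  have "pvec d (\<lambda>i. vec d x $ i) (\<lambda>i. vec d y $ i) i = pvec d x y i" if "i < d * d" for i x y
  proof -
    have "i div d < d" "i mod d < d"
      using that by (cases "d = 0"; simp add: less_mult_imp_div_less)+
    thus ?thesis by (simp add: pvec_def)
  qed
  hence "\<sigma> = mat (d * d) (d * d) (\<lambda>(i, j). \<Sum>k<N. complex_of_real (p k) * ?X k $$ (i, j))"
    unfolding \<sigma> by (intro cong_mat refl) (simp add: kron_ketbra[where d = d])
  moreover have "\<forall>k<N. 0 \<le> p k \<and> ?X k \<in> {kron (ketbra u) (ketbra v) | u v. u \<in> unit_vectors d \<and> v \<in> unit_vectors d}"
    using p(1) unit by blast
  ultimately show "\<sigma> \<in> SEP d" using p(2) unfolding SEP_def conv_mat_def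
    by (intro CollectI exI[of _ N] exI[of _ p] exI[of _ ?X] conjI)
qed

lemma qform_sum: "qform n (\<lambda>i j. \<Sum>k\<in>K. c k * A k i j) x = (\<Sum>k\<in>K. c k * qform n (A k) x)"
proof -
  have "qform n (\<lambda>i j. \<Sum>k\<in>K. c k * A k i j) x = (\<Sum>i<n. \<Sum>j<n. \<Sum>k\<in>K. c k * (cnj (x i) * A k i j * x j))"
    by (simp add: qform_def sum_distrib_left sum_distrib_right mult_ac)
  also have "\<dots> = (\<Sum>k\<in>K. c k * qform n (A k) x)"
    by (subst sum_rotate3) (simp add: qform_def sum_distrib_left)
  finally show ?thesis .
qed

text \<open>Serves twice: for separable states and for the input states that the channel maps to
  them.\<close>

lemma mixture_density:
  assumes p: "\<forall>k<N. 0 \<le> p k \<and> nsq n (x k) = 1" "(\<Sum>k<N. p k) = (1::real)"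
  shows "mat n n (\<lambda>(i, j). \<Sum>k<N. complex_of_real (p k) * (x k i * cnj (x k j))) \<in> density_ops n"
    (is "?\<sigma> \<in> _")
proof -
  have car: "?\<sigma> \<in> carrier_mat n n" by simp
  have "0 \<le> qform n (entries ?\<sigma>) y" for y
  proof -
    have "qform n (entries ?\<sigma>) y = qform n (\<lambda>i j. \<Sum>k<N. complex_of_real (p k) * (x k i * cnj (x k j))) y"
      by (rule qform_cong) simp
    also have "\<dots> = (\<Sum>k<N. complex_of_real (p k) * of_real ((cmod (cip n (x k) y))\<^sup>2))"
      unfolding qform_sum qform_rank_one ..
    also have "0 \<le> \<dots>" using p(1) by (intro sum_nonneg) (simp add: less_eq_complex_def flip: of_real_mult of_real_power)
    finally show ?thesis .
  qed
  hence "psd n ?\<sigma>" using psd_iff_qform[OF car] by simp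
  moreover have "mtrace ?\<sigma> = 1"
  proof -
    have "mtrace ?\<sigma> = (\<Sum>k<N. complex_of_real (p k) * cip n (x k) (x k))"
      by (simp add: mtrace_def cip_def sum_distrib_left mult_ac) (rule sum.swap)
    also have "\<dots> = (\<Sum>k<N. complex_of_real (p k))" using p(1) by (simp add: cip_self)
    finally show ?thesis using p(2) by (simp flip: of_real_sum)
  qed
  ultimately show ?thesis by (simp add: density_ops_def)
qed

lemma SEP_density: "SEP d \<subseteq> density_ops (d * d)"
proof
  fix \<sigma> assume "\<sigma> \<in> SEP d"
  then obtain N :: nat and p U V where p: "\<forall>k<N. 0 \<le> p k \<and> nsq d (U k) = 1 \<and> nsq d (V k) = 1" "(\<Sum>k<N. p k) = 1"
    and \<sigma>: "\<sigma> = mat (d * d) (d * d) (\<lambda>(i, j). \<Sum>k<N. complex_of_real (p k) * (pvec d (U k) (V k) i * cnj (pvec d (U k) (V k) j)))"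
    unfolding SEP_iff by blast
  show "\<sigma> \<in> density_ops (d * d)"
    unfolding \<sigma> by (rule mixture_density) (use p in \<open>simp_all add: nsq_pvec\<close>)
qed

lemma SEP_convex:
  assumes \<sigma>: "\<sigma> \<in> SEP d" and \<tau>: "\<tau> \<in> SEP d" and t: "0 \<le> t" "t \<le> 1"
  shows "mat (d * d) (d * d) (\<lambda>(i, j). of_real (1 - t) * \<sigma> $$ (i, j) + of_real t * \<tau> $$ (i, j)) \<in> SEP d"
proof -
  obtain N :: nat and p U V where p: "\<forall>k<N. 0 \<le> p k \<and> nsq d (U k) = 1 \<and> nsq d (V k) = 1" "(\<Sum>k<N. p k) = 1"
    and \<sigma>': "\<sigma> = mat (d * d) (d * d) (\<lambda>(i, j). \<Sum>k<N. complex_of_real (p k) * (pvec d (U k) (V k) i * cnj (pvec d (U k) (V k) j)))"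
    using \<sigma> unfolding SEP_iff by blast
  obtain N' :: nat and p' U' V' where p': "\<forall>k<N'. 0 \<le> p' k \<and> nsq d (U' k) = 1 \<and> nsq d (V' k) = 1" "(\<Sum>k<N'. p' k) = 1"
    and \<tau>': "\<tau> = mat (d * d) (d * d) (\<lambda>(i, j). \<Sum>k<N'. complex_of_real (p' k) * (pvec d (U' k) (V' k) i * cnj (pvec d (U' k) (V' k) j)))"
    using \<tau> unfolding SEP_iff by blast
  \<comment> \<open>The two mixtures are concatenated, with weights scaled by 1 - t and t.\<close>
  define q where "q = (\<lambda>k. if k < N then (1 - t) * p k else t * p' (k - N))"
  define U2 where "U2 = (\<lambda>k. if k < N then U k else U' (k - N))"
  define V2 where "V2 = (\<lambda>k. if k < N then V k else V' (k - N))"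
  show ?thesis unfolding SEP_iff
  proof (rule exI[of _ "N + N'"], rule exI[of _ q], rule exI[of _ U2], rule exI[of _ V2], intro conjI)
    show "\<forall>k<N + N'. 0 \<le> q k \<and> nsq d (U2 k) = 1 \<and> nsq d (V2 k) = 1"
      using p(1) p'(1) t by (auto simp: q_def U2_def V2_def)
    have "(\<Sum>k<N + N'. q k) = (1 - t) * (\<Sum>k<N. p k) + t * (\<Sum>k<N'. p' k)"
      unfolding sum_lessThan_add by (simp add: q_def sum_distrib_left)
    thus "(\<Sum>k<N + N'. q k) = 1" using p(2) p'(2) by simp
    show "mat (d * d) (d * d) (\<lambda>(i, j). of_real (1 - t) * \<sigma> $$ (i, j) + of_real t * \<tau> $$ (i, j)) =
      mat (d * d) (d * d) (\<lambda>(i, j). \<Sum>k<N + N'. complex_of_real (q k) * (pvec d (U2 k) (V2 k) i * cnj (pvec d (U2 k) (V2 k) j)))"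
      unfolding sum_lessThan_add
      by (intro cong_mat refl) (simp add: \<sigma>' \<tau>' q_def U2_def V2_def sum_distrib_left mult_ac)
  qed
qed

lemma product_in_SEP:
  assumes "nsq d u = 1" "nsq d v = 1"
  shows "mat (d * d) (d * d) (\<lambda>(i, j). pvec d u v i * cnj (pvec d u v j)) \<in> SEP d"
  unfolding SEP_iff
  by (intro exI[of _ "Suc 0"] exI[of _ "\<lambda>_. 1"] exI[of _ "\<lambda>_. u"] exI[of _ "\<lambda>_. v"] conjI)
    (use assms in simp_all)

section \<open>The channel\<close>

text \<open>\<open>E\<close> is an orthonormal basis of S, where the number of copies is
  \<open>Suc m\<close>: one is kept and m are discarded. \<open>E_fix\<close> says that the
  projection fixes every product power.\<close>

locale copies_channel =
  fixes d m D M :: nat and E :: "nat \<Rightarrow> nat \<Rightarrow> complex"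
  assumes d: "0 < d"
    and D: "D = d ^ Suc m * d ^ Suc m"
    and orth: "orthonormal D M E"
    and E_span: "\<And>k. k < M \<Longrightarrow> E k \<in> bipow_span d (Suc m)"
    and E_fix: "\<And>x y i. i < D \<Longrightarrow>
      (\<Sum>k<M. cip D (E k) (bipow d (Suc m) x y) * E k i) = bipow d (Suc m) x y i"
begin

abbreviation P :: "nat \<Rightarrow> nat \<Rightarrow> complex" where "P \<equiv> proj D M E"

definition ops :: "(nat \<times> nat) + nat \<Rightarrow> nat \<Rightarrow> nat \<Rightarrow> complex" where
  "ops = chan_ops d m P"

definition app :: "(nat \<times> nat) + nat \<Rightarrow> (nat \<Rightarrow> complex) \<Rightarrow> nat \<Rightarrow> complex" where
  "app r x = (\<lambda>p. \<Sum>j<D. ops r p j * x j)"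

definition chan :: "complex mat \<Rightarrow> complex mat" where
  "chan = kraus_map D (d * d) (chan_index d m) ops"

lemma chan_channel: "quantum_channel D (d * d) chan"
  unfolding chan_def ops_def
  by (rule kraus_map_channel[OF finite_chan_index chan_ops_complete[OF D orth d]])

lemma app_Inl: "app (Inl (a, b)) x p = mapply D P x (enc d (d ^ m) p a b)"
  by (simp add: app_def ops_def chan_ops_def mapply_def)

lemma app_Inr: "j < D \<Longrightarrow> app (Inr j) x p = (if p = 0 then x j - mapply D P x j else 0)"
proof -
  assume j: "j < D"
  have "(\<Sum>i<D. (if j = i then 1 else 0) * x i) = x j"
  proof -
    have "(\<Sum>i<D. (if j = i then 1 else 0) * x i) = (\<Sum>i<D. x i * (if j = i then 1 else 0))"
      by (simp only: mult.commute)
    also have "\<dots> = x j" using j by (simp add: mult_indicator)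
    finally show ?thesis .
  qed
  thus ?thesis
    by (simp add: app_def ops_def chan_ops_def mapply_def left_diff_distrib sum_subtractf)
qed

lemma P_fix: "i < D \<Longrightarrow> mapply D P (bipow d (Suc m) x y) i = bipow d (Suc m) x y i"
  by (simp add: mapply_proj E_fix)

lemma P_hermitian: "hermitian D P"
  by (simp add: hermitian_def cnj_proj)

lemma enc_D: "p < d * d \<Longrightarrow> a < d ^ m \<Longrightarrow> b < d ^ m \<Longrightarrow> enc d (d ^ m) p a b < D"
  using enc_less[of p d a "d ^ m" b] by (simp add: D)

lemma sum_index:
  fixes F :: "_ \<Rightarrow> 'a::comm_monoid_add"
  shows "(\<Sum>r\<in>chan_index d m. F r) = (\<Sum>a<d ^ m. \<Sum>b<d ^ m. F (Inl (a, b))) + (\<Sum>j<D. F (Inr j))"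
  unfolding D by (rule sum_chan_index)

lemma app_bipow:
  "p < d * d \<Longrightarrow> a < d ^ m \<Longrightarrow> b < d ^ m \<Longrightarrow>
    app (Inl (a, b)) (bipow d (Suc m) u v) p = (tpow d m u a * tpow d m v b) * pvec d u v p"
  by (simp add: app_Inl P_fix enc_D bipow_enc pvec_def)

lemma app_bipow_Inr: "j < D \<Longrightarrow> app (Inr j) (bipow d (Suc m) u v) p = 0"
  by (simp add: app_Inr P_fix)

lemma chan_mixture_entry:
  fixes p' :: "nat \<Rightarrow> real"
  assumes pq: "p < d * d" "q < d * d"
  shows "chan (mat D D (\<lambda>(i, j). \<Sum>k<N. complex_of_real (p' k) * (x k i * cnj (x k j)))) $$ (p, q)
    = (\<Sum>k<N. complex_of_real (p' k) * (\<Sum>r\<in>chan_index d m. app r (x k) p * cnj (app r (x k) q)))"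
proof -
  have "chan (mat D D (\<lambda>(i, j). \<Sum>k<N. complex_of_real (p' k) * (x k i * cnj (x k j)))) $$ (p, q)
      = (\<Sum>r\<in>chan_index d m. \<Sum>i<D. \<Sum>j<D. \<Sum>k<N.
          complex_of_real (p' k) * ((ops r p i * x k i) * cnj (ops r q j * x k j)))"
    using pq by (simp add: chan_def kraus_map_def sum_distrib_left sum_distrib_right mult_ac)
  also have "\<dots> = (\<Sum>r\<in>chan_index d m. \<Sum>k<N. complex_of_real (p' k) * (app r (x k) p * cnj (app r (x k) q)))"
    by (rule sum.cong[OF refl], subst sum_rotate3)
      (simp only: app_def cnj_sum sum_product, simp only: sum_distrib_left)
  also have "\<dots> = (\<Sum>k<N. complex_of_real (p' k) * (\<Sum>r\<in>chan_index d m. app r (x k) p * cnj (app r (x k) q)))"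
    by (subst sum.swap) (simp add: sum_distrib_left)
  finally show ?thesis .
qed

text \<open>The projection leaves a product power unchanged, and the discarded copies contribute
  only their unit norms. Product powers are thus sent exactly to product states, which is why the
  coverage error is 0.\<close>

lemma chan_bipow:
  assumes pq: "p < d * d" "q < d * d" and unit: "nsq d u = 1" "nsq d v = 1"
  shows "(\<Sum>r\<in>chan_index d m. app r (bipow d (Suc m) u v) p * cnj (app r (bipow d (Suc m) u v) q))
    = pvec d u v p * cnj (pvec d u v q)"
proof -
  have n1: "cip (d ^ m) (tpow d m x) (tpow d m x) = 1" if "nsq d x = 1" for x
    by (subst cip_tpow) (simp add: cip_self that)
  have "(\<Sum>r\<in>chan_index d m. app r (bipow d (Suc m) u v) p * cnj (app r (bipow d (Suc m) u v) q))
      = (\<Sum>a<d ^ m. \<Sum>b<d ^ m. (cnj (tpow d m u a) * tpow d m u a) * ((cnj (tpow d m v b) * tpow d m v b) * (pvec d u v p * cnj (pvec d u v q))))"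
    unfolding sum_index using pq by (simp add: app_bipow app_bipow_Inr mult_ac)
  also have "\<dots> = cip (d ^ m) (tpow d m u) (tpow d m u) * (cip (d ^ m) (tpow d m v) (tpow d m v) * (pvec d u v p * cnj (pvec d u v q)))"
    unfolding cip_def by (simp add: sum_distrib_left sum_distrib_right mult_ac) (rule sum.swap)
  finally show ?thesis using n1 unit by simp
qed

lemma coverage:
  assumes "\<sigma> \<in> SEP d"
  shows "\<exists>\<rho>\<in>density_ops D. chan \<rho> = \<sigma>"
proof -
  obtain N :: nat and p U V where p: "\<forall>k<N. 0 \<le> p k \<and> nsq d (U k) = 1 \<and> nsq d (V k) = 1" "(\<Sum>k<N. p k) = 1"
    and \<sigma>: "\<sigma> = mat (d * d) (d * d) (\<lambda>(i, j). \<Sum>k<N. complex_of_real (p k) * (pvec d (U k) (V k) i * cnj (pvec d (U k) (V k) j)))"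
    using assms unfolding SEP_iff by blast
  define x where "x = (\<lambda>k. bipow d (Suc m) (U k) (V k))"
  let ?\<rho> = "mat D D (\<lambda>(i, j). \<Sum>k<N. complex_of_real (p k) * (x k i * cnj (x k j)))"
  have "nsq D (x k) = 1" if "k < N" for k
  proof -
    have "complex_of_real (nsq D (x k)) = 1"
      unfolding cip_self[symmetric] x_def D cip_bipow using p(1) that by (simp add: cip_self)
    thus ?thesis by simp
  qed
  hence "?\<rho> \<in> density_ops D" using p by (intro mixture_density) auto
  moreover have "chan ?\<rho> = \<sigma>"
  proof (rule eq_matI)
    fix i j assume "i < dim_row \<sigma>" "j < dim_col \<sigma>"
    hence ij: "i < d * d" "j < d * d" by (auto simp: \<sigma>)
    show "chan ?\<rho> $$ (i, j) = \<sigma> $$ (i, j)"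
      unfolding chan_mixture_entry[OF ij] \<sigma> using ij p(1) by (simp add: x_def chan_bipow)
  qed (simp_all add: chan_def kraus_map_def \<sigma>)
  ultimately show ?thesis by blast
qed

text \<open>Plain positivity is complete positivity with an ancilla of dimension 1.\<close>

lemma chan_density:
  assumes "\<rho> \<in> density_ops D"
  shows "chan \<rho> \<in> density_ops (d * d)"
proof -
  have \<rho>: "psd D \<rho>" "\<rho> \<in> carrier_mat D D" "mtrace \<rho> = 1"
    using assms by (auto simp: density_ops_def psd_def)
  have "psd (1 * (d * d)) (ampliation 1 D (d * d) chan \<rho>)"
    using kraus_map_completely_positive[of D "d * d" "chan_index d m" ops] \<rho>(1)
    unfolding completely_positive_def chan_def by (metis mult_1)
  moreover have "ampliation 1 D (d * d) chan \<rho> = chan \<rho>"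
  proof -
    have "mat_block D \<rho> 0 0 = \<rho>" using \<rho>(2) by (intro eq_matI) (auto simp: mat_block_def)
    thus ?thesis by (intro eq_matI) (auto simp: ampliation_def chan_def kraus_map_def)
  qed
  moreover have "mtrace (chan \<rho>) = 1"
    using kraus_map_trace[OF finite_chan_index chan_ops_complete[OF D orth d]] \<rho>(2,3)
    unfolding trace_preserving_def chan_def ops_def by simp
  ultimately show ?thesis by (simp add: density_ops_def)
qed

section \<open>Pulling an observable back to the input of the channel\<close>

context
  fixes e :: "nat \<Rightarrow> nat \<Rightarrow> complex" and w :: "nat \<Rightarrow> real"
  assumes e: "orthonormal (d * d) (d * d) e" and w: "\<And>k. k < d * d \<Longrightarrow> 0 \<le> w k \<and> w k \<le> 1"
begin

text \<open>The row vector <e k| L_r. Written with these rows, the pulled-back observable is a real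
  combination of rank-one projectors up to scale, so it is visibly Hermitian.\<close>

definition eig_row :: "(nat \<times> nat) + nat \<Rightarrow> nat \<Rightarrow> nat \<Rightarrow> complex" where
  "eig_row r k j = cip (d * d) (e k) (\<lambda>p. ops r p j)"

text \<open>The image under the adjoint of the channel of the observable with eigenvectors \<open>e k\<close> and eigenvalues \<open>w k\<close>.\<close>

definition pull :: "nat \<Rightarrow> nat \<Rightarrow> complex" where
  "pull i j = (\<Sum>r\<in>chan_index d m. \<Sum>k<d * d. of_real (w k) * (cnj (eig_row r k i) * eig_row r k j))"

lemma pull_hermitian: "hermitian D pull"
  by (simp add: hermitian_def pull_def mult_ac)

lemma eig_row_app: "(\<Sum>j<D. eig_row r k j * x j) = cip (d * d) (e k) (app r x)"
proof -
  have "cip (d * d) (e k) (\<lambda>p. \<Sum>j<D. x j * ops r p j) = (\<Sum>j<D. x j * eig_row r k j)"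
    unfolding eig_row_def cip_sum_right cip_scale_right ..
  thus ?thesis by (simp add: app_def mult.commute)
qed

lemma pull_form:
  "cip D x (mapply D pull y) = (\<Sum>r\<in>chan_index d m. \<Sum>k<d * d.
    of_real (w k) * cnj (cip (d * d) (e k) (app r x)) * cip (d * d) (e k) (app r y))"
proof -
  have "cip D x (mapply D pull y) = (\<Sum>i<D. \<Sum>j<D. \<Sum>r\<in>chan_index d m. \<Sum>k<d * d.
      of_real (w k) * (cnj (eig_row r k i * x i) * (eig_row r k j * y j)))"
    by (simp add: cip_def mapply_def pull_def sum_distrib_left sum_distrib_right mult_ac)
  also have "\<dots> = (\<Sum>r\<in>chan_index d m. \<Sum>k<d * d. \<Sum>i<D. \<Sum>j<D.
      of_real (w k) * (cnj (eig_row r k i * x i) * (eig_row r k j * y j)))"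
    by (rule sum_swap_pairs)
  also have "\<dots> = (\<Sum>r\<in>chan_index d m. \<Sum>k<d * d.
      of_real (w k) * (cnj (\<Sum>i<D. eig_row r k i * x i) * (\<Sum>j<D. eig_row r k j * y j)))"
    by (simp only: cnj_sum sum_product) (simp only: sum_distrib_left)
  finally show ?thesis unfolding eig_row_app by (simp add: mult_ac)
qed

text \<open>The index order \<open>pull j i\<close> makes the right-hand side the trace of \<rho>
  times \<open>pull\<close>, ready for the spectral decomposition of \<open>pull\<close>.\<close>

lemma pull_trace:
  "(\<Sum>k<d * d. of_real (w k) * qform (d * d) (entries (chan \<rho>)) (e k)) = (\<Sum>i<D. \<Sum>j<D. \<rho> $$ (i, j) * pull j i)"
proof -
  let ?W = "\<lambda>p q. \<Sum>k<d * d. of_real (w k) * (cnj (e k p) * e k q)"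
  have "(\<Sum>k<d * d. of_real (w k) * qform (d * d) (entries (chan \<rho>)) (e k))
      = (\<Sum>k<d * d. \<Sum>p<d * d. \<Sum>q<d * d. of_real (w k) * (cnj (e k p) * e k q) * chan \<rho> $$ (p, q))"
    by (simp add: qform_def sum_distrib_left mult_ac)
  also have "\<dots> = (\<Sum>p<d * d. \<Sum>q<d * d. ?W p q * chan \<rho> $$ (p, q))"
    unfolding sum_distrib_right by (rule sum_rotate3[symmetric])
  also have "\<dots> = (\<Sum>i<D. \<Sum>j<D. \<rho> $$ (i, j) *
      (\<Sum>r\<in>chan_index d m. \<Sum>p<d * d. \<Sum>q<d * d. ?W p q * ops r p i * cnj (ops r q j)))"
    unfolding chan_def by (rule kraus_map_adjoint[OF finite_chan_index])
  also have "\<dots> = (\<Sum>i<D. \<Sum>j<D. \<rho> $$ (i, j) * pull j i)"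
  proof (intro sum.cong refl arg_cong2[of _ _ _ _ "(*)"])
    fix i j
    show "(\<Sum>r\<in>chan_index d m. \<Sum>p<d * d. \<Sum>q<d * d. ?W p q * ops r p i * cnj (ops r q j)) = pull j i"
      unfolding pull_def
    proof (rule sum.cong[OF refl])
      fix r
      have "(\<Sum>p<d * d. \<Sum>q<d * d. ?W p q * ops r p i * cnj (ops r q j))
          = (\<Sum>p<d * d. \<Sum>q<d * d. \<Sum>k<d * d. of_real (w k) * ((cnj (e k p) * ops r p i) * cnj (cnj (e k q) * ops r q j)))"
        by (simp add: sum_distrib_right sum_distrib_left mult_ac)
      also have "\<dots> = (\<Sum>k<d * d. of_real (w k) * (eig_row r k i * cnj (eig_row r k j)))"
        by (subst sum_rotate3) (simp only: eig_row_def cip_def cnj_sum sum_product, simp only: sum_distrib_left)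
      finally show "(\<Sum>p<d * d. \<Sum>q<d * d. ?W p q * ops r p i * cnj (ops r q j))
          = (\<Sum>k<d * d. of_real (w k) * (cnj (eig_row r k j) * eig_row r k i))" by (simp only: mult.commute)
    qed
  qed
  finally show ?thesis .
qed

text \<open>The eigenvector \<psi> need not lie in S, hence the passage to its projection
  \<open>\<Psi>\<close>. If \<open>\<Psi>\<close> vanishes, only the failure operators act on
  \<psi>, and \<mu> is exactly the expectation of the observable at e_0 \<otimes> e_0. Otherwise the
  eigenvalue equation is tested against the maximizing product power: the failure operators
  annihilate it, and the rest of the equation involves \<psi> only through
  \<open>\<Psi>\<close>.\<close>

lemma pull_eigenvalue_bound:
  assumes \<psi>: "nsq D \<psi> = 1" and eig: "\<And>i. i < D \<Longrightarrow> mapply D pull \<psi> i = of_real \<mu> * \<psi> i"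
  shows "\<exists>u v. nsq d u = 1 \<and> nsq d v = 1 \<and>
    \<mu> \<le> (\<Sum>k<d * d. w k * (cmod (cip (d * d) (e k) (pvec d u v)))\<^sup>2) + sqrt (real d - 1) / (2 * real (Suc m))"
proof -
  define \<Psi> where "\<Psi> = mapply D P \<psi>"
  have eq: "(\<Sum>r\<in>chan_index d m. \<Sum>k<d * d.
      of_real (w k) * cnj (cip (d * d) (e k) (app r x)) * cip (d * d) (e k) (app r \<psi>)) = of_real \<mu> * cip D x \<psi>" for x
  proof -
    have "cip D x (mapply D pull \<psi>) = cip D x (\<lambda>i. of_real \<mu> * \<psi> i)" using eig by (intro cip_cong) auto
    thus ?thesis by (simp only: pull_form cip_scale_right)
  qed
  show ?thesis
  proof (cases "\<forall>i<D. \<Psi> i = 0")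
    case True
    let ?u = "\<lambda>i :: nat. if i = 0 then 1 else (0 :: complex)"
    have u1: "nsq d ?u = 1"
      using d by (simp add: nsq_def if_distrib[of cmod] if_distrib[of "\<lambda>x. x\<^sup>2"] cong: if_cong)
    have ce: "cip (d * d) (e k) (\<lambda>p. if p = 0 then z else 0) = z * cnj (e k 0)" for k z
    proof -
      have "cip (d * d) (e k) (\<lambda>p. z * (if p = 0 then 1 else 0)) = z * cnj (e k 0)"
        unfolding cip_scale_right using d by (simp add: cip_def mult_indicator)
      moreover have "(\<lambda>p. z * (if p = 0 then 1 else 0)) = (\<lambda>p :: nat. if p = 0 then z else 0)" by auto
      ultimately show ?thesis by simp
    qed
    have pv: "pvec d ?u ?u = (\<lambda>p. if p = 0 then 1 else 0)"
      using d by (auto simp: pvec_def fun_eq_iff intro: ccontr)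
    define h where "h = (\<Sum>k<d * d. w k * (cmod (cip (d * d) (e k) (pvec d ?u ?u)))\<^sup>2)"
    have inl: "cip (d * d) (e k) (app (Inl (a, b)) \<psi>) = 0" if "a < d ^ m" "b < d ^ m" for k a b
    proof -
      have "cip (d * d) (e k) (app (Inl (a, b)) \<psi>) = cip (d * d) (e k) (\<lambda>_. 0)"
        using True that by (intro cip_cong) (simp_all add: app_Inl \<Psi>_def enc_D)
      thus ?thesis by (simp add: cip_def)
    qed
    have inr: "cip (d * d) (e k) (app (Inr j) \<psi>) = \<psi> j * cnj (e k 0)" if "j < D" for k j
    proof -
      have "app (Inr j) \<psi> = (\<lambda>p. if p = 0 then \<psi> j else 0)"
        using True that by (simp add: fun_eq_iff app_Inr \<Psi>_def)
      thus ?thesis by (simp only: ce)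
    qed
    have "of_real \<mu> * cip D \<psi> \<psi> = (\<Sum>j<D. \<Sum>k<d * d. of_real (w k) * cnj (\<psi> j * cnj (e k 0)) * (\<psi> j * cnj (e k 0)))"
      unfolding eq[symmetric] sum_index by (simp add: inl inr)
    also have "\<dots> = (\<Sum>j<D. cnj (\<psi> j) * \<psi> j) * (\<Sum>k<d * d. of_real (w k) * (e k 0 * cnj (e k 0)))"
      by (simp add: sum_product mult_ac)
    also have "(\<Sum>k<d * d. of_real (w k) * (e k 0 * cnj (e k 0))) = of_real h"
      unfolding h_def pv ce of_real_sum
      by (intro sum.cong refl) (simp add: complex_norm_square[symmetric] del: of_real_power)
    finally have "complex_of_real \<mu> = of_real h"
      using \<psi> by (simp add: cip_def[symmetric] cip_self)
    hence "\<mu> = h" by (simp only: of_real_eq_iff)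
    moreover have "0 \<le> sqrt (real d - 1) / (2 * real (Suc m))" using d by simp
    ultimately have "\<mu> \<le> h + sqrt (real d - 1) / (2 * real (Suc m))" by linarith
    thus ?thesis using u1 unfolding h_def by blast
  next
    case False
    have "(\<lambda>i. \<Sum>k<M. cip D (E k) \<psi> * E k i) \<in> bipow_span d (Suc m)"
      by (intro bipow_span_sum E_span)
    hence "\<Psi> \<in> bipow_span d (Suc m)" unfolding \<Psi>_def mapply_proj[abs_def] .
    then obtain K :: nat and c X Y
      where \<Psi>: "\<And>i. i < D \<Longrightarrow> \<Psi> i = (\<Sum>k<K. c k * bipow d (Suc m) (X k) (Y k) i)"
      unfolding bipow_span_def D by blast
    have form: "form d (Suc m) K c X Y x y = cip D (bipow d (Suc m) x y) \<Psi>" for x y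
    proof -
      have "cip D (bipow d (Suc m) x y) \<Psi> = cip D (bipow d (Suc m) x y) (\<lambda>i. \<Sum>k<K. c k * bipow d (Suc m) (X k) (Y k) i)"
        using \<Psi> by (intro cip_cong) auto
      thus ?thesis unfolding cip_sum_right cip_scale_right D cip_bipow by (simp only: form_def mult.assoc)
    qed
    \<comment> \<open>A combination of product powers that is orthogonal to all product powers is
      orthogonal to itself.\<close>
    have "\<exists>x y. form d (Suc m) K c X Y x y \<noteq> 0"
    proof (rule ccontr)
      assume "\<not> ?thesis"
      hence zero: "cip D (bipow d (Suc m) x y) \<Psi> = 0" for x y unfolding form by blast
      have "cip D \<Psi> \<Psi> = cip D (\<lambda>i. \<Sum>k<K. c k * bipow d (Suc m) (X k) (Y k) i) \<Psi>"
        using \<Psi> by (intro cip_cong) auto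
      also have "\<dots> = 0" unfolding cip_sum_left cip_scale_left zero by simp
      finally have "nsq D \<Psi> = 0" by (simp add: cip_self)
      thus False using False nsq_eq_0[of D \<Psi>] by blast
    qed
    then obtain u v where max: "max_at d (Suc m) K c X Y u v" and f0: "form d (Suc m) K c X Y u v \<noteq> 0"
      using max_at_exists[OF d] by blast
    define s where "s = bipow d (Suc m) u v"
    have "cip D s \<psi> = cip D (mapply D P s) \<psi>"
      unfolding s_def using P_fix by (intro cip_cong) auto
    hence s\<psi>: "cip D s \<psi> = form d (Suc m) K c X Y u v"
      unfolding mapply_hermitian[OF P_hermitian] form s_def \<Psi>_def .
    let ?t = "\<lambda>a b. tpow d m u a * tpow d m v b"
    have inl: "cip (d * d) (e k) (app (Inl (a, b)) s) = ?t a b * cip (d * d) (e k) (pvec d u v)"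
      if "a < d ^ m" "b < d ^ m" for k a b
      unfolding cip_scale_right[symmetric] s_def using that by (intro cip_cong) (simp_all add: app_bipow)
    have inr: "cip (d * d) (e k) (app (Inr j) s) = 0" if "j < D" for k j
      using that by (simp add: s_def cip_def app_bipow_Inr)
    \<comment> \<open>Summing over the labels of the discarded copies contracts
      \<open>\<Psi>\<close> with m copies of \<open>u\<close> and of \<open>v\<close>, which is the
      matrix \<open>polar_entry\<close>.\<close>
    have entry: "(\<Sum>a<d ^ m. \<Sum>b<d ^ m. cnj (?t a b) * app (Inl (a, b)) \<psi> p)
        = polar_entry d m K c X Y u v (p div d) (p mod d)" if "p < d * d" for p
    proof -
      have "(\<Sum>a<d ^ m. \<Sum>b<d ^ m. cnj (?t a b) * app (Inl (a, b)) \<psi> p)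
          = (\<Sum>a<d ^ m. \<Sum>b<d ^ m. \<Sum>k<K. (c k * (X k (p div d) * Y k (p mod d))) *
              ((cnj (tpow d m u a) * tpow d m (X k) a) * (cnj (tpow d m v b) * tpow d m (Y k) b)))"
      proof (intro sum.cong refl)
        fix a b assume "a \<in> {..<d ^ m}" "b \<in> {..<d ^ m}"
        hence ab: "a < d ^ m" "b < d ^ m" by auto
        have "app (Inl (a, b)) \<psi> p = \<Psi> (enc d (d ^ m) p a b)" by (simp add: app_Inl \<Psi>_def)
        also have "\<dots> = (\<Sum>k<K. c k * (X k (p div d) * Y k (p mod d) * (tpow d m (X k) a * tpow d m (Y k) b)))"
          using \<Psi>[OF enc_D[OF that ab]] bipow_enc[OF that ab] by simp
        finally show "cnj (?t a b) * app (Inl (a, b)) \<psi> p = (\<Sum>k<K. (c k * (X k (p div d) * Y k (p mod d))) *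
              ((cnj (tpow d m u a) * tpow d m (X k) a) * (cnj (tpow d m v b) * tpow d m (Y k) b)))"
          by (simp add: sum_distrib_left mult_ac)
      qed
      also have "\<dots> = (\<Sum>k<K. (c k * (X k (p div d) * Y k (p mod d))) *
          (cip (d ^ m) (tpow d m u) (tpow d m (X k)) * cip (d ^ m) (tpow d m v) (tpow d m (Y k))))"
        by (subst sum_rotate3) (simp only: cip_def sum_product, simp only: sum_distrib_left)
      finally show ?thesis unfolding cip_tpow polar_entry_def by (simp add: mult_ac)
    qed
    have "of_real \<mu> * form d (Suc m) K c X Y u v = (\<Sum>a<d ^ m. \<Sum>b<d ^ m. \<Sum>k<d * d.
        of_real (w k) * cnj (?t a b * cip (d * d) (e k) (pvec d u v)) * cip (d * d) (e k) (app (Inl (a, b)) \<psi>))"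
      unfolding s\<psi>[symmetric] eq[symmetric] sum_index by (simp add: inl inr)
    also have "\<dots> = (\<Sum>k<d * d. \<Sum>a<d ^ m. \<Sum>b<d ^ m.
        of_real (w k) * cnj (?t a b * cip (d * d) (e k) (pvec d u v)) * cip (d * d) (e k) (app (Inl (a, b)) \<psi>))"
      by (rule sum_rotate3)
    also have "\<dots> = (\<Sum>k<d * d. of_real (w k) * cnj (cip (d * d) (e k) (pvec d u v)) *
        cip (d * d) (e k) (\<lambda>p. \<Sum>a<d ^ m. \<Sum>b<d ^ m. cnj (?t a b) * app (Inl (a, b)) \<psi> p))"
      unfolding cip_sum_right cip_scale_right by (simp add: sum_distrib_left mult_ac)
    also have "\<dots> = (\<Sum>k<d * d. of_real (w k) * cnj (cip (d * d) (e k) (pvec d u v)) *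
        cip (d * d) (e k) (\<lambda>p. polar_entry d m K c X Y u v (p div d) (p mod d)))"
      using entry by (intro sum.cong refl arg_cong2[of _ _ _ _ "(*)"] cip_cong) auto
    finally have key: "(\<Sum>k<d * d. of_real (w k) * cnj (cip (d * d) (e k) (\<lambda>p. u (p div d) * v (p mod d))) *
        cip (d * d) (e k) (\<lambda>p. polar_entry d m K c X Y u v (p div d) (p mod d))) = of_real \<mu> * form d (Suc m) K c X Y u v"
      unfolding pvec_def by simp
    have "\<mu> \<le> (\<Sum>k<d * d. w k * (cmod (cip (d * d) (e k) (pvec d u v)))\<^sup>2) + sqrt (real d - 1) / (2 * real (Suc m))"
      unfolding pvec_def using max_at_product_bound[OF max f0 _ e w key] d by simp
    thus ?thesis using max unfolding max_at_def by blast
  qed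
qed

text \<open>The product state belongs to the largest eigenvalue of the pulled-back observable and
  depends on the observable only, not on \<rho>. The alternative 1 in the minimum is the trivial
  bound: an observable between 0 and 1 has expectations in [0, 1].\<close>

lemma response:
  assumes \<rho>: "\<rho> \<in> density_ops D"
  shows "\<exists>\<sigma>\<in>SEP d. (\<Sum>k<d * d. w k * (Re (qform (d * d) (entries (chan \<rho>)) (e k)) - Re (qform (d * d) (entries \<sigma>) (e k))))
    \<le> min 1 (sqrt (real d - 1) / (2 * real (Suc m)))"
proof -
  obtain F l where F: "orthonormal D D F"
    and spec: "\<And>i j. i < D \<Longrightarrow> j < D \<Longrightarrow> pull i j = (\<Sum>k<D. of_real (l k) * F k i * cnj (F k j))"
    and eig: "\<And>k i. k < D \<Longrightarrow> i < D \<Longrightarrow> mapply D pull (F k) i = of_real (l k) * F k i"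
    by (rule hermitian_spectral[OF pull_hermitian]) (rule that)
  have "0 < D" using d by (simp add: D)
  hence fin: "finite (l ` {..<D})" "l ` {..<D} \<noteq> {}" by auto
  obtain k0 where k0: "k0 < D" "l k0 = Max (l ` {..<D})" using Max_in[OF fin] by auto
  have lk: "l k \<le> l k0" if "k < D" for k using that fin k0(2) by simp
  obtain u v where uv: "nsq d u = 1" "nsq d v = 1"
    and le: "l k0 \<le> (\<Sum>k<d * d. w k * (cmod (cip (d * d) (e k) (pvec d u v)))\<^sup>2) + sqrt (real d - 1) / (2 * real (Suc m))"
    using pull_eigenvalue_bound[OF orthonormal_nsq[OF F k0(1)] eig[OF k0(1)]] by blast
  define \<sigma> where "\<sigma> = mat (d * d) (d * d) (\<lambda>(i, j). pvec d u v i * cnj (pvec d u v j))"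
  have \<sigma>: "\<sigma> \<in> SEP d" unfolding \<sigma>_def by (rule product_in_SEP[OF uv])
  have q\<sigma>: "Re (qform (d * d) (entries \<sigma>) (e k)) = (cmod (cip (d * d) (e k) (pvec d u v)))\<^sup>2" for k
  proof -
    have "qform (d * d) (entries \<sigma>) (e k) = qform (d * d) (\<lambda>i j. pvec d u v i * cnj (pvec d u v j)) (e k)"
      by (rule qform_cong) (simp add: \<sigma>_def)
    thus ?thesis unfolding qform_rank_one using cip_commute[of "d * d" "e k" "pvec d u v"] by simp
  qed
  define T where "T = (\<Sum>k<d * d. w k * Re (qform (d * d) (entries (chan \<rho>)) (e k)))"
  have pos: "0 \<le> Re (qform n (entries \<tau>) x)" if "\<tau> \<in> density_ops n" for n \<tau> x
    using density_opsD(2)[OF that, of x] by (simp add: less_eq_complex_def)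
  have one: "(\<Sum>k<n. Re (qform n (entries \<tau>) (f k))) = 1" if "\<tau> \<in> density_ops n" "orthonormal n n f" for n \<tau> f
    using trace_orthonormal[OF that(2), of "entries \<tau>"] density_opsD(3)[OF that(1)]
    by (metis Re_sum one_complex.sel(1))
  have T1: "T \<le> l k0"
  proof -
    have "complex_of_real T = complex_of_real (Re (\<Sum>k<d * d. of_real (w k) * qform (d * d) (entries (chan \<rho>)) (e k)))"
      by (simp add: T_def)
    also have "(\<Sum>k<d * d. of_real (w k) * qform (d * d) (entries (chan \<rho>)) (e k)) = (\<Sum>i<D. \<Sum>j<D. \<rho> $$ (i, j) * pull j i)"
      by (rule pull_trace)
    also have "\<dots> = (\<Sum>i<D. \<Sum>j<D. \<Sum>k<D. of_real (l k) * (cnj (F k i) * \<rho> $$ (i, j) * F k j))"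
      by (intro sum.cong refl) (simp add: spec sum_distrib_left mult_ac)
    also have "\<dots> = (\<Sum>k<D. of_real (l k) * qform D (entries \<rho>) (F k))"
      by (subst sum_rotate3) (simp only: qform_def sum_distrib_left)
    finally have "T = (\<Sum>k<D. l k * Re (qform D (entries \<rho>) (F k)))"
      by (simp only: of_real_eq_iff) simp
    also have "\<dots> \<le> (\<Sum>k<D. l k0 * Re (qform D (entries \<rho>) (F k)))"
      using lk pos[OF \<rho>] by (intro sum_mono mult_right_mono) auto
    also have "\<dots> = l k0" by (simp only: sum_distrib_left[symmetric] one[OF \<rho> F] mult_1_right)
    finally show ?thesis .
  qed
  have T2: "T \<le> 1"
  proof -
    have "T \<le> (\<Sum>k<d * d. 1 * Re (qform (d * d) (entries (chan \<rho>)) (e k)))"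
      unfolding T_def using w pos[OF chan_density[OF \<rho>]] by (intro sum_mono mult_right_mono) auto
    thus ?thesis using one[OF chan_density[OF \<rho>] e] by simp
  qed
  have S0: "0 \<le> (\<Sum>k<d * d. w k * (cmod (cip (d * d) (e k) (pvec d u v)))\<^sup>2)"
    using w by (intro sum_nonneg mult_nonneg_nonneg) auto
  have "(\<Sum>k<d * d. w k * (Re (qform (d * d) (entries (chan \<rho>)) (e k)) - Re (qform (d * d) (entries \<sigma>) (e k))))
      = T - (\<Sum>k<d * d. w k * (cmod (cip (d * d) (e k) (pvec d u v)))\<^sup>2)"
    by (simp add: T_def q\<sigma> right_diff_distrib sum_subtractf)
  also have "\<dots> \<le> min 1 (sqrt (real d - 1) / (2 * real (Suc m)))"
    using T1 T2 le S0 by linarith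
  finally show ?thesis using \<sigma> by blast
qed

end

lemma chan_disentangler:
  "disentangler D d (min 1 (sqrt (real d - 1) / (2 * real (Suc m)))) 0 chan"
  unfolding disentangler_def
proof (intro conjI)
  let ?\<epsilon> = "min 1 (sqrt (real d - 1) / (2 * real (Suc m)))"
  show "quantum_channel D (d * d) chan" by (rule chan_channel)
  show "(SUP \<rho>\<in>density_ops D. INF \<sigma>\<in>SEP d. ereal (trace_dist (chan \<rho>) \<sigma>)) \<le> ereal ?\<epsilon>"
  proof (rule SUP_least)
    fix \<rho> assume \<rho>: "\<rho> \<in> density_ops D"
    show "(INF \<sigma>\<in>SEP d. ereal (trace_dist (chan \<rho>) \<sigma>)) \<le> ereal ?\<epsilon>"
    proof (rule ereal_le_epsilon2)
      fix \<eta> :: real assume \<eta>: "0 < \<eta>"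
      have "0 \<le> ?\<epsilon>" using d by simp
      moreover have "0 < d * d" using d by simp
      ultimately have "\<exists>\<sigma>\<in>SEP d. trace_dist (chan \<rho>) \<sigma> \<le> ?\<epsilon> + \<eta>"
        by (intro minimax_trace_dist[OF chan_density[OF \<rho>] SEP_density _ _ _ _ \<eta>] SEP_convex response[OF _ _ \<rho>])
      then obtain \<sigma> where \<sigma>: "\<sigma> \<in> SEP d" "trace_dist (chan \<rho>) \<sigma> \<le> ?\<epsilon> + \<eta>" by blast
      hence "(INF \<sigma>\<in>SEP d. ereal (trace_dist (chan \<rho>) \<sigma>)) \<le> ereal (?\<epsilon> + \<eta>)"
        by (intro INF_lower2[OF \<sigma>(1)]) simp
      thus "(INF \<sigma>\<in>SEP d. ereal (trace_dist (chan \<rho>) \<sigma>)) \<le> ereal ?\<epsilon> + ereal \<eta>"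
        by (simp only: plus_ereal.simps)
    qed
  qed
  show "(SUP \<sigma>\<in>SEP d. INF \<rho>\<in>density_ops D. ereal (trace_dist (chan \<rho>) \<sigma>)) \<le> ereal 0"
  proof (rule SUP_least)
    fix \<sigma> assume \<sigma>: "\<sigma> \<in> SEP d"
    obtain \<rho> where \<rho>: "\<rho> \<in> density_ops D" "chan \<rho> = \<sigma>" using coverage[OF \<sigma>] by blast
    have car: "\<sigma> \<in> carrier_mat (d * d) (d * d)" using \<sigma> SEP_density density_opsD(1) by blast
    have "trace_norm (\<sigma> - \<sigma>) \<le> Re (\<Sum>i<d * d. 0) + Re (\<Sum>i<d * d. 0) + real (d * d) * 0"
      by (rule trace_norm_bound[where P = "\<lambda>_ _. 0" and Q = "\<lambda>_ _. 0" and R = "\<lambda>_ _. 0"])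
        (use car in \<open>auto simp: hermitian_def qform_def\<close>)
    hence "trace_dist (chan \<rho>) \<sigma> \<le> 0" by (simp add: trace_dist_def \<rho>(2))
    thus "(INF \<rho>\<in>density_ops D. ereal (trace_dist (chan \<rho>) \<sigma>)) \<le> ereal 0"
      by (intro INF_lower2[OF \<rho>(1)]) simp
  qed
qed

end

section \<open>Instantiating the channel and choosing the number of copies\<close>

lemma disentangler_exists:
  assumes d: "2 \<le> d" and n: "1 \<le> n"
  shows "\<exists>\<Lambda>. disentangler (d ^ n * d ^ n) d (min 1 (sqrt (real d - 1) / (2 * real n))) 0 \<Lambda>"
proof -
  obtain m where m: "n = Suc m" using n by (cases n) auto
  obtain M E where E: "orthonormal (d ^ n * d ^ n) M E" "\<And>k. k < M \<Longrightarrow> E k \<in> bipow_span d n"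
    "\<And>x y i. i < d ^ n * d ^ n \<Longrightarrow> (\<Sum>k<M. cip (d ^ n * d ^ n) (E k) (bipow d n x y) * E k i) = bipow d n x y i"
    by (rule bipow_span_projection[OF refl]) (rule that)
  have "copies_channel d m (d ^ Suc m * d ^ Suc m) M E"
    by (rule copies_channel.intro[OF _ refl E[unfolded m]]) (use d in simp)
  from copies_channel.chan_disentangler[OF this] show ?thesis unfolding m by blast
qed

lemma disentangler_mono:
  assumes "disentangler D d \<epsilon> \<delta> \<Lambda>" "\<epsilon> \<le> \<epsilon>'"
  shows "disentangler D d \<epsilon>' \<delta> \<Lambda>"
proof -
  have "ereal \<epsilon> \<le> ereal \<epsilon>'" using assms(2) by simp
  thus ?thesis using assms(1) unfolding disentangler_def
    by (elim conjE) (intro conjI; (assumption | erule order_trans))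
qed

text \<open>Slightly more than sqrt d / (2 \<epsilon>) copies bring the error below \<epsilon>. The
  logarithm of the dimension d^(2 n) is 2 n ln d, where 2 n \<le> sqrt d / \<epsilon> + 2; the 2
  from rounding is absorbed into 2 sqrt d, which gives the constant 1 / \<epsilon> + 2.\<close>

lemma disentangler_small:
  assumes \<epsilon>: "0 < \<epsilon>"
  shows "\<exists>C>0. \<forall>d::nat. 2 \<le> d \<longrightarrow> (\<exists>(D::nat) \<Lambda>. 1 \<le> D \<and> disentangler D d \<epsilon> 0 \<Lambda> \<and>
    ln (real D) \<le> C * sqrt (real d) * ln (real d))"
proof (intro exI[of _ "1 / \<epsilon> + 2"] conjI allI impI)
  show "0 < 1 / \<epsilon> + 2" using \<epsilon> by (simp add: add_pos_pos)
  fix d :: nat assume d: "2 \<le> d"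
  define n where "n = Suc (nat \<lfloor>sqrt (real d) / (2 * \<epsilon>)\<rfloor>)"
  have x0: "0 \<le> sqrt (real d) / (2 * \<epsilon>)" using \<epsilon> by simp
  have n_ge: "sqrt (real d) / (2 * \<epsilon>) \<le> real n" and n_le: "real n \<le> sqrt (real d) / (2 * \<epsilon>) + 1"
    using x0 by (simp_all add: n_def of_nat_nat) linarith+
  have n1: "1 \<le> n" by (simp add: n_def)
  obtain \<Lambda> where \<Lambda>: "disentangler (d ^ n * d ^ n) d (min 1 (sqrt (real d - 1) / (2 * real n))) 0 \<Lambda>"
    using disentangler_exists[OF d n1] by blast
  have "sqrt (real d - 1) \<le> sqrt (real d)" by simp
  also have "\<dots> \<le> \<epsilon> * (2 * real n)" using n_ge \<epsilon> by (simp add: field_simps)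
  finally have "sqrt (real d - 1) / (2 * real n) \<le> \<epsilon>" using n1 by (simp add: divide_le_eq)
  hence dis: "disentangler (d ^ n * d ^ n) d \<epsilon> 0 \<Lambda>" using disentangler_mono[OF \<Lambda>] by simp
  have s1: "1 \<le> sqrt (real d)" using d by simp
  have "real (2 * n) \<le> (1 / \<epsilon> + 2) * sqrt (real d)"
  proof -
    have "2 * real n \<le> 2 * (sqrt (real d) / (2 * \<epsilon>) + 1)" using n_le by simp
    also have "\<dots> = 1 / \<epsilon> * sqrt (real d) + 2" by (simp add: field_simps)
    also have "\<dots> \<le> (1 / \<epsilon> + 2) * sqrt (real d)" using s1 by (simp add: distrib_right)
    finally show ?thesis by simp
  qed
  moreover have "0 \<le> ln (real d)" using d by simp
  ultimately have "real (2 * n) * ln (real d) \<le> (1 / \<epsilon> + 2) * sqrt (real d) * ln (real d)"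
    by (rule mult_right_mono)
  moreover have "ln (real (d ^ n * d ^ n)) = real (2 * n) * ln (real d)"
  proof -
    have "real (d ^ n * d ^ n) = real d ^ (2 * n)" by (simp add: power_add[symmetric] mult_2)
    thus ?thesis using d by (simp only: ln_realpow)
  qed
  ultimately have "ln (real (d ^ n * d ^ n)) \<le> (1 / \<epsilon> + 2) * sqrt (real d) * ln (real d)" by simp
  moreover have "1 \<le> d ^ n * d ^ n" using d by simp
  ultimately show "\<exists>(D::nat) \<Lambda>. 1 \<le> D \<and> disentangler D d \<epsilon> 0 \<Lambda> \<and>
      ln (real D) \<le> (1 / \<epsilon> + 2) * sqrt (real d) * ln (real d)"
    using dis by blast
qed

theorem theorem5p1:
  shows "(\<forall>d n :: nat. 2 \<le> d \<longrightarrow> 1 \<le> n \<longrightarrow>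
           (\<exists>\<Lambda>. disentangler (d ^ n * d ^ n) d (min 1 (sqrt (real d - 1) / (2 * real n))) 0 \<Lambda>)) \<and>
         (\<forall>\<epsilon> :: real. 0 < \<epsilon> \<longrightarrow> \<epsilon> < 1 \<longrightarrow>
           (\<exists>C > 0. \<forall>d :: nat. 2 \<le> d \<longrightarrow>
             (\<exists>(D :: nat) \<Lambda>. 1 \<le> D \<and> disentangler D d \<epsilon> 0 \<Lambda> \<and>
                ln (real D) \<le> C * sqrt (real d) * ln (real d)))) \<and>
         (\<exists>C > 0. \<forall>d :: nat. 2 \<le> d \<longrightarrow>
           (\<exists>(D :: nat) \<Lambda>. 1 \<le> D \<and> disentangler D d (1 / 4) 0 \<Lambda> \<and>
              ln (real D) \<le> C * sqrt (real d) * ln (real d)))"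
proof (intro conjI allI impI)
  show "\<exists>\<Lambda>. disentangler (d ^ n * d ^ n) d (min 1 (sqrt (real d - 1) / (2 * real n))) 0 \<Lambda>"
    if "2 \<le> d" "1 \<le> n" for d n
    using that by (rule disentangler_exists)
  show "\<exists>C>0. \<forall>d::nat. 2 \<le> d \<longrightarrow> (\<exists>(D::nat) \<Lambda>. 1 \<le> D \<and> disentangler D d \<epsilon> 0 \<Lambda> \<and>
      ln (real D) \<le> C * sqrt (real d) * ln (real d))" if "0 < \<epsilon>" for \<epsilon>
    using that by (rule disentangler_small)
  show "\<exists>C>0. \<forall>d::nat. 2 \<le> d \<longrightarrow> (\<exists>(D::nat) \<Lambda>. 1 \<le> D \<and> disentangler D d (1 / 4) 0 \<Lambda> \<and>
      ln (real D) \<le> C * sqrt (real d) * ln (real d))"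
    by (rule disentangler_small) simp
qed

end
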